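(* Assume that $\mathcal A$ is bounded and let $f\in H$. Then the dynamics of the real-valued process $V(t;f):=\mathcal L_f(\mathcal V(t))=\langle Y(t),f\rangle^2$ is $$dV(t;f)=\left(V(t;f)+|Q_W^{1/2}\eta^*f|^2+\mathcal L_{\mathcal A^*f}(\mathcal V(t))-\mathcal L_{(\mathcal A^*-\mathrm{Id})f}(\mathcal V(t))\right)dt+2\,|Q_W^{1/2}\eta^*f|\,\sqrt{V(t;f)}\,dw(t),\qquad t\ge0,$$ where $w$ is a real-valued Wiener process.
   Context: $(\Omega,\mathcal F,\{\mathcal F_t\}_{t\ge0},\mathbb P)$ is a filtered probability space. $H$ is a real separable Hilbert space with inner product $\langle\cdot,\cdot\rangle$ and norm $|\cdot|$; $L(H)$ is the space of bounded linear operators on $H$; $\mathcal H=L_{HS}(H)$ is the Hilbert space of Hilbert-Schmidt operators on $H$ with inner product $\langle\langle\cdot,\cdot\rangle\rangle$; $\mathrm{Id}$ is the identity on $H$. For $f,g\in H$ the tensor product is the operator $f\otimes g:=\langle f,\cdot\rangle g$, and $f^{\otimes2}:=f\otimes f$. For $f\in H$, the linear functional $\mathcal L_f:\mathcal H\to\mathbb R$ is $\mathcal L_f(\mathcal T):=\langle\langle\mathcal T,f^{\otimes2}\rangle\rangle=\langle\mathcal T(f),f\rangle$. $\{W(t)\}_{t\ge0}$ is an $H$-valued $\mathcal F_t$-Wiener process with covariance operator $Q_W$ (symmetric, positive definite, trace class), $\eta\in L(H)$, $Y_0\in H$. $\{Y(t)\}_{t\ge0}$ is the solution of $dY(t)=\mathcal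 AY(t)\,dt+\eta\,dW(t)$, $Y(0)=Y_0$; when $\mathcal A\in L(H)$ this is a strong solution. The tensor Heston stochastic variance process is $\mathcal V(t):=Y(t)^{\otimes2}$. The assertion is that there is a real-valued Wiener process $w$ (depending on $f$) for which the stated equation holds. *)

theory Defs
  imports "HOL-Probability.Probability"
begin

section \<open>Bounded operators on a Hilbert space\<close>

text \<open>
  A real separable Hilbert space is a type of sort
  \<open>{real_inner, banach, second_countable_topology}\<close>.
\<close>

definition adj :: "('h::{real_inner,banach} \<Rightarrow>\<^sub>L 'h) \<Rightarrow> ('h \<Rightarrow>\<^sub>L 'h)" where
  "adj T = Blinfun (adjoint (blinfun_apply T))"

definition self_adjoint :: "('h::{real_inner,banach} \<Rightarrow>\<^sub>L 'h) \<Rightarrow> bool" where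
  "self_adjoint T \<longleftrightarrow> (\<forall>x y. T x \<bullet> y = x \<bullet> T y)"

definition nonneg_definite :: "('h::{real_inner,banach} \<Rightarrow>\<^sub>L 'h) \<Rightarrow> bool" where
  "nonneg_definite T \<longleftrightarrow> (\<forall>x. 0 \<le> T x \<bullet> x)"

definition positive_definite :: "('h::{real_inner,banach} \<Rightarrow>\<^sub>L 'h) \<Rightarrow> bool" where
  "positive_definite T \<longleftrightarrow> (\<forall>x. x \<noteq> 0 \<longrightarrow> 0 < T x \<bullet> x)"

text \<open>Only meaningful for self-adjoint nonnegative definite \<open>T\<close>.\<close>

definition op_sqrt :: "('h::{real_inner,banach} \<Rightarrow>\<^sub>L 'h) \<Rightarrow> ('h \<Rightarrow>\<^sub>L 'h)" where
  "op_sqrt T = (THE R. self_adjoint R \<and> nonneg_definite R \<and> R o\<^sub>L R = T)"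

definition orthonormal_basis :: "'h::{real_inner,banach} set \<Rightarrow> bool" where
  "orthonormal_basis B \<longleftrightarrow>
     pairwise orthogonal B \<and> (\<forall>e\<in>B. norm e = 1) \<and> closure (span B) = UNIV"

text \<open>The operator \<open>op_sqrt (adj T o\<^sub>L T)\<close> is the absolute value of \<open>T\<close>.\<close>

definition trace_class :: "('h::{real_inner,banach} \<Rightarrow>\<^sub>L 'h) \<Rightarrow> bool" where
  "trace_class T \<longleftrightarrow>
     (\<forall>B. orthonormal_basis B \<longrightarrow> (\<lambda>e. op_sqrt (adj T o\<^sub>L T) e \<bullet> e) summable_on B)"

text \<open>
  The Hilbert-Schmidt inner product; for Hilbert-Schmidt operators \<open>S\<close> and \<open>T\<close> the sum
  does not depend on the orthonormal basis.
\<close>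

definition hs_inner :: "('h::{real_inner,banach} \<Rightarrow>\<^sub>L 'h) \<Rightarrow> ('h \<Rightarrow>\<^sub>L 'h) \<Rightarrow> real" where
  "hs_inner S T = (\<Sum>\<^sub>\<infinity>e\<in>(SOME B. orthonormal_basis B). S e \<bullet> T e)"

definition tensor :: "'h::{real_inner,banach} \<Rightarrow> 'h \<Rightarrow> ('h \<Rightarrow>\<^sub>L 'h)" (infixr "\<otimes>\<^sub>H" 75) where
  "f \<otimes>\<^sub>H g = Blinfun (\<lambda>x. (f \<bullet> x) *\<^sub>R g)"

lemma tensor_apply [simp]: "(f \<otimes>\<^sub>H g) x = (f \<bullet> x) *\<^sub>R g"
proof -
  have "bounded_linear (\<lambda>x. (f \<bullet> x) *\<^sub>R g)"
    by (intro bounded_linear_intros)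
  then show ?thesis
    by (simp add: tensor_def bounded_linear_Blinfun_apply)
qed

definition Lfun :: "'h::{real_inner,banach} \<Rightarrow> ('h \<Rightarrow>\<^sub>L 'h) \<Rightarrow> real" where
  "Lfun f T = hs_inner T (f \<otimes>\<^sub>H f)"


section \<open>Filtrations and Wiener processes\<close>

text \<open>
  Time is \<open>[0,\<infinity>)\<close> inside \<open>real\<close>.  The filtration carries irrelevant values at
  negative times; a filtration on \<open>[0,\<infinity>)\<close> can be extended by its value at \<open>0\<close>.
\<close>

locale filtered_prob_space = prob_space M + filtration "space M" F
  for M :: "'w measure" and F :: "real \<Rightarrow> 'w measure" +
  assumes sets_F_subset: "\<And>t. sets (F t) \<subseteq> sets M"

definition adapted ::
    "(real \<Rightarrow> 'w measure) \<Rightarrow> (real \<Rightarrow> 'w \<Rightarrow> 'b::topological_space) \<Rightarrow> bool" where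
  "adapted F X \<longleftrightarrow> (\<forall>t\<ge>0. X t \<in> borel_measurable (F t))"

definition progressive ::
    "(real \<Rightarrow> 'w measure) \<Rightarrow> (real \<Rightarrow> 'w \<Rightarrow> 'b::topological_space) \<Rightarrow> bool" where
  "progressive F X \<longleftrightarrow>
     (\<forall>t\<ge>0. (\<lambda>(s, \<omega>). X s \<omega>) \<in> borel_measurable (restrict_space borel {0..t} \<Otimes>\<^sub>M F t))"

text \<open>The centred normal law with variance \<open>v\<close>, a point mass if \<open>v = 0\<close>.\<close>

definition centred_normal :: "real \<Rightarrow> real measure" where
  "centred_normal v =
     (if v = 0 then return borel 0 else density lborel (\<lambda>x. ennreal (normal_density 0 (sqrt v) x)))"

text \<open>
  Wiener process with covariance operator \<open>Q\<close> relative to the filtration \<open>F\<close>: the increment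
  over \<open>[s,t]\<close> is independent of \<open>F s\<close> and is Gaussian with mean zero and covariance
  operator \<open>(t - s) Q\<close>, that is, all its one-dimensional projections are centred normal with
  the corresponding variance.
\<close>

definition wiener_process ::
    "'w measure \<Rightarrow> (real \<Rightarrow> 'w measure) \<Rightarrow>
     ('h::{real_inner,banach,second_countable_topology} \<Rightarrow>\<^sub>L 'h) \<Rightarrow> (real \<Rightarrow> 'w \<Rightarrow> 'h) \<Rightarrow> bool" where
  "wiener_process M F Q W \<longleftrightarrow>
     adapted F W \<and>
     (AE \<omega> in M. W 0 \<omega> = 0) \<and>
     (AE \<omega> in M. continuous_on {0..} (\<lambda>t. W t \<omega>)) \<and>
     (\<forall>s t. 0 \<le> s \<and> s < t \<longrightarrow>
        prob_space.indep_set M (sets (F s))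
          (sets (vimage_algebra (space M) (\<lambda>\<omega>. W t \<omega> - W s \<omega>) borel)) \<and>
        (\<forall>h. distr M borel (\<lambda>\<omega>. (W t \<omega> - W s \<omega>) \<bullet> h) = centred_normal ((t - s) * (Q h \<bullet> h))))"

abbreviation real_wiener_process ::
    "'w measure \<Rightarrow> (real \<Rightarrow> 'w measure) \<Rightarrow> (real \<Rightarrow> 'w \<Rightarrow> real) \<Rightarrow> bool" where
  "real_wiener_process M F w \<equiv> wiener_process M F id_blinfun w"


section \<open>The Ito integral\<close>

text \<open>
  A simple process is given by a number \<open>n\<close> of steps, grid points \<open>\<tau> 0 \<le> \<dots> \<le> \<tau> n\<close> and
  heights \<open>\<xi>\<close>; its value on \<open>(\<tau> i, \<tau> (i + 1)]\<close> is \<open>\<xi> i\<close>.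
\<close>

definition simple_process ::
    "'w measure \<Rightarrow> (real \<Rightarrow> 'w measure) \<Rightarrow> nat \<Rightarrow> (nat \<Rightarrow> real) \<Rightarrow> (nat \<Rightarrow> 'w \<Rightarrow> real) \<Rightarrow> bool" where
  "simple_process M F n \<tau> \<xi> \<longleftrightarrow>
     0 \<le> \<tau> 0 \<and> (\<forall>i<n. \<tau> i \<le> \<tau> (Suc i)) \<and>
     (\<forall>i<n. \<xi> i \<in> borel_measurable (F (\<tau> i)) \<and> bounded (\<xi> i ` space M))"

definition simple_value ::
    "nat \<Rightarrow> (nat \<Rightarrow> real) \<Rightarrow> (nat \<Rightarrow> 'w \<Rightarrow> real) \<Rightarrow> real \<Rightarrow> 'w \<Rightarrow> real" where
  "simple_value n \<tau> \<xi> s \<omega> = (\<Sum>i<n. \<xi> i \<omega> * indicator {\<tau> i<..\<tau> (Suc i)} s)"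

definition simple_integral_process ::
    "(real \<Rightarrow> 'w \<Rightarrow> real) \<Rightarrow> nat \<Rightarrow> (nat \<Rightarrow> real) \<Rightarrow> (nat \<Rightarrow> 'w \<Rightarrow> real) \<Rightarrow> real \<Rightarrow> 'w \<Rightarrow> real" where
  "simple_integral_process w n \<tau> \<xi> t \<omega> =
     (\<Sum>i<n. \<xi> i \<omega> * (w (min (\<tau> (Suc i)) t) \<omega> - w (min (\<tau> i) t) \<omega>))"

text \<open>
  The process \<open>I\<close> is (a version of) the Ito integral process of \<open>\<sigma>\<close> with respect to the
  Wiener process \<open>w\<close>: simple processes approximate \<open>\<sigma>\<close> in \<open>L\<^sup>2[0,T]\<close> and their integrals
  approximate \<open>I\<close> uniformly on \<open>[0,T]\<close>, for all \<open>T\<close>, almost surely.  Asking for convergence in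
  probability in both places would give the same notion, by passing to a subsequence; it determines
  \<open>I\<close> up to indistinguishability.
\<close>

definition ito_integral ::
    "'w measure \<Rightarrow> (real \<Rightarrow> 'w measure) \<Rightarrow> (real \<Rightarrow> 'w \<Rightarrow> real) \<Rightarrow>
     (real \<Rightarrow> 'w \<Rightarrow> real) \<Rightarrow> (real \<Rightarrow> 'w \<Rightarrow> real) \<Rightarrow> bool" where
  "ito_integral M F w \<sigma> I \<longleftrightarrow>
     progressive F \<sigma> \<and>
     (AE \<omega> in M. \<forall>T\<ge>0. set_integrable lborel {0..T} (\<lambda>s. (\<sigma> s \<omega>)\<^sup>2)) \<and>
     adapted F I \<and>
     (\<exists>n \<tau> \<xi>. (\<forall>k. simple_process M F (n k) (\<tau> k) (\<xi> k)) \<and>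
        (AE \<omega> in M. \<forall>T\<ge>0.
           ((\<lambda>k. \<integral>\<^sup>+s\<in>{0..T}. ennreal ((simple_value (n k) (\<tau> k) (\<xi> k) s \<omega> - \<sigma> s \<omega>)\<^sup>2) \<partial>lborel)
              \<longlonglongrightarrow> 0) \<and>
           uniform_limit {0..T} (\<lambda>k t. simple_integral_process w (n k) (\<tau> k) (\<xi> k) t \<omega>)
             (\<lambda>t. I t \<omega>) sequentially))"

text \<open>\<open>dX(t) = b(t) dt + \<sigma>(t) dw(t)\<close> for \<open>t \<ge> 0\<close>.\<close>

definition has_ito_differential ::
    "'w measure \<Rightarrow> (real \<Rightarrow> 'w measure) \<Rightarrow> (real \<Rightarrow> 'w \<Rightarrow> real) \<Rightarrow>
     (real \<Rightarrow> 'w \<Rightarrow> real) \<Rightarrow> (real \<Rightarrow> 'w \<Rightarrow> real) \<Rightarrow> (real \<Rightarrow> 'w \<Rightarrow> real) \<Rightarrow> bool" where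
  "has_ito_differential M F w X b \<sigma> \<longleftrightarrow>
     (\<exists>I. ito_integral M F w \<sigma> I \<and>
        (AE \<omega> in M. \<forall>t\<ge>0. set_integrable lborel {0..t} (\<lambda>s. b s \<omega>) \<and>
           X t \<omega> = X 0 \<omega> + (LINT s:{0..t}|lborel. b s \<omega>) + I t \<omega>))"


section \<open>The tensor Heston stochastic variance process\<close>

text \<open>
  Strong solution of \<open>dY(t) = A Y(t) dt + \<eta> dW(t)\<close>, \<open>Y(0) = Y\<^sub>0\<close>, for bounded \<open>A\<close>.  The
  noise is additive, so the stochastic integral of the constant operator \<open>\<eta>\<close> is \<open>\<eta> (W t)\<close>.
\<close>

definition strong_solution ::
    "'w measure \<Rightarrow> (real \<Rightarrow> 'w measure) \<Rightarrow>
     ('h::{real_inner,banach,second_countable_topology} \<Rightarrow>\<^sub>L 'h) \<Rightarrow> ('h \<Rightarrow>\<^sub>L 'h) \<Rightarrow>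
     (real \<Rightarrow> 'w \<Rightarrow> 'h) \<Rightarrow> 'h \<Rightarrow> (real \<Rightarrow> 'w \<Rightarrow> 'h) \<Rightarrow> bool" where
  "strong_solution M F A \<eta> W Y\<^sub>0 Y \<longleftrightarrow>
     progressive F Y \<and>
     (AE \<omega> in M. \<forall>t\<ge>0. set_integrable lborel {0..t} (\<lambda>s. A (Y s \<omega>)) \<and>
        Y t \<omega> = Y\<^sub>0 + (LINT s:{0..t}|lborel. A (Y s \<omega>)) + \<eta> (W t \<omega>))"

definition heston_variance ::
    "(real \<Rightarrow> 'w \<Rightarrow> 'h::{real_inner,banach}) \<Rightarrow> real \<Rightarrow> 'w \<Rightarrow> ('h \<Rightarrow>\<^sub>L 'h)" where
  "heston_variance Y t \<omega> = Y t \<omega> \<otimes>\<^sub>H Y t \<omega>"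

end

theory Submission
  imports Defs
begin

text \<open>
  With \<open>X = \<langle>Y, f\<rangle>\<close>, \<open>g = \<langle>Y, A\<^sup>* f\<rangle>\<close> and \<open>c = |Q\<^sup>1\<^sup>/\<^sup>2 \<eta>\<^sup>* f|\<close> the equation projects to
  \<open>dX = g dt + c dB\<close> for the Wiener process \<open>B = \<langle>W, \<eta>\<^sup>* f\<rangle> / c\<close>, hence
  \<open>d(X\<^sup>2) = (c\<^sup>2 + 2 X g) dt + 2 c X dB\<close>, and polarization turns \<open>2 X g\<close> into the stated drift.
  The process \<open>w\<close> is the integral of \<open>sign X\<close> against \<open>B\<close>, so that \<open>|X| dw = X dB\<close>.  It is the
  limit of the integrals of signs frozen on dyadic time intervals; each of these is itself a Wiener
  process, because an independent sign does not change a centred Gaussian increment, so no general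
  characterization of Brownian motion is needed.  The limit exists because \<open>X\<close> vanishes at
  any fixed positive time with probability zero.  If \<open>c = 0\<close>, any Wiener process serves as \<open>w\<close>, and one
  exists because \<open>Q\<close> is positive definite and the space is not trivial.
\<close>

section \<open>Operators on a Hilbert space\<close>

text \<open>The definition \<open>ito_integral\<close> demands simple integrals that converge almost
  surely and uniformly on every compact interval, so each mean square estimate has to become a
  summable series of probabilities. Hence the recurring pattern: a horizon and a truncation height
  that grow with the index \<open>j\<close>, a geometric bound, a maximal inequality and
  Borel-Cantelli. One sequence of levels \<open>\<kappa> j\<close> carries everything: the mesh is
  at most (1/8)^j, and the sign integral frozen at level \<open>\<kappa> j\<close> lies within
  (1/8)^j in squared mean of all finer ones. The rate 1/8 pays for the squared thresholds and for
  the factor j^2 caused by truncating the integrand at height j. The filtration is not completed, so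
  \<open>w\<close> and the integral process are defined by \<open>lim\<close> at every sample point,
  which keeps them adapted.\<close>

lemma riesz_representation:
  fixes \<phi> :: "'h::{real_inner,banach} \<Rightarrow> real"
  assumes "bounded_linear \<phi>"
  shows "\<exists>v. \<forall>x. \<phi> x = v \<bullet> x"
proof -
  interpret \<phi>: bounded_linear \<phi> by fact
  obtain K where K: "\<And>x. norm (\<phi> x) \<le> norm x * K" using \<phi>.bounded by blast
  \<comment> \<open>If \<phi> is represented by v, then J x = |x - v|^2 - |v|^2; the representing
    vector is therefore sought as the minimiser of J.\<close>
  define J where "J x = x \<bullet> x - 2 * \<phi> x" for x
  have lower: "J x \<ge> - K\<^sup>2" for x
  proof -
    have "\<phi> x \<le> norm x * K" using K[of x] by simp
    moreover have "0 \<le> (norm x - K)\<^sup>2" by simp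
    ultimately show ?thesis
      unfolding J_def power2_norm_eq_inner[symmetric]
      by (simp add: power2_diff)
  qed
  define m where "m = Inf (range J)"
  have bdd: "bdd_below (range J)" using lower by (intro bdd_belowI[of _ "-K\<^sup>2"]) auto
  have m_le: "m \<le> J x" for x unfolding m_def using bdd by (intro cInf_lower) auto
  have "\<exists>x. J x < m + 1 / Suc n" for n
  proof -
    have "m < m + 1 / Suc n" by simp
    then show ?thesis
      using cInf_lessD[of "range J" "m + 1 / Suc n"] unfolding m_def by auto
  qed
  then obtain x where x: "\<And>n. J (x n) < m + 1 / Suc n" by metis
  \<comment> \<open>The parallelogram law at the midpoint of y and z: nearly minimal points are
    close to each other, so a minimising sequence is Cauchy.\<close>
  have par: "(norm (y - z))\<^sup>2 \<le> 2 * ((J y - m) + (J z - m))" for y z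
  proof -
    have "J y + J z - 2 * J ((1/2) *\<^sub>R (y + z)) = (norm (y - z))\<^sup>2 / 2"
      unfolding J_def power2_norm_eq_inner \<phi>.scaleR \<phi>.add
      by (simp add: algebra_simps inner_commute)
    with m_le[of "(1/2) *\<^sub>R (y + z)"] show ?thesis by simp
  qed
  have "Cauchy x"
  proof (rule metric_CauchyI)
    fix e :: real assume "e > 0"
    then obtain N where N: "1 / Suc N < e\<^sup>2 / 4"
      using reals_Archimedean[of "e\<^sup>2 / 4"] by (auto simp: inverse_eq_divide)
    have "dist (x i) (x j) < e" if "i \<ge> N" "j \<ge> N" for i j
    proof -
      have *: "1 / Suc i \<le> 1 / Suc N" "1 / Suc j \<le> 1 / Suc N"
        using that by (auto simp: field_simps)
      have "(norm (x i - x j))\<^sup>2 < e\<^sup>2"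
        using par[of "x i" "x j"] x[of i] x[of j] N * by simp
      then show ?thesis
        using \<open>e > 0\<close> by (simp add: dist_norm power2_less_imp_less)
    qed
    then show "\<exists>N. \<forall>i\<ge>N. \<forall>j\<ge>N. dist (x i) (x j) < e" by blast
  qed
  then obtain v where v: "x \<longlonglongrightarrow> v" using Cauchy_convergent_iff convergent_def by blast
  have "(\<lambda>n. J (x n)) \<longlonglongrightarrow> J v" unfolding J_def
    by (intro tendsto_intros v \<phi>.tendsto)
  moreover have "(\<lambda>n. m + 1 / Suc n) \<longlonglongrightarrow> m + 0"
    by (intro tendsto_intros LIMSEQ_Suc[OF lim_inverse_n'])
  ultimately have "J v \<le> m + 0"
    using x by (intro LIMSEQ_le[of "\<lambda>n. J (x n)" _ "\<lambda>n. m + 1 / Suc n"]) (auto intro: less_imp_le)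
  then have J_min: "J v \<le> J y" for y using m_le[of y] by simp
  have "\<phi> y = v \<bullet> y" for y
  proof (rule ccontr)
    assume neq: "\<phi> y \<noteq> v \<bullet> y"
    define d where "d = \<phi> y - v \<bullet> y"
    have "y \<noteq> 0" using neq \<phi>.zero by auto
    then have yy: "y \<bullet> y > 0" by simp
    \<comment> \<open>The multiple d / |y|^2 is the optimal step from v in the direction y; it would
      lower J by d^2 / |y|^2.\<close>
    have "J (v + (d / (y \<bullet> y)) *\<^sub>R y) = J v - d\<^sup>2 / (y \<bullet> y)"
      unfolding J_def \<phi>.scaleR \<phi>.add d_def using yy
      by (simp add: field_simps inner_add inner_commute power2_eq_square)
    moreover have "d\<^sup>2 / (y \<bullet> y) > 0" using yy neq by (simp add: d_def)
    ultimately show False using J_min[of "v + (d / (y \<bullet> y)) *\<^sub>R y"] by simp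
  qed
  then show ?thesis by blast
qed

text \<open>\<open>adjoint\<close> is a choice operator and \<open>Blinfun\<close> is meaningful
  only on bounded linear maps. Riesz shows that the choice succeeds, and boundedness is then derived
  from the adjoint identity itself.\<close>

lemma inner_adj:
  fixes T :: "'h::{real_inner,banach} \<Rightarrow>\<^sub>L 'h"
  shows "T x \<bullet> y = x \<bullet> adj T y"
proof -
  have "\<exists>v. \<forall>x. T x \<bullet> y = v \<bullet> x" for y
    by (rule riesz_representation) (intro bounded_linear_intros)
  then obtain T' where T': "\<And>x y. T x \<bullet> y = T' y \<bullet> x" by metis
  then have "\<exists>T'. \<forall>x y. T x \<bullet> y = x \<bullet> T' y" by (auto simp: inner_commute intro!: exI[of _ T'])
  then have a: "T x \<bullet> y = x \<bullet> adjoint (blinfun_apply T) y" for x y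
    unfolding adjoint_def by (rule someI2_ex) auto
  have eqI: "u = v" if "\<And>x::'h. x \<bullet> u = x \<bullet> v" for u v
  proof -
    have "(u - v) \<bullet> (u - v) = 0" using that[of "u - v"] by (simp add: inner_diff_right)
    then show ?thesis by simp
  qed
  have "bounded_linear (adjoint (blinfun_apply T))"
  proof (rule bounded_linear_intro)
    show "adjoint (blinfun_apply T) (x + y) =
        adjoint (blinfun_apply T) x + adjoint (blinfun_apply T) y" for x y
      by (rule eqI) (simp add: a[symmetric] inner_add_right)
    show "adjoint (blinfun_apply T) (r *\<^sub>R x) = r *\<^sub>R adjoint (blinfun_apply T) x" for r x
      by (rule eqI) (simp add: a[symmetric])
    show "norm (adjoint (blinfun_apply T) y) \<le> norm y * norm T" for y
    proof -
      let ?z = "adjoint (blinfun_apply T) y"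
      \<comment> \<open>Testing the identity with z itself gives |z|^2 \<le> |T| |z| |y|, and one
        factor |z| cancels.\<close>
      have "(norm ?z)\<^sup>2 = T ?z \<bullet> y" by (simp add: power2_norm_eq_inner a)
      also have "\<dots> \<le> norm (T ?z) * norm y" by (rule norm_cauchy_schwarz)
      also have "\<dots> \<le> norm T * norm ?z * norm y"
        by (intro mult_right_mono norm_blinfun) auto
      finally show ?thesis
        by (cases "norm ?z = 0") (auto simp: power2_eq_square mult_ac)
    qed
  qed
  then show ?thesis by (simp add: adj_def bounded_linear_Blinfun_apply a)
qed

section \<open>Orthonormal bases and Parseval's identity\<close>

text \<open>One Gram-Schmidt step: the residual of \<open>d\<close> after projection on the span of
  \<open>B\<close> is normalised and added; if it is zero, \<open>B\<close> already serves.\<close>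

lemma finite_orthonormal_extension:
  fixes d :: "'h::real_inner"
  assumes "finite B" "pairwise orthogonal B" "\<forall>e\<in>B. norm e = 1"
  shows "\<exists>C. B \<subseteq> C \<and> finite C \<and> pairwise orthogonal C \<and> (\<forall>e\<in>C. norm e = 1) \<and> d \<in> span C"
proof -
  define p where "p = (\<Sum>e\<in>B. (d \<bullet> e) *\<^sub>R e)"
  define r where "r = d - p"
  have p: "p \<in> span B" unfolding p_def by (intro span_sum span_scale span_base)
  have p_e: "p \<bullet> e = d \<bullet> e" if "e \<in> B" for e
  proof -
    have "p \<bullet> e = (\<Sum>e'\<in>B. if e' = e then d \<bullet> e else 0)"
      unfolding p_def inner_sum_left
    proof (rule sum.cong)
      fix e' assume "e' \<in> B"
      then show "(d \<bullet> e') *\<^sub>R e' \<bullet> e = (if e' = e then d \<bullet> e else 0)"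
        using that assms(2,3) by (auto simp: pairwise_def orthogonal_def norm_eq_1)
    qed simp
    then show ?thesis using that assms(1) by simp
  qed
  show ?thesis
  proof (cases "r = 0")
    case True
    then show ?thesis using assms p unfolding r_def by (intro exI[of _ B]) auto
  next
    case False
    define e0 where "e0 = (1 / norm r) *\<^sub>R r"
    have "orthogonal e0 e" if "e \<in> B" for e
      using p_e[OF that] by (simp add: orthogonal_def e0_def r_def inner_diff)
    then have "pairwise orthogonal (insert e0 B)"
      using assms(2) by (auto simp: pairwise_insert orthogonal_commute)
    moreover have "norm e0 = 1" using False by (simp add: e0_def)
    moreover have "d \<in> span (insert e0 B)"
    proof -
      have "d = p + norm r *\<^sub>R e0" using False by (simp add: e0_def r_def)
      moreover have "p \<in> span (insert e0 B)"
        using p span_mono[of B "insert e0 B"] by auto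
      ultimately show ?thesis
        by (metis insertI1 span_add span_base span_scale)
    qed
    ultimately show ?thesis using assms by (intro exI[of _ "insert e0 B"]) auto
  qed
qed

text \<open>Gram-Schmidt along a countable dense sequence, with nested finite families so that the
  union stays orthonormal. It gives meaning to the basis that \<open>hs_inner\<close> picks by
  \<open>SOME\<close>.\<close>

lemma orthonormal_basis_exists:
  "\<exists>B::'h::{real_inner,banach,second_countable_topology} set. orthonormal_basis B"
proof -
  obtain D :: "'h set" where D: "countable D" "\<And>X. open X \<Longrightarrow> X \<noteq> {} \<Longrightarrow> \<exists>d\<in>D. d \<in> X"
    using countable_dense_setE by metis
  have "D \<noteq> {}" using D(2)[of UNIV] by auto
  define d where "d = from_nat_into D"
  have ran: "range d = D" using \<open>D \<noteq> {}\<close> D(1) by (simp add: d_def)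
  define P where "P n C \<longleftrightarrow> finite C \<and> pairwise orthogonal C \<and> (\<forall>e\<in>C. norm e = 1) \<and> d n \<in> span C"
    for n C
  have "\<exists>B. \<forall>n. P n (B n) \<and> B n \<subseteq> B (Suc n)"
  proof (rule dependent_nat_choice)
    show "\<exists>x. P 0 x"
      using finite_orthonormal_extension[of "{}" "d 0"] by (auto simp: P_def pairwise_def)
    show "\<exists>y. P (Suc n) y \<and> x \<subseteq> y" if "P n x" for x n
      using finite_orthonormal_extension[of x "d (Suc n)"] that by (auto simp: P_def)
  qed
  then obtain B where B: "\<And>n. P n (B n)" and mono: "\<And>n. B n \<subseteq> B (Suc n)" by blast
  have "mono B" using mono by (intro mono_iff_le_Suc[THEN iffD2]) auto
  have "pairwise orthogonal (\<Union>n. B n)"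
  proof (rule pairwiseI)
    fix x y assume "x \<in> (\<Union>n. B n)" "y \<in> (\<Union>n. B n)" "x \<noteq> y"
    then obtain i j where "x \<in> B i" "y \<in> B j" by auto
    then have "x \<in> B (max i j)" "y \<in> B (max i j)"
      using monoD[OF \<open>mono B\<close>, of i "max i j"] monoD[OF \<open>mono B\<close>, of j "max i j"] by auto
    then show "orthogonal x y"
      using B[of "max i j"] \<open>x \<noteq> y\<close> by (auto simp: P_def pairwise_def)
  qed
  moreover have "\<forall>e\<in>(\<Union>n. B n). norm e = 1" using B by (auto simp: P_def)
  moreover have "closure (span (\<Union>n. B n)) = UNIV"
  proof -
    have "D \<subseteq> span (\<Union>n. B n)"
    proof -
      have "d n \<in> span (\<Union>n. B n)" for n
        using B[of n] span_mono[of "B n" "\<Union>n. B n"] by (auto simp: P_def)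
      then show ?thesis using ran by auto
    qed
    moreover have "closure D = UNIV"
    proof -
      have "\<exists>y\<in>D. dist y x < e" if "e > 0" for x e
        using D(2)[of "ball x e"] that by (auto simp: dist_commute)
      then show ?thesis by (auto simp: closure_approachable)
    qed
    ultimately show ?thesis using closure_mono by blast
  qed
  ultimately show ?thesis unfolding orthonormal_basis_def by blast
qed

text \<open>For finite \<open>G\<close> the partial sum is the inner product of y with the
  projection p of x on the span of \<open>G\<close>. Since p is the best approximation of x there,
  it is as close to x as any u in the dense span of \<open>B\<close> as soon as that span contains
  u.\<close>

lemma parseval:
  fixes x y :: "'h::{real_inner,banach}"
  assumes "orthonormal_basis B"
  shows "((\<lambda>e. (x \<bullet> e) * (y \<bullet> e)) has_sum (x \<bullet> y)) B"
  unfolding has_sum_def tendsto_iff eventually_finite_subsets_at_top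
proof (intro allI impI)
  fix \<epsilon> :: real assume "\<epsilon> > 0"
  have orth_B: "e \<bullet> e' = 0" if "e \<in> B" "e' \<in> B" "e \<noteq> e'" for e e'
    using assms that by (auto simp: orthonormal_basis_def pairwise_def orthogonal_def)
  have norm_B: "e \<bullet> e = 1" if "e \<in> B" for e
    using assms that by (auto simp: orthonormal_basis_def norm_eq_1)
  \<comment> \<open>Cauchy-Schwarz will give an error of at most \<delta> |y|; the added 1 keeps the
    divisor positive when y = 0.\<close>
  define \<delta> where "\<delta> = \<epsilon> / (norm y + 1)"
  have "\<delta> > 0" using \<open>\<epsilon> > 0\<close> by (simp add: \<delta>_def add_nonneg_pos)
  moreover have "x \<in> closure (span B)" using assms by (auto simp: orthonormal_basis_def)
  ultimately obtain u where u: "u \<in> span B" "norm (x - u) < \<delta>"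
    by (auto simp: closure_approachable dist_norm norm_minus_commute)
  obtain S r where S: "finite S" "S \<subseteq> B" "u = (\<Sum>e\<in>S. r e *\<^sub>R e)"
    using u(1) unfolding span_explicit by auto
  have approx: "dist (\<Sum>e\<in>G. (x \<bullet> e) * (y \<bullet> e)) (x \<bullet> y) < \<epsilon>" if G: "finite G" "S \<subseteq> G" "G \<subseteq> B" for G
  proof -
    define p where "p = (\<Sum>e\<in>G. (x \<bullet> e) *\<^sub>R e)"
    have p_e: "p \<bullet> e = x \<bullet> e" if "e \<in> G" for e
    proof -
      have "p \<bullet> e = (\<Sum>e'\<in>G. if e' = e then x \<bullet> e else 0)"
        unfolding p_def inner_sum_left
      proof (rule sum.cong)
        fix e' assume "e' \<in> G"
        then show "(x \<bullet> e') *\<^sub>R e' \<bullet> e = (if e' = e then x \<bullet> e else 0)"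
          using orth_B[of e' e] norm_B[of e] that G(3) by (cases "e' = e") auto
      qed simp
      then show ?thesis using that G(1) by simp
    qed
    have orth: "(x - p) \<bullet> z = 0" if "z \<in> span G" for z
      using that
    proof (induction rule: span_induct_alt)
      case (step c z w)
      then show ?case by (simp add: inner_add_right inner_diff_left[of x p z] p_e)
    qed simp
    have "p \<in> span G" unfolding p_def by (intro span_sum span_scale span_base)
    moreover have "u \<in> span G"
      unfolding S(3) using G(2) by (intro span_sum span_scale span_base) auto
    ultimately have "(x - p) \<bullet> (p - u) = 0" by (intro orth span_diff)
    then have "(norm (x - u))\<^sup>2 = (norm (x - p))\<^sup>2 + (norm (p - u))\<^sup>2"
      using norm_add_Pythagorean[of "x - p" "p - u"] by (simp add: orthogonal_def)
    then have "(norm (x - p))\<^sup>2 \<le> (norm (x - u))\<^sup>2" by simp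
    then have "norm (x - p) \<le> norm (x - u)"
      by (rule power2_le_imp_le) simp
    then have "norm (x - p) < \<delta>" using u(2) by simp
    have "(\<Sum>e\<in>G. (x \<bullet> e) * (y \<bullet> e)) = p \<bullet> y"
      unfolding p_def inner_sum_left by (intro sum.cong) (simp_all add: inner_commute)
    then have "dist (\<Sum>e\<in>G. (x \<bullet> e) * (y \<bullet> e)) (x \<bullet> y) = \<bar>(x - p) \<bullet> y\<bar>"
      by (simp add: dist_real_def inner_diff_left abs_minus_commute)
    also have "\<dots> \<le> norm (x - p) * norm y" by (rule Cauchy_Schwarz_ineq2)
    also have "\<dots> \<le> \<delta> * norm y" using \<open>norm (x - p) < \<delta>\<close> by (intro mult_right_mono) auto
    also have "\<dots> < \<delta> * (norm y + 1)" using \<open>\<delta> > 0\<close> by simp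
    also have "\<dots> = \<epsilon>" unfolding \<delta>_def using norm_ge_zero[of y] by (simp add: add_nonneg_eq_0_iff)
    finally show ?thesis .
  qed
  show "\<exists>X. finite X \<and> X \<subseteq> B \<and> (\<forall>Y. finite Y \<and> X \<subseteq> Y \<and> Y \<subseteq> B \<longrightarrow>
      dist (\<Sum>e\<in>Y. (x \<bullet> e) * (y \<bullet> e)) (x \<bullet> y) < \<epsilon>)"
  proof (rule exI[of _ S], rule conjI[OF S(1) conjI[OF S(2)]], rule allI, rule impI)
    fix Y assume "finite Y \<and> S \<subseteq> Y \<and> Y \<subseteq> B"
    then show "dist (\<Sum>e\<in>Y. (x \<bullet> e) * (y \<bullet> e)) (x \<bullet> y) < \<epsilon>"
      by (elim conjE) (rule approx)
  qed
qed

text \<open>Each summand of the Hilbert-Schmidt product of two rank one operators contains the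
  factor \<open>y \<bullet> f\<close>; what remains is a Parseval sum, whose value is the same for
  every basis.\<close>

lemma Lfun_tensor:
  fixes f y :: "'h::{real_inner,banach,second_countable_topology}"
  shows "Lfun f (y \<otimes>\<^sub>H y) = (y \<bullet> f)\<^sup>2"
proof -
  have B: "orthonormal_basis (SOME B::'h set. orthonormal_basis B)"
    using orthonormal_basis_exists by (rule someI_ex)
  have "((\<lambda>e. (y \<bullet> f) * ((y \<bullet> e) * (f \<bullet> e))) has_sum ((y \<bullet> f) * (y \<bullet> f)))
      (SOME B::'h set. orthonormal_basis B)"
    by (intro has_sum_cmult_right parseval B)
  moreover have "(\<lambda>e. (y \<otimes>\<^sub>H y) e \<bullet> (f \<otimes>\<^sub>H f) e) = (\<lambda>e. (y \<bullet> f) * ((y \<bullet> e) * (f \<bullet> e)))"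
    by (auto simp: algebra_simps)
  ultimately show ?thesis
    unfolding Lfun_def hs_inner_def by (simp add: infsumI power2_eq_square)
qed

section \<open>The nonnegative square root of an operator\<close>

text \<open>The nonnegative form is evaluated at x - T x / |T|; this step length makes the quadratic
  term at most half of the linear one. The point of the estimate is that a zero of the form is a
  zero of the operator.\<close>

lemma self_adjoint_nonneg_norm_le:
  fixes T :: "'h::{real_inner,banach} \<Rightarrow>\<^sub>L 'h"
  assumes "self_adjoint T" "nonneg_definite T"
  shows "(norm (T x))\<^sup>2 \<le> norm T * (T x \<bullet> x)"
proof (cases "norm T = 0")
  case False
  define q where "q = norm T"
  have "q > 0" using False by (simp add: q_def)
  let ?z = "T x"
  have "T ?z \<bullet> ?z \<le> norm (T ?z) * norm ?z" by (rule norm_cauchy_schwarz)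
  also have "\<dots> \<le> q * norm ?z * norm ?z"
    unfolding q_def by (intro mult_right_mono norm_blinfun) auto
  finally have le: "T ?z \<bullet> ?z \<le> q * (?z \<bullet> ?z)"
      by (simp add: power2_norm_eq_inner[symmetric] power2_eq_square)
  have "0 \<le> T (x - (1/q) *\<^sub>R ?z) \<bullet> (x - (1/q) *\<^sub>R ?z)"
    using assms(2) by (auto simp: nonneg_definite_def)
  also have "\<dots> = T x \<bullet> x - 2 * (1/q) * (?z \<bullet> ?z) + (1/q)\<^sup>2 * (T ?z \<bullet> ?z)"
  proof -
    have "T ?z \<bullet> x = ?z \<bullet> ?z" using assms(1) by (simp add: self_adjoint_def)
    then show ?thesis
      by (simp add: blinfun.diff_right blinfun.scaleR_right inner_diff_left inner_diff_right
          power2_eq_square diff_divide_distrib)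
  qed
  also have "\<dots> \<le> T x \<bullet> x - 2 * (1/q) * (?z \<bullet> ?z) + (1/q)\<^sup>2 * (q * (?z \<bullet> ?z))"
    by (intro add_left_mono mult_left_mono le) auto
  also have "\<dots> = T x \<bullet> x - (1/q) * (?z \<bullet> ?z)"
    using \<open>q > 0\<close> by (simp add: power2_eq_square)
  finally show ?thesis using \<open>q > 0\<close>
      by (simp add: power2_norm_eq_inner q_def[symmetric] field_simps)
qed (simp)

text \<open>The squared norm of \<open>D x\<close> is the inner product of \<open>x\<close> with
  \<open>D (D x)\<close>.\<close>

lemma self_adjoint_square_eq_0:
  fixes D :: "'h::{real_inner,banach} \<Rightarrow>\<^sub>L 'h"
  assumes "self_adjoint D" "D (D x) = 0"
  shows "D x = 0"
  using assms unfolding self_adjoint_def by (metis inner_eq_zero_iff inner_zero_right)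

text \<open>With y = (R - S) x, commutation gives (R + S) y = (R^2 - S^2) x = 0. The two nonnegative
  numbers \<open>R y \<bullet> y\<close> and \<open>S y \<bullet> y\<close> then vanish, hence so do
  R y and S y, and (R - S)^2 x = 0.\<close>

lemma nonneg_sqrt_unique:
  fixes R S :: "'h::{real_inner,banach} \<Rightarrow>\<^sub>L 'h"
  assumes R: "self_adjoint R" "nonneg_definite R" and S: "self_adjoint S" "nonneg_definite S"
    and sq: "R o\<^sub>L R = S o\<^sub>L S" and comm: "R o\<^sub>L S = S o\<^sub>L R"
  shows "R = S"
proof -
  have sq': "R (R x) = S (S x)" and comm': "R (S x) = S (R x)" for x
    using sq comm by (metis blinfun_apply_blinfun_compose)+
  have "R x = S x" for x
  proof -
    define y where "y = R x - S x"
    have "R y + S y = 0"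
      unfolding y_def by (simp add: blinfun.diff_right sq' comm')
    then have "R y \<bullet> y + S y \<bullet> y = 0" by (metis inner_add_left inner_zero_left)
    moreover have "R y \<bullet> y \<ge> 0" "S y \<bullet> y \<ge> 0" using R S by (auto simp: nonneg_definite_def)
    ultimately have "R y \<bullet> y = 0" "S y \<bullet> y = 0" by auto
    then have "R y = 0" "S y = 0"
      using self_adjoint_nonneg_norm_le[OF R, of y] self_adjoint_nonneg_norm_le[OF S, of y] by auto
    then have "(R - S) ((R - S) x) = 0" by (simp add: y_def blinfun.diff_left)
    moreover have "self_adjoint (R - S)"
      using R S by (auto simp: self_adjoint_def blinfun.diff_left inner_diff)
    ultimately have "(R - S) x = 0" by (rule self_adjoint_square_eq_0[rotated])
    then show ?thesis by (simp add: blinfun.diff_left)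
  qed
  then show ?thesis by (rule blinfun_eqI)
qed

text \<open>
  For \<open>T = 1 - Q\<close> the operator \<open>1 - R\<close> with \<open>R\<close> the limit of these iterates is the square root
  of \<open>Q\<close>, since \<open>R = (T + R\<^sup>2) / 2\<close>.  The same recursion for numbers, with \<open>1\<close>
  in place of \<open>T\<close>, dominates the norms.
\<close>

fun sqrt_iter :: "('h::real_normed_vector \<Rightarrow>\<^sub>L 'h) \<Rightarrow> nat \<Rightarrow> ('h \<Rightarrow>\<^sub>L 'h)" where
  "sqrt_iter T 0 = 0"
| "sqrt_iter T (Suc n) = (1/2) *\<^sub>R (T + (sqrt_iter T n o\<^sub>L sqrt_iter T n))"

fun sqrt_iter_bound :: "nat \<Rightarrow> real" where
  "sqrt_iter_bound 0 = 0"
| "sqrt_iter_bound (Suc n) = (1 + (sqrt_iter_bound n)\<^sup>2) / 2"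

lemma sqrt_iter_bound_le_1: "0 \<le> sqrt_iter_bound n \<and> sqrt_iter_bound n \<le> 1"
proof (induction n)
  case (Suc n)
  then have "(sqrt_iter_bound n)\<^sup>2 \<le> 1" by (simp add: power_le_one)
  then show ?case by simp
qed simp

lemma sqrt_iter_bound_mono: "sqrt_iter_bound n \<le> sqrt_iter_bound (Suc n)"
proof -
  have "0 \<le> (1 - sqrt_iter_bound n)\<^sup>2" by simp
  then show ?thesis by (simp add: power2_diff)
qed

lemma norm_sqrt_iter:
  assumes "norm T \<le> 1"
  shows "norm (sqrt_iter T n) \<le> sqrt_iter_bound n"
proof (induction n)
  case (Suc n)
  have "norm (sqrt_iter T n o\<^sub>L sqrt_iter T n) \<le> norm (sqrt_iter T n) * norm (sqrt_iter T n)"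
    by (rule norm_blinfun_compose)
  also have "\<dots> \<le> (sqrt_iter_bound n)\<^sup>2"
    unfolding power2_eq_square using Suc by (intro mult_mono) (auto simp: sqrt_iter_bound_le_1)
  finally show ?case
    using assms norm_triangle_ineq[of T "sqrt_iter T n o\<^sub>L sqrt_iter T n"] by simp
qed simp

text \<open>The identity a^2 - b^2 = a (a - b) + (a - b) b needs no commutation, and its numerical
  counterpart is an equality, so the increments of the operators are dominated by those of the
  numbers.\<close>

lemma norm_sqrt_iter_diff:
  assumes "norm T \<le> 1"
  shows "norm (sqrt_iter T (Suc n) - sqrt_iter T n) \<le> sqrt_iter_bound (Suc n) - sqrt_iter_bound n"
proof (induction n)
  case 0
  then show ?case using assms by simp
next
  case (Suc n)
  define a b where "a = sqrt_iter T (Suc n)" and "b = sqrt_iter T n"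
  define u v where "u = sqrt_iter_bound (Suc n)" and "v = sqrt_iter_bound n"
  have ab: "norm a \<le> u" "norm b \<le> v" using norm_sqrt_iter[OF assms]
      by (auto simp: a_def b_def u_def v_def simp del: sqrt_iter.simps sqrt_iter_bound.simps)
  have d: "norm (a - b) \<le> u - v" using Suc by (simp add: a_def b_def u_def v_def)
  have uv: "0 \<le> u" "0 \<le> v" "v \<le> u" using sqrt_iter_bound_le_1 sqrt_iter_bound_mono
      unfolding u_def v_def by blast+
  have "sqrt_iter T (Suc (Suc n)) - sqrt_iter T (Suc n)
      = (1/2) *\<^sub>R ((a o\<^sub>L (a - b)) + ((a - b) o\<^sub>L b))"
  proof -
    have "sqrt_iter T (Suc (Suc n)) = (1/2) *\<^sub>R (T + (a o\<^sub>L a))" unfolding a_def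
        by (rule sqrt_iter.simps)
    moreover have "sqrt_iter T (Suc n) = (1/2) *\<^sub>R (T + (b o\<^sub>L b))" unfolding b_def
        by (rule sqrt_iter.simps)
    ultimately show ?thesis
      by (intro blinfun_eqI) (simp add: blinfun.diff_left blinfun.add_left blinfun.scaleR_left
          blinfun.diff_right scaleR_diff_right[symmetric])
  qed
  also have "norm \<dots> \<le> (u * (u - v) + (u - v) * v) / 2"
  proof -
    have "norm (a o\<^sub>L (a - b)) \<le> u * (u - v)"
      using norm_blinfun_compose[of a "a - b"] mult_mono[OF ab(1) d uv(1)] by simp
    moreover have "norm ((a - b) o\<^sub>L b) \<le> (u - v) * v"
      using norm_blinfun_compose[of "a - b" b] mult_mono[OF d ab(2)] uv by simp
    ultimately show ?thesis
      using norm_triangle_ineq[of "a o\<^sub>L (a - b)" "(a - b) o\<^sub>L b"] by simp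
  qed
  also have "\<dots> = sqrt_iter_bound (Suc (Suc n)) - sqrt_iter_bound (Suc n)"
  proof -
    have "sqrt_iter_bound (Suc (Suc n)) = (1 + u\<^sup>2) / 2" unfolding u_def
        by (rule sqrt_iter_bound.simps)
    moreover have "sqrt_iter_bound (Suc n) = (1 + v\<^sup>2) / 2" unfolding v_def
        by (rule sqrt_iter_bound.simps)
    ultimately show ?thesis by (simp add: power2_eq_square algebra_simps add_divide_distrib
        diff_divide_distrib)
  qed
  finally show ?case .
qed

text \<open>The dominating numbers increase and stay below 1, so their increments form a convergent
  telescoping series.\<close>

lemma sqrt_iter_convergent:
  fixes T :: "'h::{real_inner,banach} \<Rightarrow>\<^sub>L 'h"
  assumes "norm T \<le> 1"
  shows "\<exists>R. sqrt_iter T \<longlonglongrightarrow> R"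
proof -
  have "incseq sqrt_iter_bound" using sqrt_iter_bound_mono by (rule incseq_SucI)
  then have "convergent sqrt_iter_bound"
    using sqrt_iter_bound_le_1 by (intro Bseq_monoseq_convergent BseqI'[of _ 1])
        (auto simp: monoseq_def incseq_def)
  then obtain r where "sqrt_iter_bound \<longlonglongrightarrow> r" unfolding convergent_def by blast
  then have "summable (\<lambda>n. sqrt_iter_bound (Suc n) - sqrt_iter_bound n)"
    using telescope_sums sums_summable by blast
  then have "summable (\<lambda>n. sqrt_iter T (Suc n) - sqrt_iter T n)"
    by (rule summable_comparison_test'[where N=0]) (rule norm_sqrt_iter_diff[OF assms])
  then show ?thesis
    unfolding summable_iff_convergent convergent_def
    by (simp only: sum_lessThan_telescope sqrt_iter.simps(1) diff_zero)
qed

lemma blinfun_compose_tendsto: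
  fixes R :: "nat \<Rightarrow> ('h::{real_inner,banach} \<Rightarrow>\<^sub>L 'h)"
  assumes "R \<longlonglongrightarrow> r" "S \<longlonglongrightarrow> s"
  shows "(\<lambda>n. R n o\<^sub>L S n) \<longlonglongrightarrow> (r o\<^sub>L s)"
  using assms by (rule bounded_bilinear.tendsto[OF bounded_bilinear_blinfun_compose])

text \<open>The last clause is what uniqueness feeds on: any root R of Q commutes with Q = R^2,
  hence with the root built here, and \<open>nonneg_sqrt_unique\<close> applies. It holds because
  the iterates are polynomials in Q and commutation passes to the limit.\<close>

lemma nonneg_sqrt_exists_commuting:
  fixes Q :: "'h::{real_inner,banach} \<Rightarrow>\<^sub>L 'h"
  assumes "self_adjoint Q" "nonneg_definite Q"
  shows "\<exists>S. self_adjoint S \<and> nonneg_definite S \<and> S o\<^sub>L S = Q \<and>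
    (\<forall>C. C o\<^sub>L Q = Q o\<^sub>L C \<longrightarrow> C o\<^sub>L S = S o\<^sub>L C)"
proof (cases "Q = 0")
  case True
  then show ?thesis by (intro exI[of _ 0]) (auto simp: self_adjoint_def nonneg_definite_def)
next
  case False
  define q where "q = norm Q"
  have "q > 0" using False by (simp add: q_def)
  \<comment> \<open>Scaling by q = |Q| makes T a contraction: |T x|^2 is at most |x|^2 minus the
    nonnegative number (Q x, x) / q.\<close>
  define T where "T = id_blinfun - (1/q) *\<^sub>R Q"
  have T: "T x = x - (1/q) *\<^sub>R Q x" for x
    by (simp add: T_def blinfun.diff_left blinfun.scaleR_left)
  have "norm T \<le> 1"
  proof (rule norm_blinfun_bound)
    fix x
    have "(norm (T x))\<^sup>2 = (norm x)\<^sup>2 - 2 * (1/q) * (Q x \<bullet> x) + (1/q)\<^sup>2 * (norm (Q x))\<^sup>2"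
      unfolding T power2_norm_eq_inner
      by (simp add: inner_diff_left inner_diff_right inner_commute power2_eq_square)
    also have "\<dots> \<le> (norm x)\<^sup>2 - 2 * (1/q) * (Q x \<bullet> x) + (1/q)\<^sup>2 * (q * (Q x \<bullet> x))"
      unfolding q_def by (intro add_left_mono mult_left_mono self_adjoint_nonneg_norm_le assms) auto
    also have "\<dots> = (norm x)\<^sup>2 - (1/q) * (Q x \<bullet> x)" using \<open>q > 0\<close> by (simp add: power2_eq_square)
    also have "\<dots> \<le> (norm x)\<^sup>2"
      using assms(2) \<open>q > 0\<close> by (simp add: nonneg_definite_def)
    finally have "norm (T x) \<le> norm x" by (rule power2_le_imp_le) simp
    then show "norm (T x) \<le> 1 * norm x" by simp
  qed simp
  then obtain R where R: "sqrt_iter T \<longlonglongrightarrow> R" using sqrt_iter_convergent by blast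
  have "(\<lambda>n. sqrt_iter T (Suc n)) \<longlonglongrightarrow> (1/2) *\<^sub>R (T + (R o\<^sub>L R))"
    unfolding sqrt_iter.simps by (intro tendsto_intros blinfun_compose_tendsto R)
  with LIMSEQ_Suc[OF R] have fix_R: "R = (1/2) *\<^sub>R (T + (R o\<^sub>L R))" by (rule LIMSEQ_unique)
  have normR: "norm R \<le> 1"
    using norm_sqrt_iter[OF \<open>norm T \<le> 1\<close>] sqrt_iter_bound_le_1
    by (intro LIMSEQ_le_const2[OF tendsto_norm[OF R]]) (meson order_trans)
  have lim: "(\<lambda>n. sqrt_iter T n x) \<longlonglongrightarrow> R x" for x
    by (intro bounded_bilinear.tendsto[OF bounded_bilinear_blinfun_apply] R tendsto_const)
  have sa_iter: "sqrt_iter T n x \<bullet> y = x \<bullet> sqrt_iter T n y" for n x y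
  proof (induction n arbitrary: x y)
    case (Suc n)
    have "T x \<bullet> y = x \<bullet> T y"
      using assms(1) by (simp add: T inner_diff_left inner_diff_right self_adjoint_def)
    then show ?case
      by (simp add: blinfun.scaleR_left blinfun.add_left inner_add_left inner_add_right Suc)
  qed simp
  have saR: "R x \<bullet> y = x \<bullet> R y" for x y
    using LIMSEQ_unique[of "\<lambda>n. sqrt_iter T n x \<bullet> y" "R x \<bullet> y" "x \<bullet> R y"]
      tendsto_inner[OF lim[of x] tendsto_const[of y]]
          tendsto_inner[OF tendsto_const[of x] lim[of y]]
    by (simp add: sa_iter)
  \<comment> \<open>The fixed point equation R = (T + R^2) / 2 says (1 - R)^2 = 1 - T = Q / q; the
    factor sqrt q undoes the scaling.\<close>
  define S where "S = sqrt q *\<^sub>R (id_blinfun - R)"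
  have S: "S x = sqrt q *\<^sub>R (x - R x)" for x
    by (simp add: S_def blinfun.diff_left blinfun.scaleR_left)
  have "self_adjoint S" by (simp add: self_adjoint_def S inner_diff_left inner_diff_right saR)
  moreover have "nonneg_definite S"
    unfolding nonneg_definite_def
  proof
    fix x
    have "R x \<bullet> x \<le> norm (R x) * norm x" by (rule norm_cauchy_schwarz)
    also have "\<dots> \<le> (norm R * norm x) * norm x"
      by (intro mult_right_mono norm_blinfun) simp
    also have "\<dots> \<le> (1 * norm x) * norm x"
      by (intro mult_right_mono normR) auto
    finally have "R x \<bullet> x \<le> x \<bullet> x" by (simp add: dot_square_norm power2_eq_square)
    then show "0 \<le> S x \<bullet> x" using \<open>q > 0\<close> by (simp add: S inner_diff_left)
  qed
  moreover have "S o\<^sub>L S = Q"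
  proof (rule blinfun_eqI)
    fix x
    have "R x = (1/2) *\<^sub>R (T x + R (R x))"
      by (rule trans[OF arg_cong[OF fix_R, of "\<lambda>R. blinfun_apply R x"]])
        (simp add: blinfun.scaleR_left blinfun.add_left)
    then have "2 *\<^sub>R R x = 2 *\<^sub>R ((1/2) *\<^sub>R (T x + R (R x)))" by (rule arg_cong)
    then have "2 *\<^sub>R R x = T x + R (R x)" by simp
    then have "R (R x) = 2 *\<^sub>R R x - (x - (1/q) *\<^sub>R Q x)" unfolding T by (simp add: algebra_simps)
    then have "x - R x - (R x - R (R x)) = (1/q) *\<^sub>R Q x"
      by (simp add: scaleR_2)
    moreover have "(S o\<^sub>L S) x = q *\<^sub>R (x - R x - (R x - R (R x)))"
      using \<open>q > 0\<close>
      by (simp add: S blinfun.diff_right blinfun.scaleR_right flip: scaleR_diff_right)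
    ultimately show "(S o\<^sub>L S) x = Q x"
      using \<open>q > 0\<close> by simp
  qed
  moreover have "C o\<^sub>L S = S o\<^sub>L C" if C: "C o\<^sub>L Q = Q o\<^sub>L C" for C
  proof (rule blinfun_eqI)
    fix x
    have CQ: "C (Q x) = Q (C x)" for x using C by (metis blinfun_apply_blinfun_compose)
    have iter: "C (sqrt_iter T n x) = sqrt_iter T n (C x)" for n x
    proof (induction n arbitrary: x)
      case (Suc n)
      then show ?case
        by (simp add: blinfun.scaleR_left blinfun.add_left blinfun.scaleR_right blinfun.add_right
            T blinfun.diff_right CQ)
    qed (simp)
    have "(\<lambda>n. C (sqrt_iter T n x)) \<longlonglongrightarrow> C (R x)"
      by (intro bounded_bilinear.tendsto[OF bounded_bilinear_blinfun_apply] lim tendsto_const)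
    then have "C (R x) = R (C x)"
      using lim[of "C x"] unfolding iter by (rule LIMSEQ_unique)
    then show "(C o\<^sub>L S) x = (S o\<^sub>L C) x"
      by (simp add: S blinfun.diff_right blinfun.scaleR_right)
  qed
  ultimately show ?thesis by blast
qed

lemma op_sqrt:
  fixes Q :: "'h::{real_inner,banach} \<Rightarrow>\<^sub>L 'h"
  assumes "self_adjoint Q" "nonneg_definite Q"
  shows "self_adjoint (op_sqrt Q) \<and> nonneg_definite (op_sqrt Q) \<and> op_sqrt Q o\<^sub>L op_sqrt Q = Q"
  unfolding op_sqrt_def
proof (rule theI')
  obtain S where S: "self_adjoint S" "nonneg_definite S" "S o\<^sub>L S = Q"
    and comm: "\<And>C. C o\<^sub>L Q = Q o\<^sub>L C \<Longrightarrow> C o\<^sub>L S = S o\<^sub>L C"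
    using nonneg_sqrt_exists_commuting[OF assms] by blast
  show "\<exists>!R. self_adjoint R \<and> nonneg_definite R \<and> R o\<^sub>L R = Q"
  proof (rule ex1I[of _ S])
    fix R assume R: "self_adjoint R \<and> nonneg_definite R \<and> R o\<^sub>L R = Q"
    have "R o\<^sub>L (R o\<^sub>L R) = (R o\<^sub>L R) o\<^sub>L R" by (rule blinfun_eqI) simp
    then have "R o\<^sub>L S = S o\<^sub>L R" using comm R by metis
    moreover have "R o\<^sub>L R = S o\<^sub>L S" using R S(3)
        by (elim conjE) (rule trans, assumption, rule sym)
    ultimately show "R = S" using R S(1,2) nonneg_sqrt_unique by blast
  qed (use S in blast)
qed

text \<open>Links the coefficient of the theorem to the noise: at \<open>adj \<eta> f\<close> the
  right-hand side is the variance per unit time of the projected Wiener process.\<close>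

lemma norm_op_sqrt:
  fixes Q :: "'h::{real_inner,banach} \<Rightarrow>\<^sub>L 'h"
  assumes "self_adjoint Q" "nonneg_definite Q"
  shows "(norm (op_sqrt Q x))\<^sup>2 = Q x \<bullet> x"
proof -
  have "op_sqrt Q y \<bullet> z = y \<bullet> op_sqrt Q z" for y z
    using op_sqrt[OF assms] unfolding self_adjoint_def by blast
  then have "(norm (op_sqrt Q x))\<^sup>2 = op_sqrt Q (op_sqrt Q x) \<bullet> x"
    by (simp only: power2_norm_eq_inner)
  also have "op_sqrt Q (op_sqrt Q x) = (op_sqrt Q o\<^sub>L op_sqrt Q) x" by simp
  also have "\<dots> = Q x"
    using op_sqrt[OF assms] by (intro arg_cong[of _ _ "\<lambda>R. blinfun_apply R x"]) blast
  finally show ?thesis .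
qed

section \<open>Gaussian increments\<close>

lemma real_distribution_centred_normal:
  assumes "0 \<le> v"
  shows "real_distribution (centred_normal v)"
proof (cases "v = 0")
  case True
  then show ?thesis
    by (auto simp: centred_normal_def real_distribution_def real_distribution_axioms_def
        intro!: prob_space_return)
next
  case False
  with assms have "0 < sqrt v" by simp
  from prob_space_normal_density[OF this] show ?thesis
    using False by (auto simp: centred_normal_def real_distribution_def
        real_distribution_axioms_def)
qed

text \<open>The substitution x = sqrt v * y leads to the standard normal law; the point mass at v =
  0 is a separate case.\<close>

lemma char_centred_normal:
  assumes "0 \<le> v"
  shows "char (centred_normal v) \<theta> = exp (- (v * \<theta>\<^sup>2) / 2)"
proof (cases "v = 0")
  case True
  then show ?thesis by (simp add: centred_normal_def char_def integral_return)
next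
  case False
  with assms have v: "0 < v" by simp
  have dens: "sqrt v * normal_density 0 (sqrt v) (sqrt v * y) = std_normal_density y" for y
    using v by (simp add: normal_density_def power_mult_distrib real_sqrt_mult)
  have "char (centred_normal v) \<theta> = (CLINT x|lborel. normal_density 0 (sqrt v) x *\<^sub>R iexp (\<theta> * x))"
    using False unfolding char_def centred_normal_def by (simp add: integral_density)
  also have "\<dots> = \<bar>sqrt v\<bar> *\<^sub>R (CLINT y|lborel. normal_density 0 (sqrt v) (0 + sqrt v * y) *\<^sub>R iexp
      (\<theta> * (0 + sqrt v * y)))"
    using v by (intro lborel_integral_real_affine) simp
  also have "\<dots> = (CLINT y|lborel. (sqrt v * normal_density 0 (sqrt v) (sqrt v * y)) *\<^sub>R iexp
      ((\<theta> * sqrt v) * y))"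
    using v by (simp add: mult_ac flip: integral_scaleR_right scaleR_scaleR)
  also have "\<dots> = char std_normal_distribution (\<theta> * sqrt v)"
    unfolding char_def dens by (simp add: integral_density)
  also have "\<dots> = exp (- (v * \<theta>\<^sup>2) / 2)"
    using v by (simp add: char_std_normal_distribution power_mult_distrib mult.commute)
  finally show ?thesis .
qed

lemma sigma_sets_vimage_subset:
  assumes "g \<in> measurable N N'"
  shows "sigma_sets (space N) {g -` A \<inter> space N |A. A \<in> sets N'} \<subseteq> sets N"
  by (intro sets.sigma_sets_subset) (auto intro: measurable_sets[OF assms])

lemma (in prob_space) indep_set_mono:
  assumes "indep_set A B" "A' \<subseteq> A" "B' \<subseteq> B"
  shows "indep_set A' B'"
  using assms unfolding indep_sets2_eq by blast

context filtered_prob_space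
begin

section \<open>Independence, projections and moments of Wiener increments\<close>

lemma subalgebra_F: "subalgebra M (F t)"
  using space_F sets_F_subset by (auto simp: subalgebra_def)

lemma measurable_F_M: "X \<in> measurable (F t) N \<Longrightarrow> X \<in> measurable M N"
  by (rule measurable_from_subalg[OF subalgebra_F])

lemma measurable_F_mono:
  assumes "X \<in> measurable (F s) N" "s \<le> t"
  shows "X \<in> measurable (F t) N"
proof (rule measurable_from_subalg[OF _ assms(1)])
  show "subalgebra (F t) (F s)"
    using space_F sets_F_mono[OF assms(2)] by (auto simp: subalgebra_def)
qed

lemma adaptedD: "adapted F X \<Longrightarrow> 0 \<le> s \<Longrightarrow> s \<le> t \<Longrightarrow> X s \<in> borel_measurable (F t)"
  unfolding adapted_def using measurable_F_mono by blast

lemma adapted_measurable: "adapted F X \<Longrightarrow> 0 \<le> s \<Longrightarrow> X s \<in> borel_measurable M"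
  using adaptedD[of X s s] measurable_F_M by blast

text \<open>Passes from independent sigma-algebras to independent random variables. The map
  \<open>g\<close> allows complex exponentials and squares of the increment, which generate smaller
  sigma-algebras.\<close>

lemma wiener_increment_indep:
  fixes W :: "real \<Rightarrow> 'w \<Rightarrow> 'h::{real_inner,banach,second_countable_topology}"
  assumes W: "wiener_process M F Q W" and st: "0 \<le> s" "s < t"
    and Z: "Z \<in> measurable (F s) N" and g: "g \<in> measurable borel N'"
  shows "indep_var N Z N' (\<lambda>\<omega>. g (W t \<omega> - W s \<omega>))"
proof -
  have ad: "adapted F W" using W by (simp add: wiener_process_def)
  have [measurable]: "W t \<in> borel_measurable M" "W s \<in> borel_measurable M"
    using adapted_measurable[OF ad] st by auto
  note g[measurable] measurable_F_M[OF Z, measurable]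
  have ind: "indep_set (sets (F s))
      (sets (vimage_algebra (space M) (\<lambda>\<omega>. W t \<omega> - W s \<omega>) borel))"
    using W st by (auto simp: wiener_process_def)
  have "sigma_sets (space M) {Z -` A \<inter> space M |A. A \<in> sets N} \<subseteq> sets (F s)"
    using sigma_sets_vimage_subset[OF Z] by (simp only: space_F)
  moreover have "sigma_sets (space M) {(\<lambda>\<omega>. g (W t \<omega> - W s \<omega>)) -` A \<inter> space M |A. A \<in> sets N'}
      \<subseteq> sets (vimage_algebra (space M) (\<lambda>\<omega>. W t \<omega> - W s \<omega>) borel)"
  proof -
    have "(\<lambda>\<omega>. W t \<omega> - W s \<omega>) \<in> measurable (vimage_algebra (space M) (\<lambda>\<omega>. W t \<omega> - W s \<omega>) borel)
        borel"
      by (rule measurable_vimage_algebra1) simp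
    from sigma_sets_vimage_subset[OF measurable_compose[OF this g]] show ?thesis
      by (simp only: space_vimage_algebra)
  qed
  ultimately have "indep_set (sigma_sets (space M) {Z -` A \<inter> space M |A. A \<in> sets N})
    (sigma_sets (space M) {(\<lambda>\<omega>. g (W t \<omega> - W s \<omega>)) -` A \<inter> space M |A. A \<in> sets N'})"
    by (rule indep_set_mono[OF ind])
  then show ?thesis unfolding indep_var_eq by simp
qed

text \<open>Dividing by \<open>c\<close> normalises the variance rate to 1. The law of the increment
  comes from testing the increment of \<open>W\<close> with the vector (k / c) h.\<close>

lemma real_wiener_projection:
  fixes W :: "real \<Rightarrow> 'w \<Rightarrow> 'h::{real_inner,banach,second_countable_topology}"
  assumes W: "wiener_process M F Q W" and c: "c \<noteq> 0" "Q h \<bullet> h = c\<^sup>2"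
  shows "real_wiener_process M F (\<lambda>t \<omega>. (W t \<omega> \<bullet> h) / c)"
proof -
  have ad: "adapted F W" and W0: "AE \<omega> in M. W 0 \<omega> = 0"
    and cont: "AE \<omega> in M. continuous_on {0..} (\<lambda>t. W t \<omega>)"
    using W by (auto simp: wiener_process_def)
  show ?thesis
    unfolding wiener_process_def
  proof (intro conjI allI impI)
    show "adapted F (\<lambda>t \<omega>. (W t \<omega> \<bullet> h) / c)"
      unfolding adapted_def
    proof (intro allI impI)
      fix t :: real assume "0 \<le> t"
      then have [measurable]: "W t \<in> borel_measurable (F t)" using adaptedD[OF ad] by auto
      show "(\<lambda>\<omega>. (W t \<omega> \<bullet> h) / c) \<in> borel_measurable (F t)" by measurable
    qed
    show "AE \<omega> in M. (W 0 \<omega> \<bullet> h) / c = 0" using W0 by eventually_elim simp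
    show "AE \<omega> in M. continuous_on {0..} (\<lambda>t. (W t \<omega> \<bullet> h) / c)"
      using cont by eventually_elim (intro continuous_intros, use c in auto)
    fix s t :: real assume st: "0 \<le> s \<and> s < t"
    have [measurable]: "W t \<in> borel_measurable M" "W s \<in> borel_measurable M"
      using adapted_measurable[OF ad] st by auto
    have ind: "indep_set (sets (F s))
        (sets (vimage_algebra (space M) (\<lambda>\<omega>. W t \<omega> - W s \<omega>) borel))"
      using W st by (auto simp: wiener_process_def)
    have "sets (vimage_algebra (space M) (\<lambda>\<omega>. (W t \<omega> \<bullet> h) / c - (W s \<omega> \<bullet> h) / c) borel)
      \<subseteq> sets (vimage_algebra (space M) (\<lambda>\<omega>. W t \<omega> - W s \<omega>) borel)"
    proof -
      have m: "(\<lambda>\<omega>. W t \<omega> - W s \<omega>) \<in> measurable (vimage_algebra (space M) (\<lambda>\<omega>. W t \<omega> - W s \<omega>) borel)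
          borel"
        by (rule measurable_vimage_algebra1) simp
      have g: "(\<lambda>x. (x \<bullet> h) / c) \<in> borel_measurable borel" by measurable
      from sigma_sets_vimage_subset[OF measurable_compose[OF m g]]
      show ?thesis
        unfolding sets_vimage_algebra[of _ "\<lambda>\<omega>. (W t \<omega> \<bullet> h) / c - (W s \<omega> \<bullet> h) / c"]
        by (simp only: inner_diff_left diff_divide_distrib space_vimage_algebra)
    qed
    then show "indep_set (sets (F s))
        (sets (vimage_algebra (space M) (\<lambda>\<omega>. (W t \<omega> \<bullet> h) / c - (W s \<omega> \<bullet> h) / c) borel))"
      by (rule indep_set_mono[OF ind order_refl])
    fix k :: real
    have "distr M borel (\<lambda>\<omega>. (W t \<omega> - W s \<omega>) \<bullet> ((k / c) *\<^sub>R h))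
        = centred_normal ((t - s) * (Q ((k / c) *\<^sub>R h) \<bullet> ((k / c) *\<^sub>R h)))"
      using W st unfolding wiener_process_def by blast
    moreover have "Q ((k / c) *\<^sub>R h) \<bullet> ((k / c) *\<^sub>R h) = k * k"
      using c by (simp add: blinfun.scaleR_right power2_eq_square)
    moreover have "(W t \<omega> - W s \<omega>) \<bullet> ((k / c) *\<^sub>R h) = (W t \<omega> \<bullet> h / c - W s \<omega> \<bullet> h / c) \<bullet> k" for \<omega>
      by (simp add: inner_diff_left diff_divide_distrib algebra_simps)
    ultimately show "distr M borel (\<lambda>\<omega>. (W t \<omega> \<bullet> h / c - W s \<omega> \<bullet> h / c) \<bullet> k)
        = centred_normal ((t - s) * (id_blinfun k \<bullet> k))"
      by (simp only: id_blinfun.rep_eq inner_real_def)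
  qed
qed

lemma wiener_increment_distr:
  assumes B: "real_wiener_process M F B" and st: "0 \<le> s" "s \<le> t"
  shows "distr M borel (\<lambda>\<omega>. B t \<omega> - B s \<omega>) = centred_normal (t - s)"
proof (cases "s = t")
  case True
  then show ?thesis
    by (simp add: centred_normal_def distr_const)
next
  case False
  with st have "0 \<le> s \<and> s < t" by simp
  then have "distr M borel (\<lambda>\<omega>. (B t \<omega> - B s \<omega>) \<bullet> 1)
      = centred_normal ((t - s) * (id_blinfun 1 \<bullet> (1::real)))"
    using B unfolding wiener_process_def by blast
  then show ?thesis by simp
qed

lemma wiener_increment_measurable:
  assumes B: "real_wiener_process M F B" and st: "0 \<le> s" "0 \<le> t"
  shows "(\<lambda>\<omega>. B t \<omega> - B s \<omega>) \<in> borel_measurable M"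
proof -
  have "adapted F B" using B by (simp add: wiener_process_def)
  from adapted_measurable[OF this] st show ?thesis by (intro borel_measurable_diff) auto
qed

text \<open>For s = t the law of the increment is a point mass and has no density, which is the
  reason for the separate hypothesis \<open>m0\<close>.\<close>

lemma wiener_increment_moment:
  assumes B: "real_wiener_process M F B" and st: "0 \<le> s" "s \<le> t"
    and m: "has_bochner_integral lborel (\<lambda>x. normal_density 0 (sqrt (t - s)) x * x ^ k) m"
    and k: "0 < k" and m0: "s = t \<Longrightarrow> m = 0"
  shows "has_bochner_integral M (\<lambda>\<omega>. (B t \<omega> - B s \<omega>) ^ k) m"
proof (cases "s = t")
  case True
  then show ?thesis using k m0 by (simp add: has_bochner_integral_zero zero_power)
next
  case False
  have D: "(\<lambda>\<omega>. B t \<omega> - B s \<omega>) \<in> borel_measurable M"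
    using wiener_increment_measurable[OF B] st by auto
  have "has_bochner_integral (density lborel (normal_density 0 (sqrt (t - s)))) (\<lambda>x. x ^ k) m"
    using m by (intro has_bochner_integral_density) auto
  then have "has_bochner_integral (distr M borel (\<lambda>\<omega>. B t \<omega> - B s \<omega>)) (\<lambda>x. x ^ k) m"
    using False by (simp add: wiener_increment_distr[OF B st] centred_normal_def)
  then show ?thesis
    using D by (simp add: has_bochner_integral_iff integrable_distr_eq integral_distr)
qed

text \<open>The fourth moment is what the second moment of a squared increment, and with it the
  quadratic variation, requires.\<close>

lemma wiener_increment_moments:
  assumes B: "real_wiener_process M F B" and st: "0 \<le> s" "s \<le> t"
  shows "has_bochner_integral M (\<lambda>\<omega>. B t \<omega> - B s \<omega>) 0"
    and "has_bochner_integral M (\<lambda>\<omega>. (B t \<omega> - B s \<omega>)\<^sup>2) (t - s)"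
    and "has_bochner_integral M (\<lambda>\<omega>. (B t \<omega> - B s \<omega>) ^ 4) (3 * (t - s)\<^sup>2)"
proof -
  show "has_bochner_integral M (\<lambda>\<omega>. B t \<omega> - B s \<omega>) 0"
  proof (cases "s = t")
    case False
    with st have "0 < sqrt (t - s)" by simp
    from normal_moment_odd[OF this, of 0 0] wiener_increment_moment[OF B st, of 1 0]
    show ?thesis by simp
  qed (simp add: has_bochner_integral_zero)
  show "has_bochner_integral M (\<lambda>\<omega>. (B t \<omega> - B s \<omega>)\<^sup>2) (t - s)"
  proof (cases "s = t")
    case False
    with st have "0 < sqrt (t - s)" by simp
    moreover have "fact (2 * 1) / ((2 / (sqrt (t - s))\<^sup>2) ^ 1 * fact 1) = t - s"
      using st False by (simp add: field_simps)
    ultimately show ?thesis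
      using normal_moment_even[of "sqrt (t - s)" 0 1] wiener_increment_moment[OF B st, of 2
          "t - s"] False
      by (simp add: diff_divide_distrib)
  qed (simp add: has_bochner_integral_zero)
  show "has_bochner_integral M (\<lambda>\<omega>. (B t \<omega> - B s \<omega>) ^ 4) (3 * (t - s)\<^sup>2)"
  proof (cases "s = t")
    case False
    with st have "0 < sqrt (t - s)" by simp
    from normal_moment_even[OF this, of 0 2] wiener_increment_moment[OF B st, of 4
        "3 * (t - s)\<^sup>2"] st
    show ?thesis by (simp add: fact_numeral power_divide)
  qed (simp add: has_bochner_integral_zero)
qed

section \<open>Wiener processes through characteristic functions of increments\<close>

text \<open>
  Gaussian increments independent of the past, in terms of characteristic functions.  This form is
  stable under limits and under multiplication of the increment by a sign known at time \<open>s\<close>.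
\<close>

definition iexp_increment :: "(real \<Rightarrow> 'w \<Rightarrow> real) \<Rightarrow> real \<Rightarrow> real \<Rightarrow> bool" where
  "iexp_increment U s t \<longleftrightarrow> (\<forall>\<theta>::real. \<forall>Z\<in>borel_measurable (F s). (\<exists>K. \<forall>\<omega>. cmod (Z \<omega>) \<le> K) \<longrightarrow>
     (CLINT \<omega>|M. Z \<omega> * iexp (\<theta> * (U t \<omega> - U s \<omega>))) =
       complex_of_real (exp (- ((t - s) * \<theta>\<^sup>2) / 2)) * (CLINT \<omega>|M. Z \<omega>))"

lemma integrable_bounded_complex:
  fixes Z :: "'w \<Rightarrow> complex"
  assumes "Z \<in> borel_measurable M" "\<And>\<omega>. cmod (Z \<omega>) \<le> K"
  shows "integrable M Z"
  using assms by (intro integrable_const_bound[of _ K]) auto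

lemma wiener_iexp_increment:
  assumes B: "real_wiener_process M F B" and st: "0 \<le> s" "s \<le> t"
  shows "iexp_increment B s t"
  unfolding iexp_increment_def
proof (intro allI ballI impI)
  fix \<theta> :: real and Z :: "'w \<Rightarrow> complex"
  assume Z: "Z \<in> borel_measurable (F s)" and "\<exists>K. \<forall>\<omega>. cmod (Z \<omega>) \<le> K"
  then obtain K where K: "\<And>\<omega>. cmod (Z \<omega>) \<le> K" by blast
  note [measurable] = wiener_increment_measurable[OF B, of s t] measurable_F_M[OF Z]
  show "(CLINT \<omega>|M. Z \<omega> * iexp (\<theta> * (B t \<omega> - B s \<omega>))) =
       complex_of_real (exp (- ((t - s) * \<theta>\<^sup>2) / 2)) * (CLINT \<omega>|M. Z \<omega>)"
  proof (cases "s = t")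
    case False
    then have "s < t" using st by simp
    have "indep_var borel Z borel (\<lambda>\<omega>. iexp (\<theta> * (B t \<omega> - B s \<omega>)))"
      by (rule wiener_increment_indep[OF B st(1) \<open>s < t\<close> Z, of "\<lambda>x. iexp (\<theta> * x)"]) measurable
    moreover have "integrable M (\<lambda>\<omega>. iexp (\<theta> * (B t \<omega> - B s \<omega>)))"
      using st by (intro integrable_bounded_complex[of _ 1])
          (auto simp del: of_real_mult of_real_diff)
    ultimately have "(CLINT \<omega>|M. Z \<omega> * iexp (\<theta> * (B t \<omega> - B s \<omega>))) =
        (CLINT \<omega>|M. Z \<omega>) * (CLINT \<omega>|M. iexp (\<theta> * (B t \<omega> - B s \<omega>)))"
      using K by (intro indep_var_lebesgue_integral integrable_bounded_complex) auto
    also have "(CLINT \<omega>|M. iexp (\<theta> * (B t \<omega> - B s \<omega>))) = char (distr M borel (\<lambda>\<omega>. B t \<omega> - B s \<omega>)) \<theta>"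
      unfolding char_def using st by (subst integral_distr) auto
    also have "\<dots> = exp (- ((t - s) * \<theta>\<^sup>2) / 2)"
      using st by (simp only: wiener_increment_distr[OF B st]) (rule char_centred_normal, simp)
    finally show ?thesis by (simp add: mult.commute)
  qed simp
qed

text \<open>Splitting \<open>Z\<close> by the value of the sign leaves two test variables that are
  still known at time s. On the second one \<theta> is replaced by -\<theta>, which the Gaussian
  factor does not notice because it depends on the square of \<theta> only.\<close>

lemma iexp_increment_sign:
  assumes U: "iexp_increment U s t"
      and sg: "\<epsilon> \<in> borel_measurable (F s)" "\<And>\<omega>. \<epsilon> \<omega> = 1 \<or> \<epsilon> \<omega> = - (1::real)"
    and V: "\<And>\<omega>. V t \<omega> - V s \<omega> = \<epsilon> \<omega> * (U t \<omega> - U s \<omega>)"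
    and [measurable]: "(\<lambda>\<omega>. U t \<omega> - U s \<omega>) \<in> borel_measurable M"
  shows "iexp_increment V s t"
  unfolding iexp_increment_def
proof (intro allI ballI impI)
  fix \<theta> :: real and Z :: "'w \<Rightarrow> complex"
  assume Z[measurable]: "Z \<in> borel_measurable (F s)" and "\<exists>K. \<forall>\<omega>. cmod (Z \<omega>) \<le> K"
  then obtain K where K: "\<And>\<omega>. cmod (Z \<omega>) \<le> K" by blast
  note sg(1)[measurable] measurable_F_M[OF Z, measurable] measurable_F_M[OF sg(1), measurable]
  define Z1 Z2 where "Z1 \<omega> = (if \<epsilon> \<omega> = 1 then Z \<omega> else 0)" and "Z2 \<omega> = (if \<epsilon> \<omega> = 1 then 0 else Z \<omega>)"
      for \<omega>
  have [measurable]: "Z1 \<in> borel_measurable (F s)" "Z2 \<in> borel_measurable (F s)"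
    unfolding Z1_def Z2_def by measurable
  note [measurable] = measurable_F_M[OF this(1)] measurable_F_M[OF this(2)]
  have b: "cmod (Z1 \<omega>) \<le> K" "cmod (Z2 \<omega>) \<le> K" for \<omega>
    using K[of \<omega>] norm_ge_zero[of "Z \<omega>"] by (auto simp: Z1_def Z2_def simp del: norm_ge_zero)
  have i: "integrable M Z1" "integrable M Z2"
    "integrable M (\<lambda>\<omega>. Z1 \<omega> * iexp (\<theta> * (U t \<omega> - U s \<omega>)))"
    "integrable M (\<lambda>\<omega>. Z2 \<omega> * iexp ((- \<theta>) * (U t \<omega> - U s \<omega>)))"
    using b by (auto intro!: integrable_bounded_complex[of _ K] simp: norm_mult simp del:
        of_real_mult)
  have "(CLINT \<omega>|M. Z \<omega> * iexp (\<theta> * (V t \<omega> - V s \<omega>)))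
      = (CLINT \<omega>|M. Z1 \<omega> * iexp (\<theta> * (U t \<omega> - U s \<omega>)) + Z2 \<omega> * iexp ((- \<theta>) * (U t \<omega> - U s \<omega>)))"
  proof (intro Bochner_Integration.integral_cong refl)
    fix \<omega>
    show "Z \<omega> * iexp (\<theta> * (V t \<omega> - V s \<omega>)) = Z1 \<omega> * iexp (\<theta> * (U t \<omega> - U s \<omega>)) + Z2 \<omega>
        * iexp ((- \<theta>) * (U t \<omega> - U s \<omega>))"
      using sg(2)[of \<omega>]
    proof
      assume "\<epsilon> \<omega> = - 1"
      moreover from this have "\<theta> * (V t \<omega> - V s \<omega>) = (- \<theta>) * (U t \<omega> - U s \<omega>)"
        unfolding V by (simp add: algebra_simps)
      ultimately show ?thesis by (simp only: Z1_def Z2_def) simp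
    qed (simp add: V Z1_def Z2_def)
  qed
  also have "\<dots> = (CLINT \<omega>|M. Z1 \<omega> * iexp (\<theta> * (U t \<omega> - U s \<omega>)))
      + (CLINT \<omega>|M. Z2 \<omega> * iexp ((- \<theta>) * (U t \<omega> - U s \<omega>)))"
    by (intro Bochner_Integration.integral_add i)
  also have "(CLINT \<omega>|M. Z1 \<omega> * iexp (\<theta> * (U t \<omega> - U s \<omega>)))
      = complex_of_real (exp (- ((t - s) * \<theta>\<^sup>2) / 2)) * (CLINT \<omega>|M. Z1 \<omega>)"
    using U b(1) \<open>Z1 \<in> borel_measurable (F s)\<close> unfolding iexp_increment_def by blast
  also have "(CLINT \<omega>|M. Z2 \<omega> * iexp ((- \<theta>) * (U t \<omega> - U s \<omega>)))
      = complex_of_real (exp (- ((t - s) * (- \<theta>)\<^sup>2) / 2)) * (CLINT \<omega>|M. Z2 \<omega>)"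
    using U b(2) \<open>Z2 \<in> borel_measurable (F s)\<close> unfolding iexp_increment_def by blast
  also have "complex_of_real (exp (- ((t - s) * \<theta>\<^sup>2) / 2)) * (CLINT \<omega>|M. Z1 \<omega>)
      + complex_of_real (exp (- ((t - s) * (- \<theta>)\<^sup>2) / 2)) * (CLINT \<omega>|M. Z2 \<omega>)
      = complex_of_real (exp (- ((t - s) * \<theta>\<^sup>2) / 2)) * (CLINT \<omega>|M. Z1 \<omega> + Z2 \<omega>)"
    using i(1,2) by (simp add: ring_distribs)
  also have "(\<lambda>\<omega>. Z1 \<omega> + Z2 \<omega>) = Z" by (auto simp: Z1_def Z2_def)
  finally show "(CLINT \<omega>|M. Z \<omega> * iexp (\<theta> * (V t \<omega> - V s \<omega>))) =
       complex_of_real (exp (- ((t - s) * \<theta>\<^sup>2) / 2)) * (CLINT \<omega>|M. Z \<omega>)" .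
qed

text \<open>The exponential of the first increment is bounded and known at time t, so it can be
  absorbed into the test variable for the second increment; the variances add in the
  exponent.\<close>

lemma iexp_increment_trans:
  assumes "iexp_increment U s t" "iexp_increment U t u" and st: "0 \<le> s" "s \<le> t"
      and ad: "adapted F U"
  shows "iexp_increment U s u"
  unfolding iexp_increment_def
proof (intro allI ballI impI)
  fix \<theta> :: real and Z :: "'w \<Rightarrow> complex"
  assume Z: "Z \<in> borel_measurable (F s)" and "\<exists>K. \<forall>\<omega>. cmod (Z \<omega>) \<le> K"
  then obtain K where K: "\<And>\<omega>. cmod (Z \<omega>) \<le> K" by blast
  have [measurable]: "U t \<in> borel_measurable (F t)" "U s \<in> borel_measurable (F t)"
      "Z \<in> borel_measurable (F t)"
    using adaptedD[OF ad] measurable_F_mono[OF Z] st by auto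
  define Z' where "Z' \<omega> = Z \<omega> * iexp (\<theta> * (U t \<omega> - U s \<omega>))" for \<omega>
  have "Z' \<in> borel_measurable (F t)" unfolding Z'_def using st by measurable
  moreover have "cmod (Z' \<omega>) \<le> K" for \<omega>
    unfolding Z'_def using K by (simp add: norm_mult del: of_real_mult)
  ultimately have "(CLINT \<omega>|M. Z' \<omega> * iexp (\<theta> * (U u \<omega> - U t \<omega>))) =
      complex_of_real (exp (- ((u - t) * \<theta>\<^sup>2) / 2)) * (CLINT \<omega>|M. Z' \<omega>)"
    using assms(2) unfolding iexp_increment_def by blast
  also have "(CLINT \<omega>|M. Z' \<omega>) = complex_of_real (exp (- ((t - s) * \<theta>\<^sup>2) / 2)) * (CLINT \<omega>|M. Z \<omega>)"
    using assms(1) Z K unfolding iexp_increment_def Z'_def by blast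
  also have "(\<lambda>\<omega>. Z' \<omega> * iexp (\<theta> * (U u \<omega> - U t \<omega>))) = (\<lambda>\<omega>. Z \<omega> * iexp (\<theta> * (U u \<omega> - U s \<omega>)))"
    unfolding Z'_def mult.assoc exp_add[symmetric] by (simp add: algebra_simps)
  also have "complex_of_real (exp (- ((u - t) * \<theta>\<^sup>2) / 2))
      * (complex_of_real (exp (- ((t - s) * \<theta>\<^sup>2) / 2)) * (CLINT \<omega>|M. Z \<omega>))
      = complex_of_real (exp (- ((u - s) * \<theta>\<^sup>2) / 2)) * (CLINT \<omega>|M. Z \<omega>)"
  proof -
    have "exp (- ((u - t) * \<theta>\<^sup>2) / 2) * exp (- ((t - s) * \<theta>\<^sup>2) / 2) = exp (- ((u - s) * \<theta>\<^sup>2) / 2)"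
      unfolding exp_add[symmetric] by (simp add: field_simps)
    then show ?thesis by (metis mult.assoc of_real_mult)
  qed
  finally show "(CLINT \<omega>|M. Z \<omega> * iexp (\<theta> * (U u \<omega> - U s \<omega>))) =
       complex_of_real (exp (- ((u - s) * \<theta>\<^sup>2) / 2)) * (CLINT \<omega>|M. Z \<omega>)" .
qed

text \<open>All integrands are bounded by the same \<open>K\<close>, so almost sure convergence at
  the two times suffices for dominated convergence.\<close>

lemma iexp_increment_limit:
  assumes inc: "\<And>j. iexp_increment (U j) s t" and st: "0 \<le> s" "s \<le> t"
    and ad: "\<And>j. adapted F (U j)" "adapted F V"
    and lim: "AE \<omega> in M. (\<lambda>j. U j s \<omega>) \<longlonglongrightarrow> V s \<omega>" "AE \<omega> in M. (\<lambda>j. U j t \<omega>) \<longlonglongrightarrow> V t \<omega>"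
  shows "iexp_increment V s t"
  unfolding iexp_increment_def
proof (intro allI ballI impI)
  fix \<theta> :: real and Z :: "'w \<Rightarrow> complex"
  assume Z: "Z \<in> borel_measurable (F s)" and "\<exists>K. \<forall>\<omega>. cmod (Z \<omega>) \<le> K"
  then obtain K where K: "\<And>\<omega>. cmod (Z \<omega>) \<le> K" by blast
  have [measurable]: "Z \<in> borel_measurable M" "\<And>j. U j s \<in> borel_measurable M"
      "\<And>j. U j t \<in> borel_measurable M"
    "V s \<in> borel_measurable M" "V t \<in> borel_measurable M"
    using measurable_F_M[OF Z] adapted_measurable[OF ad(1)] adapted_measurable[OF ad(2)] st by auto
  have "(\<lambda>j. CLINT \<omega>|M. Z \<omega> * iexp (\<theta> * (U j t \<omega> - U j s \<omega>)))
      \<longlonglongrightarrow> (CLINT \<omega>|M. Z \<omega> * iexp (\<theta> * (V t \<omega> - V s \<omega>)))"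
  proof (rule integral_dominated_convergence[where w="\<lambda>_. K"])
    show "AE \<omega> in M. (\<lambda>j. Z \<omega> * iexp (\<theta> * (U j t \<omega> - U j s \<omega>))) \<longlonglongrightarrow> Z \<omega> * iexp (\<theta> * (V t \<omega> - V s \<omega>))"
      using lim by eventually_elim (intro tendsto_intros)
    show "AE \<omega> in M. norm (Z \<omega> * iexp (\<theta> * (U j t \<omega> - U j s \<omega>))) \<le> K" for j
      using K by (simp add: norm_mult del: of_real_mult)
  qed auto
  moreover have "(CLINT \<omega>|M. Z \<omega> * iexp (\<theta> * (U j t \<omega> - U j s \<omega>))) =
      complex_of_real (exp (- ((t - s) * \<theta>\<^sup>2) / 2)) * (CLINT \<omega>|M. Z \<omega>)" for j
    using inc[of j] Z K unfolding iexp_increment_def by blast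
  ultimately show "(CLINT \<omega>|M. Z \<omega> * iexp (\<theta> * (V t \<omega> - V s \<omega>))) =
       complex_of_real (exp (- ((t - s) * \<theta>\<^sup>2) / 2)) * (CLINT \<omega>|M. Z \<omega>)"
    by (simp only: LIMSEQ_const_iff)
qed

text \<open>Testing with the indicator of an event \<open>A\<close> of \<open>F s\<close> shows that
  the increment has the same characteristic function under the conditional probability given
  \<open>A\<close> as under the original one. Levy's uniqueness theorem identifies the two laws, and
  this is independence.\<close>

lemma iexp_increment_imp_wiener:
  assumes ad: "adapted F U" and U0: "AE \<omega> in M. U 0 \<omega> = 0"
    and cont: "AE \<omega> in M. continuous_on {0..} (\<lambda>t. U t \<omega>)"
    and inc: "\<And>s t. 0 \<le> s \<Longrightarrow> s < t \<Longrightarrow> iexp_increment U s t"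
  shows "real_wiener_process M F U"
  unfolding wiener_process_def
proof (intro conjI allI impI ad U0 cont)
  fix s t :: real assume st: "0 \<le> s \<and> s < t"
  define D where "D \<omega> = U t \<omega> - U s \<omega>" for \<omega>
  have [measurable]: "D \<in> borel_measurable M"
    unfolding D_def using adapted_measurable[OF ad] st by (intro borel_measurable_diff) auto
  have E: "(CLINT \<omega>|M. Z \<omega> * iexp (\<theta> * D \<omega>)) = complex_of_real (exp (- ((t - s) * \<theta>\<^sup>2) / 2))
      * (CLINT \<omega>|M. Z \<omega>)"
    if "Z \<in> borel_measurable (F s)" "\<And>\<omega>. cmod (Z \<omega>) \<le> 1" for Z \<theta>
    using inc[of s t] st that unfolding iexp_increment_def D_def by blast
  have E1: "(CLINT \<omega>|M. iexp (\<theta> * D \<omega>)) = exp (- ((t - s) * \<theta>\<^sup>2) / 2)" for \<theta>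
    using E[of "\<lambda>_. 1" \<theta>] by (simp add: prob_space)
  have rd: "real_distribution (distr M borel X)" if "X \<in> borel_measurable M" for X
    using that by (intro real_distribution_distr)
  show "distr M borel (\<lambda>\<omega>. (U t \<omega> - U s \<omega>) \<bullet> h) = centred_normal ((t - s) * (id_blinfun h \<bullet> h))"
      for h
  proof (rule Levy_uniqueness)
    have nn: "0 \<le> (t - s) * (id_blinfun h \<bullet> h)" using st by simp
    show "real_distribution (distr M borel (\<lambda>\<omega>. (U t \<omega> - U s \<omega>) \<bullet> h))"
      unfolding D_def[symmetric] by (intro rd) simp
    show "real_distribution (centred_normal ((t - s) * (id_blinfun h \<bullet> h)))"
      by (intro real_distribution_centred_normal nn)
    show "char (distr M borel (\<lambda>\<omega>. (U t \<omega> - U s \<omega>) \<bullet> h))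
        = char (centred_normal ((t - s) * (id_blinfun h \<bullet> h)))"
    proof
      fix \<theta>
      have "char (distr M borel (\<lambda>\<omega>. D \<omega> * h)) \<theta> = (CLINT \<omega>|M. iexp ((\<theta> * h) * D \<omega>))"
        unfolding char_def by (subst integral_distr) (auto simp: mult_ac)
      also have "\<dots> = exp (- ((t - s) * (\<theta> * h)\<^sup>2) / 2)" by (rule E1)
      also have "\<dots> = char (centred_normal ((t - s) * (id_blinfun h \<bullet> h))) \<theta>"
        unfolding char_centred_normal[OF nn] by (simp add: power2_eq_square mult_ac)
      finally show "char (distr M borel (\<lambda>\<omega>. (U t \<omega> - U s \<omega>) \<bullet> h)) \<theta>
          = char (centred_normal ((t - s) * (id_blinfun h \<bullet> h))) \<theta>"
        by (simp add: D_def)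
    qed
  qed
  have indep: "prob (A \<inter> (D -` E \<inter> space M)) = prob A * prob (D -` E \<inter> space M)"
    if A: "A \<in> sets (F s)" and [measurable]: "E \<in> sets borel" for A E
  proof (cases "prob A = 0")
    case True
    have [measurable]: "A \<in> sets M" using A sets_F_subset by auto
    have "prob (A \<inter> (D -` E \<inter> space M)) \<le> prob A" by (intro finite_measure_mono) auto
    then show ?thesis using True measure_nonneg[of M "A \<inter> (D -` E \<inter> space M)"] by simp
  next
    case False
    have AM[measurable]: "A \<in> sets M" using A sets_F_subset by auto
    have pos: "prob A > 0" using False by (simp add: zero_less_measure_iff)
    \<comment> \<open>The conditional probability given \<open>A\<close>, which exists because
      \<open>prob A\<close> is positive here.\<close>
    define N where "N = density M (\<lambda>\<omega>. ennreal (indicator A \<omega> / prob A))"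
    have eN: "emeasure N X = ennreal (prob (A \<inter> X) / prob A)" if [measurable]: "X \<in> sets M" for X
    proof -
      have "emeasure N X = (\<integral>\<^sup>+\<omega>. ennreal (1 / prob A) * indicator (A \<inter> X) \<omega> \<partial>M)"
        unfolding N_def by (subst emeasure_density)
          (auto intro!: nn_integral_cong split: split_indicator)
      also have "\<dots> = ennreal (1 / prob A) * emeasure M (A \<inter> X)"
        by (rule nn_integral_cmult_indicator) measurable
      also have "\<dots> = ennreal (prob (A \<inter> X) / prob A)"
        using pos by (simp add: emeasure_eq_measure flip: ennreal_mult')
      finally show ?thesis .
    qed
    interpret N: prob_space N
    proof
      have "A \<inter> space M = A" using sets.sets_into_space[OF AM] by auto
      then show "emeasure N (space N) = 1"
        using eN[of "space M"] pos by (simp add: N_def)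
    qed
    have [measurable_cong]: "sets N = sets M" by (simp add: N_def)
    have "distr N borel D = distr M borel D"
    proof (rule Levy_uniqueness)
      show "real_distribution (distr N borel D)" by (rule N.real_distribution_distr) measurable
      show "real_distribution (distr M borel D)" by (rule rd) measurable
      show "char (distr N borel D) = char (distr M borel D)"
      proof
        fix \<theta>
        have "char (distr N borel D) \<theta> = (CLINT \<omega>|N. iexp (\<theta> * D \<omega>))"
          unfolding char_def by (subst integral_distr) auto
        also have "\<dots> = (CLINT \<omega>|M. (indicator A \<omega> / prob A) *\<^sub>R iexp (\<theta> * D \<omega>))"
          unfolding N_def using pos by (intro integral_density) auto
        also have "\<dots> = (CLINT \<omega>|M. (1 / prob A) *\<^sub>R (indicator A \<omega> * iexp (\<theta> * D \<omega>)))"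
          by (intro Bochner_Integration.integral_cong) (auto split: split_indicator)
        also have "\<dots> = (1 / prob A) *\<^sub>R (CLINT \<omega>|M. indicator A \<omega> * iexp (\<theta> * D \<omega>))"
          by simp
        also have "(CLINT \<omega>|M. indicator A \<omega> * iexp (\<theta> * D \<omega>))
            = complex_of_real (exp (- ((t - s) * \<theta>\<^sup>2) / 2)) * (CLINT \<omega>|M. indicator A \<omega>)"
          using A by (intro E) (auto split: split_indicator)
        also have "(CLINT \<omega>|M. indicator A \<omega>) = (CLINT \<omega>|M. complex_of_real (indicator A \<omega>))"
          by (intro Bochner_Integration.integral_cong) (auto split: split_indicator)
        also have "\<dots> = complex_of_real (prob A)"
          using sets.sets_into_space[OF AM] by (simp add: Int_absorb2)
        also have "(1 / prob A) *\<^sub>R (exp (- ((t - s) * \<theta>\<^sup>2) / 2) * complex_of_real (prob A))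
            = exp (- ((t - s) * \<theta>\<^sup>2) / 2)"
          using pos by (simp add: scaleR_conv_of_real)
        also have "\<dots> = (CLINT \<omega>|M. iexp (\<theta> * D \<omega>))" by (rule E1[symmetric])
        also have "\<dots> = char (distr M borel D) \<theta>"
          unfolding char_def by (subst integral_distr) auto
        finally show "char (distr N borel D) \<theta> = char (distr M borel D) \<theta>" .
      qed
    qed
    then have "emeasure (distr N borel D) E = emeasure (distr M borel D) E" by simp
    then have "emeasure N (D -` E \<inter> space M) = emeasure M (D -` E \<inter> space M)"
      by (simp add: emeasure_distr N_def)
    then have "ennreal (prob (A \<inter> (D -` E \<inter> space M)) / prob A) = ennreal (prob (D -` E \<inter> space M))"
      by (simp add: eN emeasure_eq_measure)
    then have "prob (A \<inter> (D -` E \<inter> space M)) / prob A = prob (D -` E \<inter> space M)"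
      using pos by (subst (asm) ennreal_inj) (auto simp: measure_nonneg)
    then show ?thesis using pos by (simp add: field_simps)
  qed
  have "sets (vimage_algebra (space M) D borel) = {D -` A \<inter> space M |A. A \<in> sets borel}"
    by (rule sets_vimage_algebra2) simp
  then show "indep_set (sets (F s)) (sets (vimage_algebra (space M) (\<lambda>\<omega>. U t \<omega> - U s \<omega>) borel))"
    unfolding indep_sets2_eq D_def[symmetric] using sets_F_subset indep by auto
qed

end

section \<open>Square integrable martingales\<close>

context filtered_prob_space
begin

section \<open>Square integrable variables and discrete martingales\<close>

lemma sq_integrable_mult:
  fixes X Y :: "'w \<Rightarrow> real"
  assumes [measurable]: "X \<in> borel_measurable M" "Y \<in> borel_measurable M"
    and "integrable M (\<lambda>\<omega>. (X \<omega>)\<^sup>2)" "integrable M (\<lambda>\<omega>. (Y \<omega>)\<^sup>2)"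
  shows "integrable M (\<lambda>\<omega>. X \<omega> * Y \<omega>)"
proof (rule Bochner_Integration.integrable_bound)
  show "integrable M (\<lambda>\<omega>. (X \<omega>)\<^sup>2 + (Y \<omega>)\<^sup>2)" using assms by auto
  have "\<bar>x * y\<bar> \<le> x\<^sup>2 + y\<^sup>2" for x y :: real
  proof -
    have "2 * (\<bar>x\<bar> * \<bar>y\<bar>) \<le> x\<^sup>2 + y\<^sup>2" using sum_squares_bound[of "\<bar>x\<bar>" "\<bar>y\<bar>"] by simp
    moreover have "0 \<le> \<bar>x\<bar> * \<bar>y\<bar>" by simp
    ultimately show ?thesis unfolding abs_mult by linarith
  qed
  then show "AE \<omega> in M. norm (X \<omega> * Y \<omega>) \<le> norm ((X \<omega>)\<^sup>2 + (Y \<omega>)\<^sup>2)" by simp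
qed measurable

lemma sq_integrable_integrable:
  fixes X :: "'w \<Rightarrow> real"
  assumes "X \<in> borel_measurable M" "integrable M (\<lambda>\<omega>. (X \<omega>)\<^sup>2)"
  shows "integrable M X"
  using sq_integrable_mult[of X "\<lambda>_. 1"] assms by simp

lemma sq_integrable_diff:
  fixes X Y :: "'w \<Rightarrow> real"
  assumes "X \<in> borel_measurable M" "Y \<in> borel_measurable M"
    and "integrable M (\<lambda>\<omega>. (X \<omega>)\<^sup>2)" "integrable M (\<lambda>\<omega>. (Y \<omega>)\<^sup>2)"
  shows "integrable M (\<lambda>\<omega>. (X \<omega> - Y \<omega>)\<^sup>2)"
proof -
  have "integrable M (\<lambda>\<omega>. (X \<omega>)\<^sup>2 + (Y \<omega>)\<^sup>2 - 2 * (X \<omega> * Y \<omega>))"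
    using assms sq_integrable_mult[OF assms] by auto
  then show ?thesis by (simp add: power2_diff mult.assoc)
qed

lemma sq_integrable_bounded_mult:
  fixes X \<xi> :: "'w \<Rightarrow> real"
  assumes [measurable]: "X \<in> borel_measurable M" "\<xi> \<in> borel_measurable M"
    and K: "\<And>\<omega>. \<omega> \<in> space M \<Longrightarrow> \<bar>\<xi> \<omega>\<bar> \<le> K" and int: "integrable M (\<lambda>\<omega>. (X \<omega>)\<^sup>2)"
  shows "integrable M (\<lambda>\<omega>. (\<xi> \<omega> * X \<omega>)\<^sup>2)"
    and "(LINT \<omega>|M. (\<xi> \<omega> * X \<omega>)\<^sup>2) \<le> K\<^sup>2 * (LINT \<omega>|M. (X \<omega>)\<^sup>2)"
proof -
  have le: "(\<xi> \<omega> * X \<omega>)\<^sup>2 \<le> K\<^sup>2 * (X \<omega>)\<^sup>2" if "\<omega> \<in> space M" for \<omega>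
    using power_mono[OF K[OF that], of 2] by (simp add: power_mult_distrib mult_right_mono)
  show i: "integrable M (\<lambda>\<omega>. (\<xi> \<omega> * X \<omega>)\<^sup>2)"
    by (rule Bochner_Integration.integrable_bound[of M "\<lambda>\<omega>. K\<^sup>2 * (X \<omega>)\<^sup>2"])
      (use int le in \<open>auto intro!: AE_I2\<close>)
  have "(LINT \<omega>|M. (\<xi> \<omega> * X \<omega>)\<^sup>2) \<le> (LINT \<omega>|M. K\<^sup>2 * (X \<omega>)\<^sup>2)"
    using int le by (intro integral_mono i) auto
  then show "(LINT \<omega>|M. (\<xi> \<omega> * X \<omega>)\<^sup>2) \<le> K\<^sup>2 * (LINT \<omega>|M. (X \<omega>)\<^sup>2)" by simp
qed

text \<open>The vanishing integrals over events of \<open>F s\<close> say that the conditional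
  expectation of \<open>D\<close> is zero, and the factor \<open>Z\<close>, known at time s, can be
  taken out of it.\<close>

lemma orthogonal_to_past:
  fixes Z D :: "'w \<Rightarrow> real"
  assumes Z: "Z \<in> borel_measurable (F s)" and D: "integrable M D"
    and 0: "\<And>A. A \<in> sets (F s) \<Longrightarrow> (LINT \<omega>|M. indicator A \<omega> * D \<omega>) = 0"
    and ZD: "integrable M (\<lambda>\<omega>. Z \<omega> * D \<omega>)"
  shows "(LINT \<omega>|M. Z \<omega> * D \<omega>) = 0"
proof -
  interpret finite_measure_subalgebra M "F s"
    by unfold_locales (rule subalgebra_F)
  have [measurable]: "D \<in> borel_measurable M" "Z \<in> borel_measurable M"
    using D measurable_F_M[OF Z] by auto
  have "AE \<omega> in M. real_cond_exp M (F s) D \<omega> = 0"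
    using D 0 by (intro real_cond_exp_charact) (auto simp: set_lebesgue_integral_def)
  then have "(LINT \<omega>|M. Z \<omega> * real_cond_exp M (F s) D \<omega>) = (LINT \<omega>|M. 0)"
    by (intro integral_cong_AE) auto
  then show ?thesis using real_cond_exp_intg(2)[OF ZD Z] D by auto
qed

text \<open>Discrete time: \<open>X i\<close> is known at time \<open>\<tau> i\<close>.\<close>

definition sq_martingale_seq :: "(nat \<Rightarrow> real) \<Rightarrow> (nat \<Rightarrow> 'w \<Rightarrow> real) \<Rightarrow> bool" where
  "sq_martingale_seq \<tau> X \<longleftrightarrow> mono \<tau> \<and> (\<forall>i. X i \<in> borel_measurable (F (\<tau> i)) \<and>
     integrable M (\<lambda>\<omega>. (X i \<omega>)\<^sup>2) \<and>
     (\<forall>A\<in>sets (F (\<tau> i)). (LINT \<omega>|M. indicator A \<omega> * (X (Suc i) \<omega> - X i \<omega>)) = 0))"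

lemma sq_martingale_seqD:
  assumes "sq_martingale_seq \<tau> X"
  shows "mono \<tau>" "X i \<in> borel_measurable (F (\<tau> i))" "X i \<in> borel_measurable M"
    "integrable M (\<lambda>\<omega>. (X i \<omega>)\<^sup>2)" "integrable M (X i)"
    "integrable M (\<lambda>\<omega>. (X (Suc i) \<omega> - X i \<omega>)\<^sup>2)"
proof -
  have m: "X i \<in> borel_measurable M" "integrable M (\<lambda>\<omega>. (X i \<omega>)\<^sup>2)" for i
    using assms measurable_F_M unfolding sq_martingale_seq_def by blast+
  show "mono \<tau>" "X i \<in> borel_measurable (F (\<tau> i))"
    using assms unfolding sq_martingale_seq_def by blast+
  show "X i \<in> borel_measurable M" "integrable M (\<lambda>\<omega>. (X i \<omega>)\<^sup>2)" "integrable M (X i)"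
    "integrable M (\<lambda>\<omega>. (X (Suc i) \<omega> - X i \<omega>)\<^sup>2)"
    using m by (auto intro: sq_integrable_integrable sq_integrable_diff)
qed

lemma sq_martingale_seq_orthogonal:
  assumes X: "sq_martingale_seq \<tau> X"
      and Z: "Z \<in> borel_measurable (F (\<tau> i))" "integrable M (\<lambda>\<omega>. (Z \<omega>)\<^sup>2)"
  shows "integrable M (\<lambda>\<omega>. Z \<omega> * (X (Suc i) \<omega> - X i \<omega>))"
    and "(LINT \<omega>|M. Z \<omega> * (X (Suc i) \<omega> - X i \<omega>)) = 0"
proof -
  show i: "integrable M (\<lambda>\<omega>. Z \<omega> * (X (Suc i) \<omega> - X i \<omega>))"
    using sq_martingale_seqD[OF X] measurable_F_M[OF Z(1)] Z(2)
    by (intro sq_integrable_mult) auto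
  show "(LINT \<omega>|M. Z \<omega> * (X (Suc i) \<omega> - X i \<omega>)) = 0"
    using X sq_martingale_seqD(5)[OF X]
    by (intro orthogonal_to_past[OF Z(1)] i) (auto simp: sq_martingale_seq_def)
qed

text \<open>Each increment is orthogonal to the value before it, so the cross term in the square of
  \<open>X (Suc n)\<close> integrates to zero.\<close>

lemma sq_martingale_seq_pythagoras:
  assumes X: "sq_martingale_seq \<tau> X"
  shows "(LINT \<omega>|M. (X n \<omega>)\<^sup>2) =
    (LINT \<omega>|M. (X 0 \<omega>)\<^sup>2) + (\<Sum>i<n. LINT \<omega>|M. (X (Suc i) \<omega> - X i \<omega>)\<^sup>2)"
proof (induction n)
  case (Suc n)
  note o = sq_martingale_seq_orthogonal[OF X sq_martingale_seqD(2,4)[OF X, of n]]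
  have "(LINT \<omega>|M. (X (Suc n) \<omega>)\<^sup>2) =
      (LINT \<omega>|M. (X n \<omega>)\<^sup>2 + (X (Suc n) \<omega> - X n \<omega>)\<^sup>2 + 2 * (X n \<omega> * (X (Suc n) \<omega> - X n \<omega>)))"
    by (intro Bochner_Integration.integral_cong) (auto simp: power2_eq_square algebra_simps)
  also have "\<dots> = (LINT \<omega>|M. (X n \<omega>)\<^sup>2) + (LINT \<omega>|M. (X (Suc n) \<omega> - X n \<omega>)\<^sup>2)
      + 2 * (LINT \<omega>|M. X n \<omega> * (X (Suc n) \<omega> - X n \<omega>))"
    using sq_martingale_seqD[OF X] o(1) by simp
  finally show ?case using Suc o(2) by simp
qed simp

text \<open>
  Kolmogorov's inequality, by induction on \<open>n\<close> with the second moment restricted to the event on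
  the right hand side.
\<close>

lemma sq_martingale_seq_maximal:
  assumes X: "sq_martingale_seq \<tau> X" and "0 < \<delta>"
  shows "prob {\<omega>\<in>space M. \<exists>i\<le>n. \<delta> < \<bar>X i \<omega>\<bar>} \<le> (LINT \<omega>|M. (X n \<omega>)\<^sup>2) / \<delta>\<^sup>2"
proof -
  define C where "C n = {\<omega>\<in>space M. \<exists>i\<le>n. \<delta> < \<bar>X i \<omega>\<bar>}" for n
  have Xm: "X i \<in> borel_measurable (F (\<tau> n))" if "i \<le> n" for i n
    using measurable_F_mono[OF sq_martingale_seqD(2)[OF X]
        monoD[OF sq_martingale_seqD(1)[OF X] that]] .
  have C: "C n \<in> sets (F (\<tau> n))" for n
  proof -
    have "C n = (\<Union>i\<in>{..n}. {\<omega>\<in>space (F (\<tau> n)). \<delta> < \<bar>X i \<omega>\<bar>})"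
      by (auto simp: C_def space_F)
    also have "\<dots> \<in> sets (F (\<tau> n))"
      using Xm by (intro sets.finite_UN) (auto intro!: borel_measurable_less borel_measurable_abs)
    finally show ?thesis .
  qed
  have CM[measurable]: "C n \<in> sets M" for n using C sets_F_subset by blast
  note [measurable] = sq_martingale_seqD(3)[OF X]
  have intC: "integrable M (\<lambda>\<omega>. indicator (C k) \<omega> * (X m \<omega>)\<^sup>2)" for k m
    using integrable_mult_indicator[OF CM sq_martingale_seqD(4)[OF X]] by simp
  have ind: "integrable M (\<lambda>\<omega>. \<delta>\<^sup>2 * indicator B \<omega> :: real)"
    and int_ind: "(LINT \<omega>|M. \<delta>\<^sup>2 * indicator B \<omega>) = \<delta>\<^sup>2 * prob B" if "B \<in> sets M" for B
    using that sets.sets_into_space[OF that]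
    by (auto intro!: integrable_mult_right integrable_real_indicator simp: emeasure_eq_measure
        Int_absorb2)
  have "\<delta>\<^sup>2 * prob (C n) \<le> (LINT \<omega>|M. indicator (C n) \<omega> * (X n \<omega>)\<^sup>2)"
  proof (induction n)
    case 0
    have "(LINT \<omega>|M. \<delta>\<^sup>2 * indicator (C 0) \<omega>) \<le> (LINT \<omega>|M. indicator (C 0) \<omega> * (X 0 \<omega>)\<^sup>2)"
    proof (rule integral_mono[OF _ intC])
      fix \<omega> show "\<delta>\<^sup>2 * indicator (C 0) \<omega> \<le> indicator (C 0) \<omega> * (X 0 \<omega>)\<^sup>2"
        using power_mono[of \<delta> "\<bar>X 0 \<omega>\<bar>" 2] \<open>0 < \<delta>\<close> by (auto simp: C_def split: split_indicator)
    qed (rule ind[OF CM])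
    then show ?case by (simp only: int_ind[OF CM])
  next
    case (Suc n)
    define D where "D \<omega> = X (Suc n) \<omega> - X n \<omega>" for \<omega>
    have ind2: "(indicator (C n) \<omega> * X n \<omega>)\<^sup>2 = indicator (C n) \<omega> * (X n \<omega>)\<^sup>2" for \<omega>
      by (auto split: split_indicator)
    have "(\<lambda>\<omega>. indicator (C n) \<omega> * X n \<omega>) \<in> borel_measurable (F (\<tau> n))"
      using C[of n] Xm[of n n] by measurable
    from sq_martingale_seq_orthogonal[OF X this]
    have o: "integrable M (\<lambda>\<omega>. indicator (C n) \<omega> * X n \<omega> * D \<omega>)"
      "(LINT \<omega>|M. indicator (C n) \<omega> * X n \<omega> * D \<omega>) = 0"
      using intC by (auto simp: ind2 D_def)
    have iD: "integrable M (\<lambda>\<omega>. indicator (C n) \<omega> * (D \<omega>)\<^sup>2)"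
      using integrable_mult_indicator[OF CM sq_martingale_seqD(6)[OF X]] by (simp add: D_def)
    have "(LINT \<omega>|M. indicator (C n) \<omega> * (X (Suc n) \<omega>)\<^sup>2) =
      (LINT \<omega>|M. indicator (C n) \<omega> * (X n \<omega>)\<^sup>2 + indicator (C n) \<omega> * (D \<omega>)\<^sup>2
        + 2 * (indicator (C n) \<omega> * X n \<omega> * D \<omega>))"
      by (intro Bochner_Integration.integral_cong) (auto simp: power2_eq_square algebra_simps D_def)
    also have "\<dots> = (LINT \<omega>|M. indicator (C n) \<omega> * (X n \<omega>)\<^sup>2)
        + (LINT \<omega>|M. indicator (C n) \<omega> * (D \<omega>)\<^sup>2)"
      using intC iD o by simp
    \<comment> \<open>The event \<open>C n\<close> is known at time \<open>\<tau> n\<close>, so the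
      cross term vanishes even after restriction to it, and the restricted second moment can only
      grow.\<close>
    finally have step: "(LINT \<omega>|M. indicator (C n) \<omega> * (X n \<omega>)\<^sup>2)
        \<le> (LINT \<omega>|M. indicator (C n) \<omega> * (X (Suc n) \<omega>)\<^sup>2)"
      by simp
    have sub: "C n \<subseteq> C (Suc n)" by (auto simp: C_def intro: le_SucI)
    have dM: "C (Suc n) - C n \<in> sets M" by measurable
    have "\<delta>\<^sup>2 * prob (C (Suc n)) = \<delta>\<^sup>2 * prob (C n) + \<delta>\<^sup>2 * prob (C (Suc n) - C n)"
    proof -
      have "prob (C (Suc n)) = prob (C n) + prob (C (Suc n) - C n)"
        using finite_measure_Diff[OF CM CM sub] by simp
      then show ?thesis by (simp only: distrib_left)
    qed
    also have "\<dots> \<le> (LINT \<omega>|M. indicator (C n) \<omega> * (X (Suc n) \<omega>)\<^sup>2)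
        + (LINT \<omega>|M. \<delta>\<^sup>2 * indicator (C (Suc n) - C n) \<omega>)"
      unfolding int_ind[OF dM] using Suc step by simp
    also have "\<dots> = (LINT \<omega>|M. indicator (C n) \<omega> * (X (Suc n) \<omega>)\<^sup>2 + \<delta>\<^sup>2
        * indicator (C (Suc n) - C n) \<omega>)"
      by (rule Bochner_Integration.integral_add[OF intC ind[OF dM], symmetric])
    also have "\<dots> \<le> (LINT \<omega>|M. indicator (C (Suc n)) \<omega> * (X (Suc n) \<omega>)\<^sup>2)"
    \<comment> \<open>A point that is in \<open>C (Suc n)\<close> but not in \<open>C n\<close>
      crosses the level exactly at the last index, where the square therefore exceeds that of
      \<delta>.\<close>
    proof (rule integral_mono[OF _ intC])
      fix \<omega>
      have "\<delta>\<^sup>2 \<le> (X (Suc n) \<omega>)\<^sup>2" if "\<omega> \<in> C (Suc n)" "\<omega> \<notin> C n"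
      proof -
        have "\<delta> < \<bar>X (Suc n) \<omega>\<bar>" using that by (auto simp: C_def le_Suc_eq)
        then show ?thesis using power_mono[of \<delta> "\<bar>X (Suc n) \<omega>\<bar>" 2] \<open>0 < \<delta>\<close> by simp
      qed
      with sub show "indicator (C n) \<omega> * (X (Suc n) \<omega>)\<^sup>2 + \<delta>\<^sup>2 * indicator (C (Suc n) - C n) \<omega>
          \<le> indicator (C (Suc n)) \<omega> * (X (Suc n) \<omega>)\<^sup>2"
        by (auto split: split_indicator)
    qed (intro Bochner_Integration.integrable_add intC ind dM)
    finally show ?case .
  qed
  also have "\<dots> \<le> (LINT \<omega>|M. (X n \<omega>)\<^sup>2)"
    by (intro integral_mono intC sq_martingale_seqD(4)[OF X]) (auto split: split_indicator)
  finally show ?thesis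
    using \<open>0 < \<delta>\<close> by (simp add: C_def field_simps)
qed

section \<open>Martingales in continuous time\<close>

definition sq_martingale :: "(real \<Rightarrow> 'w \<Rightarrow> real) \<Rightarrow> bool" where
  "sq_martingale R \<longleftrightarrow> adapted F R \<and> (\<forall>t\<ge>0. integrable M (\<lambda>\<omega>. (R t \<omega>)\<^sup>2)) \<and>
     (\<forall>s t. 0 \<le> s \<and> s \<le> t \<longrightarrow> (\<forall>A\<in>sets (F s). (LINT \<omega>|M. indicator A \<omega> * (R t \<omega> - R s \<omega>)) = 0))"

lemma sq_martingaleD:
  assumes "sq_martingale R"
  shows "adapted F R" "0 \<le> t \<Longrightarrow> R t \<in> borel_measurable M" "0 \<le> t \<Longrightarrow> integrable M (\<lambda>\<omega>. (R t \<omega>)\<^sup>2)"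
    "0 \<le> t \<Longrightarrow> integrable M (R t)"
    "0 \<le> s \<Longrightarrow> s \<le> t \<Longrightarrow> A \<in> sets (F s) \<Longrightarrow> (LINT \<omega>|M. indicator A \<omega> * (R t \<omega> - R s \<omega>)) = 0"
  using assms adapted_measurable sq_integrable_integrable unfolding sq_martingale_def by blast+

lemma sq_martingale_grid:
  assumes "sq_martingale R" "mono \<tau>" "0 \<le> \<tau> 0"
  shows "sq_martingale_seq \<tau> (\<lambda>i. R (\<tau> i))"
proof -
  have pos: "0 \<le> \<tau> i" for i using monoD[OF assms(2), of 0 i] assms(3) by simp
  have le: "\<tau> i \<le> \<tau> (Suc i)" for i using monoD[OF assms(2)] by simp
  show ?thesis
    unfolding sq_martingale_seq_def
    using assms(2) adaptedD[OF sq_martingaleD(1)[OF assms(1)] pos order_refl]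
      sq_martingaleD(3)[OF assms(1) pos] sq_martingaleD(5)[OF assms(1) pos le]
    by blast
qed

lemma sq_martingale_diff:
  assumes R: "sq_martingale R" "sq_martingale S"
  shows "sq_martingale (\<lambda>t \<omega>. R t \<omega> - S t \<omega>)"
  unfolding sq_martingale_def
proof (intro conjI allI impI ballI)
  show "adapted F (\<lambda>t \<omega>. R t \<omega> - S t \<omega>)"
    using sq_martingaleD(1)[OF R(1)] sq_martingaleD(1)[OF R(2)] unfolding adapted_def
    by (auto intro: borel_measurable_diff)
  show "integrable M (\<lambda>\<omega>. (R t \<omega> - S t \<omega>)\<^sup>2)" if "0 \<le> t" for t
    using that sq_martingaleD[OF R(1)] sq_martingaleD[OF R(2)] by (intro sq_integrable_diff) auto
  fix s t A assume st: "0 \<le> s \<and> s \<le> t" and A: "A \<in> sets (F s)"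
  have AM: "A \<in> sets M" by (rule subsetD[OF sets_F_subset A])
  have i: "integrable M (\<lambda>\<omega>. indicator A \<omega> * (T t \<omega> - T s \<omega>))" if "sq_martingale T" for T
    using integrable_mult_indicator[OF AM, of "\<lambda>\<omega>. T t \<omega> - T s \<omega>"] sq_martingaleD(4)[OF that] st
        by simp
  have "(LINT \<omega>|M. indicator A \<omega> * (R t \<omega> - S t \<omega> - (R s \<omega> - S s \<omega>))) =
      (LINT \<omega>|M. indicator A \<omega> * (R t \<omega> - R s \<omega>) - indicator A \<omega> * (S t \<omega> - S s \<omega>))"
    by (intro Bochner_Integration.integral_cong) (auto simp: algebra_simps)
  also have "\<dots> = 0"
    using st A i[OF R(1)] i[OF R(2)] sq_martingaleD(5)[OF R(1)] sq_martingaleD(5)[OF R(2)] by simp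
  finally show "(LINT \<omega>|M. indicator A \<omega> * (R t \<omega> - S t \<omega> - (R s \<omega> - S s \<omega>))) = 0" .
qed

lemma sq_martingale_0: "sq_martingale (\<lambda>t \<omega>. 0)"
  by (auto simp: sq_martingale_def adapted_def)

lemma sq_martingale_sum:
  assumes "\<And>i. i < (n::nat) \<Longrightarrow> sq_martingale (R i)"
  shows "sq_martingale (\<lambda>t \<omega>. \<Sum>i<n. R i t \<omega>)"
  using assms
proof (induction n)
  case (Suc n)
  have "sq_martingale (\<lambda>t \<omega>. (\<Sum>i<n. R i t \<omega>) - (0 - R n t \<omega>))"
    using Suc by (intro sq_martingale_diff sq_martingale_0) auto
  then show ?case by simp
qed (simp add: sq_martingale_0)

text \<open>One summand of a simple stochastic integral. Its increment over [s, t] is \<xi> times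
  the increment of \<open>R\<close> over the part of [a, b] inside [s, t], where \<xi> is already
  known.\<close>

lemma sq_martingale_step:
  assumes R: "sq_martingale R" and ab: "0 \<le> a" "a \<le> b"
    and \<xi>: "\<xi> \<in> borel_measurable (F a)" "\<And>\<omega>. \<omega> \<in> space M \<Longrightarrow> \<bar>\<xi> \<omega>\<bar> \<le> K"
  shows "sq_martingale (\<lambda>t \<omega>. \<xi> \<omega> * (R (min b t) \<omega> - R (min a t) \<omega>))"
  unfolding sq_martingale_def
proof (intro conjI allI impI ballI)
  note ad = adaptedD[OF sq_martingaleD(1)[OF R]]
  show "adapted F (\<lambda>t \<omega>. \<xi> \<omega> * (R (min b t) \<omega> - R (min a t) \<omega>))"
    unfolding adapted_def
  proof (intro allI impI)
    fix t :: real assume "0 \<le> t"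
    show "(\<lambda>\<omega>. \<xi> \<omega> * (R (min b t) \<omega> - R (min a t) \<omega>)) \<in> borel_measurable (F t)"
    proof (cases "a \<le> t")
      case True
      have [measurable]: "\<xi> \<in> borel_measurable (F t)" "R (min b t) \<in> borel_measurable (F t)"
          "R (min a t) \<in> borel_measurable (F t)"
        using measurable_F_mono[OF \<xi>(1) True] ad[of "min b t" t] ad[of "min a t" t] ab \<open>0 \<le> t\<close>
            by auto
      show ?thesis by measurable
    next
      case False
      \<comment> \<open>Before time a the height need not be measurable, but both clamped times
        equal t and the product is 0.\<close>
      then show ?thesis using ab by (simp add: min_def)
    qed
  qed
  note \<xi>M[measurable] = measurable_F_M[OF \<xi>(1)]
  show "integrable M (\<lambda>\<omega>. (\<xi> \<omega> * (R (min b t) \<omega> - R (min a t) \<omega>))\<^sup>2)" if "0 \<le> t" for t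
  proof (rule sq_integrable_bounded_mult(1)[OF _ \<xi>M \<xi>(2)])
    have "0 \<le> min b t" "0 \<le> min a t" using ab that by auto
    note * = sq_martingaleD(2,3)[OF R this(1)] sq_martingaleD(2,3)[OF R this(2)]
    show "(\<lambda>\<omega>. R (min b t) \<omega> - R (min a t) \<omega>) \<in> borel_measurable M"
      "integrable M (\<lambda>\<omega>. (R (min b t) \<omega> - R (min a t) \<omega>)\<^sup>2)"
      using * by (auto intro: sq_integrable_diff)
  qed
  fix s t A assume st: "0 \<le> s \<and> s \<le> t" and A[measurable]: "A \<in> sets (F s)"
  \<comment> \<open>Either u = v, or u is at least a and at least s; in the second case both \<xi>
    and the indicator of \<open>A\<close> are known at time u.\<close>
  define u v where "u = max a (min b s)" and "v = max a (min b t)"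
  have uv: "0 \<le> u" "u \<le> v" using ab st by (auto simp: u_def v_def)
  have eq: "indicator A \<omega> * (\<xi> \<omega> * (R (min b t) \<omega> - R (min a t) \<omega>) - \<xi> \<omega>
      * (R (min b s) \<omega> - R (min a s) \<omega>))
      = (indicator A \<omega> * \<xi> \<omega>) * (R v \<omega> - R u \<omega>)" for \<omega>
    using ab st by (auto simp: u_def v_def min_def max_def algebra_simps)
  show "(LINT \<omega>|M. indicator A \<omega> * (\<xi> \<omega> * (R (min b t) \<omega> - R (min a t) \<omega>) - \<xi> \<omega>
      * (R (min b s) \<omega> - R (min a s) \<omega>))) = 0"
  proof (cases "s < b \<and> a < t")
    case False
    then have "u = v" using st ab by (auto simp: u_def v_def min_def max_def)
    then show ?thesis unfolding eq by simp
  next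
    case True
    then have us: "s \<le> u" "a \<le> u" by (auto simp: u_def)
    have AM: "A \<in> sets M" by (rule subsetD[OF sets_F_subset A])
    have Z: "(\<lambda>\<omega>. indicator A \<omega> * \<xi> \<omega>) \<in> borel_measurable (F u)"
    proof -
      have [measurable]: "A \<in> sets (F u)" using A sets_F_mono[OF us(1)] by auto
      have [measurable]: "\<xi> \<in> borel_measurable (F u)" using measurable_F_mono[OF \<xi>(1) us(2)] .
      show ?thesis by measurable
    qed
    have "0 \<le> v" using uv by simp
    note m = sq_martingaleD(2,3,4)[OF R uv(1)] sq_martingaleD(2,3,4)[OF R \<open>0 \<le> v\<close>]
    show ?thesis unfolding eq
    proof (rule orthogonal_to_past[OF Z])
      show "integrable M (\<lambda>\<omega>. R v \<omega> - R u \<omega>)" using m by simp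
      show "(LINT \<omega>|M. indicator A' \<omega> * (R v \<omega> - R u \<omega>)) = 0" if "A' \<in> sets (F u)" for A'
        using sq_martingaleD(5)[OF R uv that] .
      have "integrable M (\<lambda>\<omega>. (indicator A \<omega> * \<xi> \<omega>)\<^sup>2)"
      proof (rule integrable_const_bound[of _ "K\<^sup>2"])
        show "AE \<omega> in M. norm ((indicator A \<omega> * \<xi> \<omega>)\<^sup>2) \<le> K\<^sup>2"
          using power_mono[OF \<xi>(2), of _ 2] by (intro AE_I2) (auto split: split_indicator)
      qed (use AM in measurable)
      then show "integrable M (\<lambda>\<omega>. indicator A \<omega> * \<xi> \<omega> * (R v \<omega> - R u \<omega>))"
        using m measurable_F_M[OF Z] by (intro sq_integrable_mult sq_integrable_diff) auto
    qed
  qed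
qed

text \<open>An inequality form of the Ito isometry. Grid increments of the integral are heights
  times increments of \<open>R\<close>, so Pythagoras on both sides compares the two second moments.
  The bound \<open>K\<close> stays explicit because it will grow along the approximating
  sequence.\<close>

lemma sq_martingale_simple_integral:
  assumes R: "sq_martingale R" and \<tau>: "mono \<tau>" "0 \<le> \<tau> 0"
    and \<xi>: "\<And>i. \<xi> i \<in> borel_measurable (F (\<tau> i))" "\<And>i \<omega>. \<omega> \<in> space M \<Longrightarrow> \<bar>\<xi> i \<omega>\<bar> \<le> K"
  shows "sq_martingale (simple_integral_process R n \<tau> \<xi>)"
    and "(LINT \<omega>|M. (simple_integral_process R n \<tau> \<xi> (\<tau> n) \<omega>)\<^sup>2) \<le> K\<^sup>2 * (LINT \<omega>|M. (R (\<tau> n) \<omega>)\<^sup>2)"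
proof -
  have pos: "0 \<le> \<tau> i" for i using monoD[OF \<tau>(1), of 0 i] \<tau>(2) by simp
  have le: "\<tau> i \<le> \<tau> j" if "i \<le> j" for i j using monoD[OF \<tau>(1) that] .
  show I: "sq_martingale (simple_integral_process R n \<tau> \<xi>)"
    unfolding simple_integral_process_def[abs_def]
    by (intro sq_martingale_sum sq_martingale_step[OF R pos le \<xi>]) auto
  note seqI = sq_martingale_grid[OF I \<tau>]
  note seqR = sq_martingale_grid[OF R \<tau>]
  have inc: "simple_integral_process R n \<tau> \<xi> (\<tau> (Suc m)) \<omega> - simple_integral_process R n \<tau> \<xi> (\<tau> m) \<omega>
      = \<xi> m \<omega> * (R (\<tau> (Suc m)) \<omega> - R (\<tau> m) \<omega>)" if "m < n" for m \<omega>
  proof -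
    have "simple_integral_process R n \<tau> \<xi> (\<tau> (Suc m)) \<omega> - simple_integral_process R n \<tau> \<xi> (\<tau> m) \<omega>
      = (\<Sum>i<n. if i = m then \<xi> m \<omega> * (R (\<tau> (Suc m)) \<omega> - R (\<tau> m) \<omega>) else 0)"
      unfolding simple_integral_process_def sum_subtractf[symmetric]
    proof (rule sum.cong)
      fix i
      consider "i = m" | "Suc i \<le> m" | "Suc m \<le> i" by linarith
      then show "\<xi> i \<omega> * (R (min (\<tau> (Suc i)) (\<tau> (Suc m))) \<omega> - R (min (\<tau> i) (\<tau> (Suc m))) \<omega>) -
         \<xi> i \<omega> * (R (min (\<tau> (Suc i)) (\<tau> m)) \<omega> - R (min (\<tau> i) (\<tau> m)) \<omega>) =
         (if i = m then \<xi> m \<omega> * (R (\<tau> (Suc m)) \<omega> - R (\<tau> m) \<omega>) else 0)"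
      proof cases
        case 1
        then show ?thesis using le[of m "Suc m"] by (simp add: min_def)
      next
        case 2
        then have "\<tau> (Suc i) \<le> \<tau> m" "\<tau> i \<le> \<tau> m" "\<tau> (Suc i) \<le> \<tau> (Suc m)" "\<tau> i \<le> \<tau> (Suc m)"
            by (auto intro: le)
        then show ?thesis using 2 by (simp add: min_absorb1)
      next
        case 3
        then have "\<tau> m \<le> \<tau> (Suc i)" "\<tau> m \<le> \<tau> i" "\<tau> (Suc m) \<le> \<tau> (Suc i)" "\<tau> (Suc m) \<le> \<tau> i"
            by (auto intro: le)
        then show ?thesis using 3 by (simp add: min_absorb2)
      qed
    qed simp
    then show ?thesis using that by simp
  qed
  have I0: "simple_integral_process R n \<tau> \<xi> (\<tau> 0) \<omega> = 0" for \<omega>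
    using le unfolding simple_integral_process_def by (intro sum.neutral) (simp add: min_absorb2)
  have "(LINT \<omega>|M. (simple_integral_process R n \<tau> \<xi> (\<tau> n) \<omega>)\<^sup>2)
      = (\<Sum>i<n. LINT \<omega>|M. (\<xi> i \<omega> * (R (\<tau> (Suc i)) \<omega> - R (\<tau> i) \<omega>))\<^sup>2)"
    unfolding sq_martingale_seq_pythagoras[OF seqI, of n] by (simp add: I0 inc)
  also have "\<dots> \<le> (\<Sum>i<n. K\<^sup>2 * (LINT \<omega>|M. (R (\<tau> (Suc i)) \<omega> - R (\<tau> i) \<omega>)\<^sup>2))"
  proof (rule sum_mono)
    fix i
    show "(LINT \<omega>|M. (\<xi> i \<omega> * (R (\<tau> (Suc i)) \<omega> - R (\<tau> i) \<omega>))\<^sup>2)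
        \<le> K\<^sup>2 * (LINT \<omega>|M. (R (\<tau> (Suc i)) \<omega> - R (\<tau> i) \<omega>)\<^sup>2)"
      using sq_martingale_seqD[OF seqR] measurable_F_M[OF \<xi>(1)] \<xi>(2)
      by (intro sq_integrable_bounded_mult) auto
  qed
  also have "\<dots> \<le> K\<^sup>2 * (LINT \<omega>|M. (R (\<tau> n) \<omega>)\<^sup>2)"
    unfolding sq_martingale_seq_pythagoras[OF seqR, of n]
    by (simp add: sum_distrib_left[symmetric] mult_left_mono)
  finally show "(LINT \<omega>|M. (simple_integral_process R n \<tau> \<xi> (\<tau> n) \<omega>)\<^sup>2)
      \<le> K\<^sup>2 * (LINT \<omega>|M. (R (\<tau> n) \<omega>)\<^sup>2)" .
qed

lemma wiener_sq_martingale: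
  assumes B: "real_wiener_process M F B"
  shows "sq_martingale B"
  unfolding sq_martingale_def
proof (intro conjI allI impI ballI)
  show ad: "adapted F B" using B by (simp add: wiener_process_def)
  have B0: "AE \<omega> in M. B 0 \<omega> = 0" using B by (simp add: wiener_process_def)
  show "integrable M (\<lambda>\<omega>. (B t \<omega>)\<^sup>2)" if "0 \<le> t" for t
  proof -
    have [measurable]: "B t \<in> borel_measurable M" "B 0 \<in> borel_measurable M"
      using adapted_measurable[OF ad] that by auto
    have "integrable M (\<lambda>\<omega>. (B t \<omega> - B 0 \<omega>)\<^sup>2)"
      using wiener_increment_moments(2)[OF B order_refl that]
          by (simp add: has_bochner_integral_iff)
    \<comment> \<open>\<open>B 0\<close> vanishes only almost surely, so the moment of the increment
      is transferred by an almost everywhere argument.\<close>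
    moreover have "integrable M (\<lambda>\<omega>. (B t \<omega> - B 0 \<omega>)\<^sup>2) = integrable M (\<lambda>\<omega>. (B t \<omega>)\<^sup>2)"
    proof (rule integrable_cong_AE)
      show "AE \<omega> in M. (B t \<omega> - B 0 \<omega>)\<^sup>2 = (B t \<omega>)\<^sup>2" using B0 by eventually_elim simp
    qed measurable
    ultimately show ?thesis by simp
  qed
  fix s t A assume st: "0 \<le> s \<and> s \<le> t" and A: "A \<in> sets (F s)"
  show "(LINT \<omega>|M. indicator A \<omega> * (B t \<omega> - B s \<omega>)) = 0"
  proof (cases "s = t")
    case False
    then have lt: "s < t" using st by simp
    have "A \<in> sets M" by (rule subsetD[OF sets_F_subset A])
    have "indep_var borel (indicator A :: 'w \<Rightarrow> real) borel (\<lambda>\<omega>. B t \<omega> - B s \<omega>)"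
      using wiener_increment_indep[OF B _ lt borel_measurable_indicator[OF A] measurable_ident] st
      by (simp only: id_apply)
    then have "(LINT \<omega>|M. indicator A \<omega> * (B t \<omega> - B s \<omega>))
        = (LINT \<omega>|M. indicator A \<omega>) * (LINT \<omega>|M. B t \<omega> - B s \<omega>)"
    proof (rule indep_var_lebesgue_integral)
      show "integrable M (indicator A :: 'w \<Rightarrow> real)"
        using \<open>A \<in> sets M\<close> by (intro integrable_real_indicator) (auto simp: emeasure_eq_measure)
      show "integrable M (\<lambda>\<omega>. B t \<omega> - B s \<omega>)"
        using wiener_increment_moments(1)[OF B, of s t] st by (simp only: has_bochner_integral_iff)
    qed
    also have "(LINT \<omega>|M. B t \<omega> - B s \<omega>) = 0"
      using wiener_increment_moments(1)[OF B, of s t] st by (simp only: has_bochner_integral_iff)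
    finally show ?thesis by simp
  qed simp
qed

text \<open>Dyadic times suffice for the supremum because of continuity.\<close>

lemma sq_martingale_maximal:
  fixes N :: nat
  assumes R: "sq_martingale R" and "0 < \<delta>"
  shows "{\<omega>\<in>space M. \<exists>k i. i \<le> N * 2 ^ k \<and> \<delta> < \<bar>R (real i / 2 ^ k) \<omega>\<bar>} \<in> sets M" (is "?E \<in> _")
    and "prob {\<omega>\<in>space M. \<exists>k i. i \<le> N * 2 ^ k \<and> \<delta> < \<bar>R (real i / 2 ^ k) \<omega>\<bar>}
      \<le> (LINT \<omega>|M. (R (real N) \<omega>)\<^sup>2) / \<delta>\<^sup>2"
proof -
  define A where "A k = {\<omega>\<in>space M. \<exists>i\<le>N * 2 ^ k. \<delta> < \<bar>R (real i / 2 ^ k) \<omega>\<bar>}" for k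
  have AM: "A k \<in> sets M" for k
  proof -
    have "A k = (\<Union>i\<in>{..N * 2 ^ k}. {\<omega>\<in>space M. \<delta> < \<bar>R (real i / 2 ^ k) \<omega>\<bar>})" by (auto simp: A_def)
    also have "\<dots> \<in> sets M"
      using sq_martingaleD(2)[OF R]
          by (intro sets.finite_UN) (auto intro!: borel_measurable_less borel_measurable_abs)
    finally show ?thesis .
  qed
  have E: "?E = (\<Union>k. A k)" by (auto simp: A_def)
  then show "?E \<in> sets M" using AM by auto
  have "A k \<subseteq> A (Suc k)" for k
  proof
    fix \<omega> assume "\<omega> \<in> A k"
    then obtain i where i: "\<omega> \<in> space M" "i \<le> N * 2 ^ k" "\<delta> < \<bar>R (real i / 2 ^ k) \<omega>\<bar>"
        by (auto simp: A_def)
    \<comment> \<open>The same time on the finer grid: i / 2^k = 2 i / 2^(k + 1).\<close>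
    then show "\<omega> \<in> A (Suc k)" unfolding A_def by (auto intro!: exI[of _ "2 * i"])
  qed
  then have "(\<lambda>k. prob (A k)) \<longlonglongrightarrow> prob (\<Union>k. A k)"
    using AM by (intro finite_Lim_measure_incseq incseq_SucI) auto
  moreover have "prob (A k) \<le> (LINT \<omega>|M. (R (real N) \<omega>)\<^sup>2) / \<delta>\<^sup>2" for k
  proof -
    have "mono (\<lambda>i. real i / 2 ^ k)" by (intro monoI divide_right_mono) auto
    from sq_martingale_seq_maximal[OF sq_martingale_grid[OF R this] \<open>0 < \<delta>\<close>, of "N * 2 ^ k"]
    show ?thesis by (simp add: A_def)
  qed
  ultimately show "prob ?E \<le> (LINT \<omega>|M. (R (real N) \<omega>)\<^sup>2) / \<delta>\<^sup>2"
    unfolding E by (intro LIMSEQ_le_const2) auto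
qed

lemma dyadic_floor_tendsto: "(\<lambda>k. of_int \<lfloor>t * 2 ^ k\<rfloor> / 2 ^ k) \<longlonglongrightarrow> (t::real)"
proof (rule tendsto_sandwich)
  have "t - 1 / 2 ^ k \<le> of_int \<lfloor>t * 2 ^ k\<rfloor> / 2 ^ k" for k :: nat
  proof -
    have "t * 2 ^ k - 1 \<le> of_int \<lfloor>t * 2 ^ k\<rfloor>" by linarith
    then show ?thesis by (simp add: le_divide_eq left_diff_distrib)
  qed
  then show "\<forall>\<^sub>F k in sequentially. t - 1 / 2 ^ k \<le> of_int \<lfloor>t * 2 ^ k\<rfloor> / 2 ^ k" by simp
  have "of_int \<lfloor>t * 2 ^ k\<rfloor> / 2 ^ k \<le> t" for k :: nat
    by (simp add: divide_le_eq)
  then show "\<forall>\<^sub>F k in sequentially. of_int \<lfloor>t * 2 ^ k\<rfloor> / 2 ^ k \<le> t" by simp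
  have "(\<lambda>k. t - (1/2) ^ k) \<longlonglongrightarrow> t - 0"
    by (intro tendsto_intros LIMSEQ_realpow_zero) auto
  then show "(\<lambda>k. t - 1 / 2 ^ k) \<longlonglongrightarrow> t" by (simp add: power_one_over)
qed simp

text \<open>Rounding t down to the grid of each level stays in [0, N], and continuity carries the
  bound to the limit t.\<close>

lemma continuous_dyadic_bound:
  fixes r :: "real \<Rightarrow> real" and N :: nat
  assumes "continuous_on {0..} r" and b: "\<And>k i. i \<le> N * 2 ^ k \<Longrightarrow> \<bar>r (real i / 2 ^ k)\<bar> \<le> \<delta>"
    and t: "0 \<le> t" "t \<le> real N"
  shows "\<bar>r t\<bar> \<le> \<delta>"
proof -
  define d where "d k = of_int \<lfloor>t * 2 ^ k\<rfloor> / (2 ^ k :: real)" for k :: nat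
  have d: "d \<longlonglongrightarrow> t" unfolding d_def by (rule dyadic_floor_tendsto)
  have d0: "d k = real (nat \<lfloor>t * 2 ^ k\<rfloor>) / 2 ^ k" for k using t by (simp add: d_def)
  have "(\<lambda>k. r (d k)) \<longlonglongrightarrow> r t"
    using t by (intro continuous_on_tendsto_compose[OF assms(1) d]) (auto simp: d0)
  moreover have "\<bar>r (d k)\<bar> \<le> \<delta>" for k
  proof -
    have "of_int \<lfloor>t * 2 ^ k\<rfloor> \<le> t * 2 ^ k" by simp
    also have "t * 2 ^ k \<le> real N * 2 ^ k" using t by simp
    finally have "of_int \<lfloor>t * 2 ^ k\<rfloor> \<le> real_of_int (int (N * 2 ^ k))" by simp
    then have "nat \<lfloor>t * 2 ^ k\<rfloor> \<le> N * 2 ^ k" by (simp only: of_int_le_iff nat_le_iff)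
    then show ?thesis unfolding d0 by (rule b)
  qed
  ultimately show ?thesis by (intro LIMSEQ_le_const2[OF tendsto_rabs]) auto
qed

text \<open>Borel-Cantelli applied to the maximal inequality. The horizon is j for the j-th process,
  so a single almost sure statement covers every compact interval.\<close>

lemma sq_martingale_eventually_small:
  assumes R: "\<And>j::nat. sq_martingale (R j)"
      and cont: "\<And>j. AE \<omega> in M. continuous_on {0..} (\<lambda>t. R j t \<omega>)"
    and \<delta>: "\<And>j. 0 < \<delta> j" and b: "\<And>j. (LINT \<omega>|M. (R j (real j) \<omega>)\<^sup>2) / (\<delta> j)\<^sup>2 \<le> b j" "summable b"
  shows "AE \<omega> in M. \<forall>\<^sub>F j in sequentially. \<forall>t\<in>{0..real j}. \<bar>R j t \<omega>\<bar> \<le> \<delta> j"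
proof -
  define E where "E j = {\<omega>\<in>space M. \<exists>k i. i \<le> j * 2 ^ k \<and> \<delta> j < \<bar>R j (real i / 2 ^ k) \<omega>\<bar>}" for j
  have "AE \<omega> in M. \<forall>\<^sub>F j in sequentially. \<omega> \<in> space M - E j"
  proof (rule borel_cantelli_AE1)
    show "E j \<in> sets M" for j unfolding E_def by (rule sq_martingale_maximal[OF R \<delta>])
    show "emeasure M (E j) < \<infinity>" for j by (simp add: emeasure_eq_measure)
    show "summable (\<lambda>j. prob (E j))"
    proof (rule summable_comparison_test'[OF b(2)])
      show "norm (prob (E j)) \<le> b j" if "0 \<le> j" for j
        using order_trans[OF sq_martingale_maximal(2)[OF R[of j] \<delta>[of j], of j] b(1)[of j]]
        unfolding E_def by (simp add: measure_nonneg)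
    qed
  qed
  moreover have "AE \<omega> in M. \<forall>j. continuous_on {0..} (\<lambda>t. R j t \<omega>)"
    using cont by (simp add: AE_all_countable)
  ultimately show ?thesis
  proof eventually_elim
    case (elim \<omega>)
    note cont_\<omega> = spec[OF elim(2)]
    show ?case using elim(1)
    proof eventually_elim
      case (elim j)
      then have "\<not> (\<exists>k i. i \<le> j * 2 ^ k \<and> \<delta> j < \<bar>R j (real i / 2 ^ k) \<omega>\<bar>)"
        unfolding E_def by blast
      then have b: "\<bar>R j (real i / 2 ^ k) \<omega>\<bar> \<le> \<delta> j" if "i \<le> j * 2 ^ k" for k i
        using that not_le by blast
      show ?case
      proof
        fix t assume "t \<in> {0..real j}"
        then show "\<bar>R j t \<omega>\<bar> \<le> \<delta> j"
          using continuous_dyadic_bound[OF cont_\<omega> b] by (simp only: atLeastAtMost_iff)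
      qed
    qed
  qed
qed

end

section \<open>The integral of the sign of a process\<close>

lemma dyadic_cell:
  fixes k :: nat
  assumes "0 \<le> t"
  defines "m \<equiv> nat \<lfloor>t * 2 ^ k\<rfloor>"
  shows "real m / 2 ^ k \<le> t" "t < real (Suc m) / 2 ^ k"
proof -
  have "real m = of_int \<lfloor>t * 2 ^ k\<rfloor>" using assms(1) by (simp add: m_def)
  then have "real m \<le> t * 2 ^ k" "t * 2 ^ k < real m + 1" by linarith+
  then show "real m / 2 ^ k \<le> t" "t < real (Suc m) / 2 ^ k"
    by (simp_all add: divide_le_eq less_divide_eq)
qed

lemma dyadic_cell_unique:
  assumes "real i / 2 ^ k \<le> t" "t < real (Suc i) / 2 ^ k"
  shows "nat \<lfloor>t * 2 ^ k\<rfloor> = i"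
proof -
  have "real i \<le> t * 2 ^ k" "t * 2 ^ k < real i + 1"
    using assms by (simp_all add: divide_le_eq less_divide_eq)
  then have "\<lfloor>t * 2 ^ k\<rfloor> = int i" by (simp add: floor_eq_iff)
  then show ?thesis by simp
qed

text \<open>Reduces a property that glues along adjacent intervals to intervals inside one cell. The
  induction counts the grid points between s and t and cuts at the next grid point after s.\<close>

lemma dyadic_induct:
  fixes P :: "real \<Rightarrow> real \<Rightarrow> bool"
  assumes cell: "\<And>i u v. real i / 2 ^ k \<le> u \<Longrightarrow> u \<le> v \<Longrightarrow> v \<le> real (Suc i) / 2 ^ k \<Longrightarrow> P u v"
    and trans: "\<And>s t u. 0 \<le> s \<Longrightarrow> s \<le> t \<Longrightarrow> t \<le> u \<Longrightarrow> P s t \<Longrightarrow> P t u \<Longrightarrow> P s u"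
    and st: "0 \<le> s" "s \<le> t"
  shows "P s t"
  using st
proof (induction "nat \<lfloor>t * 2 ^ k\<rfloor> - nat \<lfloor>s * 2 ^ k\<rfloor>" arbitrary: s rule: less_induct)
  case (less s)
  define m where "m = nat \<lfloor>s * 2 ^ k\<rfloor>"
  note m = dyadic_cell[OF less.prems(1), of k, folded m_def]
  show ?case
  proof (cases "t \<le> real (Suc m) / 2 ^ k")
    case True
    then show ?thesis using cell[OF m(1) less.prems(2)] by simp
  next
    case False
    define u where "u = real (Suc m) / 2 ^ k"
    have u: "0 \<le> u" "u \<le> t" "s \<le> u" using False m(2) by (simp_all add: u_def)
    have "real (Suc m) / 2 ^ k \<le> u" "u < real (Suc (Suc m)) / 2 ^ k"
      by (simp_all add: u_def divide_strict_right_mono)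
    then have um: "nat \<lfloor>u * 2 ^ k\<rfloor> = Suc m" by (rule dyadic_cell_unique)
    have "u * 2 ^ k \<le> t * 2 ^ k" using u by simp
    then have "nat \<lfloor>u * 2 ^ k\<rfloor> \<le> nat \<lfloor>t * 2 ^ k\<rfloor>" by (intro nat_mono floor_mono)
    then have "nat \<lfloor>t * 2 ^ k\<rfloor> - nat \<lfloor>u * 2 ^ k\<rfloor> < nat \<lfloor>t * 2 ^ k\<rfloor> - nat \<lfloor>s * 2 ^ k\<rfloor>"
      unfolding um m_def[symmetric] by linarith
    then have "P u t" using less.hyps u by blast
    moreover have "P s u" by (rule cell[OF m(1) u(3)]) (simp add: u_def)
    ultimately show ?thesis using trans less.prems u by blast
  qed
qed

lemma continuous_on_Ici:
  fixes f :: "real \<Rightarrow> 'b::topological_space"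
  assumes "\<And>v. 0 \<le> v \<Longrightarrow> continuous_on {0..v} f"
  shows "continuous_on {0..} f"
  unfolding continuous_on_eq_continuous_within
proof
  fix x :: real assume x: "x \<in> {0..}"
  then have "continuous (at x within {0..x + 1}) f"
    using assms[of "x + 1"] by (simp add: continuous_on_eq_continuous_within)
  moreover have "at x within {0..x + 1} = at x within {0..}"
    by (rule at_within_nhd[of _ "{..<x + 1}"]) auto
  ultimately show "continuous (at x within {0..}) f" by simp
qed

section \<open>Frozen sign integrals are Wiener processes\<close>

text \<open>The value at 0 is 1 rather than 0: only a factor of modulus one leaves a centred
  Gaussian increment unchanged in law.\<close>

definition sign :: "real \<Rightarrow> real" where
  "sign x = (if 0 \<le> x then 1 else - 1)"

lemma sign_cases: "sign x = 1 \<or> sign x = - 1" by (simp add: sign_def)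

lemma abs_sign [simp]: "\<bar>sign x\<bar> = 1" by (simp add: sign_def)

lemma abs_mult_sign: "\<bar>x\<bar> * sign x = x" by (simp add: sign_def)

lemma sign_measurable [measurable]: "sign \<in> borel_measurable borel"
  unfolding sign_def[abs_def] by measurable

lemma sign_tendsto:
  assumes "x \<longlonglongrightarrow> (l::real)" "l \<noteq> 0"
  shows "(\<lambda>n. sign (x n)) \<longlonglongrightarrow> sign l"
proof (rule tendsto_eventually)
  show "\<forall>\<^sub>F n in sequentially. sign (x n) = sign l"
  proof (cases "0 < l")
    case True
    from order_tendstoD(1)[OF assms(1) this] show ?thesis
      by eventually_elim (use True in \<open>simp add: sign_def\<close>)
  next
    case False
    with assms(2) have "l < 0" by simp
    from order_tendstoD(2)[OF assms(1) this] show ?thesis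
      by eventually_elim (use \<open>l < 0\<close> in \<open>simp add: sign_def\<close>)
  qed
qed

text \<open>
  The integral of the sign of \<open>X\<close>, frozen at the left end of each dyadic interval of length
  \<open>2\<^sup>-\<^sup>k\<close>, against \<open>B\<close>.
\<close>

definition sign_integral ::
    "(real \<Rightarrow> 'w \<Rightarrow> real) \<Rightarrow> (real \<Rightarrow> 'w \<Rightarrow> real) \<Rightarrow> nat \<Rightarrow> real \<Rightarrow> 'w \<Rightarrow> real" where
  "sign_integral X B k t \<omega> = (let m = nat \<lfloor>t * 2 ^ k\<rfloor> in
     (\<Sum>i<m. sign (X (real i / 2 ^ k) \<omega>) * (B (real (Suc i) / 2 ^ k) \<omega> - B (real i / 2 ^ k) \<omega>)) +
     sign (X (real m / 2 ^ k) \<omega>) * (B t \<omega> - B (real m / 2 ^ k) \<omega>))"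

lemma sign_integral_0: "sign_integral X B k 0 \<omega> = 0"
  by (simp add: sign_integral_def)

lemma sign_integral_increment:
  assumes "real i / 2 ^ k \<le> u" "u \<le> v" "v \<le> real (Suc i) / 2 ^ k"
  shows "sign_integral X B k v \<omega> - sign_integral X B k u \<omega>
      = sign (X (real i / 2 ^ k) \<omega>) * (B v \<omega> - B u \<omega>)"
proof -
  have cell: "sign_integral X B k t \<omega> =
      (\<Sum>i<i. sign (X (real i / 2 ^ k) \<omega>) * (B (real (Suc i) / 2 ^ k) \<omega> - B (real i / 2 ^ k) \<omega>)) +
      sign (X (real i / 2 ^ k) \<omega>) * (B t \<omega> - B (real i / 2 ^ k) \<omega>)"
    if t: "real i / 2 ^ k \<le> t" "t \<le> real (Suc i) / 2 ^ k" for t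
  \<comment> \<open>At the right end the floor already gives the next index, but then the incomplete
    last term is zero and the i-th cell appears as a full summand.\<close>
  proof (cases "t = real (Suc i) / 2 ^ k")
    case True
    have "real (Suc i) / 2 ^ k \<le> t" "t < real (Suc (Suc i)) / 2 ^ k"
      unfolding True by (simp_all add: divide_strict_right_mono)
    then have "nat \<lfloor>t * 2 ^ k\<rfloor> = Suc i" by (rule dyadic_cell_unique)
    then show ?thesis unfolding sign_integral_def Let_def by (simp add: True)
  next
    case False
    then have "nat \<lfloor>t * 2 ^ k\<rfloor> = i" using t by (intro dyadic_cell_unique) auto
    then show ?thesis unfolding sign_integral_def Let_def by simp
  qed
  show ?thesis
    using assms by (simp add: cell[of u] cell[of v] right_diff_distrib)
qed

lemma sign_integral_continuous:
  assumes "continuous_on {0..} (\<lambda>t. B t \<omega>)"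
  shows "continuous_on {0..} (\<lambda>t. sign_integral X B k t \<omega>)"
proof (rule continuous_on_Ici)
  fix v :: real assume "0 \<le> v"
  show "continuous_on {0..v} (\<lambda>t. sign_integral X B k t \<omega>)"
  proof (rule dyadic_induct[where P="\<lambda>u v. continuous_on {u..v} (\<lambda>t. sign_integral X B k t \<omega>)"
      and k=k])
    fix i u v assume uv: "real i / 2 ^ k \<le> u" "u \<le> v" "v \<le> real (Suc i) / 2 ^ k"
    have "0 \<le> real i / 2 ^ k" by simp
    then have u: "0 \<le> u" using uv(1) by linarith
    have "continuous_on {u..v} (\<lambda>t. sign_integral X B k u \<omega> + sign (X (real i / 2 ^ k) \<omega>)
        * (B t \<omega> - B u \<omega>))"
      by (intro continuous_intros continuous_on_subset[OF assms]) (use u in auto)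
    moreover have "sign_integral X B k t \<omega> = sign_integral X B k u \<omega> + sign (X (real i / 2 ^ k) \<omega>)
        * (B t \<omega> - B u \<omega>)"
      if "t \<in> {u..v}" for t
      using sign_integral_increment[of i k u t X B \<omega>] that uv by simp
    ultimately show "continuous_on {u..v} (\<lambda>t. sign_integral X B k t \<omega>)"
      by (simp only: cong: continuous_on_cong)
  next
    fix s t u :: real assume stu: "s \<le> t" "t \<le> u"
      and c: "continuous_on {s..t} (\<lambda>t. sign_integral X B k t \<omega>)"
          "continuous_on {t..u} (\<lambda>t. sign_integral X B k t \<omega>)"
    have "{s..u} = {s..t} \<union> {t..u}" using stu by auto
    then show "continuous_on {s..u} (\<lambda>t. sign_integral X B k t \<omega>)"
      using continuous_on_closed_Un[OF _ _ c] by simp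
  qed (use \<open>0 \<le> v\<close> in auto)
qed

context filtered_prob_space
begin

lemma sign_integral_adapted:
  assumes X: "adapted F X" and B: "adapted F B"
  shows "adapted F (sign_integral X B k)"
  unfolding adapted_def
proof (intro allI impI)
  fix t :: real assume t: "0 \<le> t"
  define m where "m = nat \<lfloor>t * 2 ^ k\<rfloor>"
  note m = dyadic_cell(1)[OF t, of k, folded m_def]
  have le: "real i / 2 ^ k \<le> t" if "i \<le> m" for i
  proof -
    have "real i / 2 ^ k \<le> real m / 2 ^ k" using that by (simp add: divide_right_mono)
    then show ?thesis using m by linarith
  qed
  have [measurable]: "X (real i / 2 ^ k) \<in> borel_measurable (F t)"
      "B (real i / 2 ^ k) \<in> borel_measurable (F t)"
    if "i \<le> m" for i
    using adaptedD[OF X _ le[OF that]] adaptedD[OF B _ le[OF that]] by auto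
  have [measurable]: "B t \<in> borel_measurable (F t)" using adaptedD[OF B t order_refl] .
  have "(\<lambda>\<omega>. (\<Sum>i<m. sign (X (real i / 2 ^ k) \<omega>)
      * (B (real (Suc i) / 2 ^ k) \<omega> - B (real i / 2 ^ k) \<omega>)) +
     sign (X (real m / 2 ^ k) \<omega>) * (B t \<omega> - B (real m / 2 ^ k) \<omega>)) \<in> borel_measurable (F t)"
  proof (intro borel_measurable_add borel_measurable_sum)
    fix i assume "i \<in> {..<m}"
    then have "i \<le> m" "Suc i \<le> m" by auto
    then show "(\<lambda>\<omega>. sign (X (real i / 2 ^ k) \<omega>)
        * (B (real (Suc i) / 2 ^ k) \<omega> - B (real i / 2 ^ k) \<omega>)) \<in> borel_measurable (F t)"
      by measurable
  qed measurable
  then show "sign_integral X B k t \<in> borel_measurable (F t)"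
    unfolding sign_integral_def[abs_def] Let_def m_def .
qed

text \<open>Inside one cell the sign is read at the left end and hence known when the increment
  starts; \<open>dyadic_induct\<close> with \<open>iexp_increment_trans\<close> carries the Gaussian
  property across cells.\<close>

lemma sign_integral_wiener:
  assumes X: "adapted F X" and B: "real_wiener_process M F B"
  shows "real_wiener_process M F (sign_integral X B k)"
proof (rule iexp_increment_imp_wiener)
  have adB: "adapted F B" using B by (simp add: wiener_process_def)
  show ad: "adapted F (sign_integral X B k)" by (rule sign_integral_adapted[OF X adB])
  show "AE \<omega> in M. sign_integral X B k 0 \<omega> = 0" by (simp add: sign_integral_0)
  have "AE \<omega> in M. continuous_on {0..} (\<lambda>t. B t \<omega>)" using B by (simp add: wiener_process_def)
  then show "AE \<omega> in M. continuous_on {0..} (\<lambda>t. sign_integral X B k t \<omega>)"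
    by eventually_elim (rule sign_integral_continuous)
  fix s t :: real assume "0 \<le> s" "s < t"
  show "iexp_increment (sign_integral X B k) s t"
  proof (rule dyadic_induct[where k=k])
    fix i u v assume uv: "real i / 2 ^ k \<le> u" "u \<le> v" "v \<le> real (Suc i) / 2 ^ k"
    have i0: "0 \<le> real i / 2 ^ k" by simp
    then have u: "0 \<le> u" using uv(1) by linarith
    show "iexp_increment (sign_integral X B k) u v"
    proof (rule iexp_increment_sign[OF wiener_iexp_increment[OF B u uv(2)]])
      show "(\<lambda>\<omega>. sign (X (real i / 2 ^ k) \<omega>)) \<in> borel_measurable (F u)"
        using measurable_compose[OF adaptedD[OF X i0 uv(1)] sign_measurable] .
      show "(\<lambda>\<omega>. B v \<omega> - B u \<omega>) \<in> borel_measurable M"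
        using u uv by (intro wiener_increment_measurable[OF B]) auto
    qed (use sign_cases sign_integral_increment[OF uv] in auto)
  next
    fix s t u :: real assume "0 \<le> s" "s \<le> t" "iexp_increment (sign_integral X B k) s t"
        "iexp_increment (sign_integral X B k) t u"
    then show "iexp_increment (sign_integral X B k) s u"
      using iexp_increment_trans ad by blast
  qed (use \<open>0 \<le> s\<close> \<open>s < t\<close> in auto)
qed

section \<open>The process does not vanish at a fixed time\<close>

text \<open>By independence \<open>Z\<close> may be frozen at a value z. The admissible increments
  then form an interval of length 2 a / |c|, whatever z is, on which the normal density is at most 1
  / (2 \<sigma>), since sqrt (2 pi) is at least 2. Integrating over the law of \<open>Z\<close>
  keeps the bound.\<close>

lemma wiener_anticoncentration:
  assumes B: "real_wiener_process M F B" and st: "0 \<le> s" "s < t" and c: "c \<noteq> 0" and a: "0 \<le> a"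
    and Z: "Z \<in> borel_measurable (F s)"
  shows "prob {\<omega>\<in>space M. \<bar>Z \<omega> + c * (B t \<omega> - B s \<omega>)\<bar> \<le> a} \<le> a / (\<bar>c\<bar> * sqrt (t - s))"
proof -
  define D where "D \<omega> = B t \<omega> - B s \<omega>" for \<omega>
  have Dm[measurable]: "D \<in> borel_measurable M"
    unfolding D_def using st by (intro wiener_increment_measurable[OF B]) auto
  note ZM[measurable] = measurable_F_M[OF Z]
  have "indep_var borel Z borel D"
    using wiener_increment_indep[OF B st Z measurable_ident] by (simp add: D_def[abs_def])
  then have pair: "distr M borel Z \<Otimes>\<^sub>M distr M borel D = distr M (borel \<Otimes>\<^sub>M borel) (\<lambda>\<omega>. (Z \<omega>, D \<omega>))"
    by (simp add: indep_var_distribution_eq)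
  define \<sigma> where "\<sigma> = sqrt (t - s)"
  have \<sigma>: "\<sigma> > 0" using st by (simp add: \<sigma>_def)
  have distD: "distr M borel D = density lborel (normal_density 0 \<sigma>)"
    using wiener_increment_distr[OF B st(1), of t] st
    by (simp add: centred_normal_def D_def[abs_def] \<sigma>_def)
  define C where "C = a / (\<bar>c\<bar> * \<sigma>)"
  have C: "0 \<le> C" using a \<sigma> by (simp add: C_def)
  have slice: "emeasure (distr M borel D) {d. \<bar>z + c * d\<bar> \<le> a} \<le> ennreal C" for z
  proof -
    have set: "{d. \<bar>z + c * d\<bar> \<le> a} = {- z / c - a / \<bar>c\<bar>..- z / c + a / \<bar>c\<bar>}"
    proof -
      have "\<bar>z + c * d\<bar> \<le> a \<longleftrightarrow> d \<in> {- z / c - a / \<bar>c\<bar>..- z / c + a / \<bar>c\<bar>}" for d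
      proof -
        have ball: "\<bar>d - m\<bar> \<le> e \<longleftrightarrow> d \<in> {m - e..m + e}" for m e :: real
          unfolding atLeastAtMost_iff by linarith
        have "z + c * d = c * (d - (- z / c))" using c by (simp add: field_simps)
        then have "\<bar>z + c * d\<bar> = \<bar>d - (- z / c)\<bar> * \<bar>c\<bar>" by (simp only: abs_mult mult.commute)
        then show ?thesis
          using c by (simp only: ball[symmetric]) (rule pos_le_divide_eq[symmetric], simp)
      qed
      then show ?thesis by blast
    qed
    have "emeasure (distr M borel D) {d. \<bar>z + c * d\<bar> \<le> a} =
        (\<integral>\<^sup>+x. ennreal (normal_density 0 \<sigma> x) * indicator {- z / c - a / \<bar>c\<bar>..- z / c + a / \<bar>c\<bar>} x
            \<partial>lborel)"
      unfolding distD set by (subst emeasure_density) auto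
    also have "\<dots> \<le> (\<integral>\<^sup>+x. ennreal (1 / (2 * \<sigma>)) * indicator {- z / c - a / \<bar>c\<bar>..- z / c + a / \<bar>c\<bar>} x
        \<partial>lborel)"
    proof (intro nn_integral_mono mult_right_mono ennreal_leI)
      fix x
      have "2 * \<sigma> = sqrt (4 * \<sigma>\<^sup>2)" using \<sigma> by (simp add: real_sqrt_mult)
      also have "\<dots> \<le> sqrt (2 * pi * \<sigma>\<^sup>2)"
        using pi_ge_two by (intro real_sqrt_le_mono mult_right_mono) auto
      finally have le: "2 * \<sigma> \<le> sqrt (2 * pi * \<sigma>\<^sup>2)" .
      have "normal_density 0 \<sigma> x \<le> 1 / sqrt (2 * pi * \<sigma>\<^sup>2) * 1"
        unfolding normal_density_def by (intro mult_left_mono) auto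
      also have "\<dots> \<le> 1 / (2 * \<sigma>)" using le \<sigma> by (simp add: frac_le)
      finally show "normal_density 0 \<sigma> x \<le> 1 / (2 * \<sigma>)" .
    qed simp
    also have "\<dots> = ennreal (1 / (2 * \<sigma>)) * ennreal (2 * (a / \<bar>c\<bar>))"
      using a by (subst nn_integral_cmult_indicator) auto
    also have "\<dots> = ennreal C"
      using a \<sigma> unfolding C_def by (subst ennreal_mult[symmetric]) auto
    finally show ?thesis .
  qed
  interpret Zd: prob_space "distr M borel Z" by (rule prob_space_distr) measurable
  interpret Dd: prob_space "distr M borel D" by (rule prob_space_distr) measurable
  define E where "E = {p :: real \<times> real. \<bar>fst p + c * snd p\<bar> \<le> a}"
  have "closed E" unfolding E_def by (intro closed_Collect_le continuous_intros)
  then have Em: "E \<in> sets (borel \<Otimes>\<^sub>M borel)" unfolding borel_prod by simp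
  have eq1: "emeasure M {\<omega>\<in>space M. \<bar>Z \<omega> + c * D \<omega>\<bar> \<le> a}
      = emeasure (distr M (borel \<Otimes>\<^sub>M borel) (\<lambda>\<omega>. (Z \<omega>, D \<omega>))) E"
  proof (subst emeasure_distr[OF _ Em])
    show "(\<lambda>\<omega>. (Z \<omega>, D \<omega>)) \<in> measurable M (borel \<Otimes>\<^sub>M borel)" by measurable
    have "{\<omega>\<in>space M. \<bar>Z \<omega> + c * D \<omega>\<bar> \<le> a} = (\<lambda>\<omega>. (Z \<omega>, D \<omega>)) -` E \<inter> space M" by (auto simp: E_def)
    then show "emeasure M {\<omega>\<in>space M. \<bar>Z \<omega> + c * D \<omega>\<bar> \<le> a}
        = emeasure M ((\<lambda>\<omega>. (Z \<omega>, D \<omega>)) -` E \<inter> space M)" by simp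
  qed
  have eq2: "emeasure (distr M borel Z \<Otimes>\<^sub>M distr M borel D) E
      = (\<integral>\<^sup>+z. emeasure (distr M borel D) (Pair z -` E) \<partial>distr M borel Z)"
    by (rule Dd.emeasure_pair_measure_alt) (use Em in simp)
  have le: "(\<integral>\<^sup>+z. emeasure (distr M borel D) (Pair z -` E) \<partial>distr M borel Z)
      \<le> (\<integral>\<^sup>+z. ennreal C \<partial>distr M borel Z)"
  proof (rule nn_integral_mono)
    fix z
    have "Pair z -` E = {d. \<bar>z + c * d\<bar> \<le> a}" by (auto simp: E_def)
    then show "emeasure (distr M borel D) (Pair z -` E) \<le> ennreal C" using slice[of z]
        by (simp only:)
  qed
  have eq3: "(\<integral>\<^sup>+z. ennreal C \<partial>distr M borel Z) = ennreal C"
    using Zd.emeasure_space_1 by simp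
  have "emeasure M {\<omega>\<in>space M. \<bar>Z \<omega> + c * D \<omega>\<bar> \<le> a} \<le> ennreal C"
    using le unfolding eq3 eq1 eq2[symmetric] by (simp only: pair)
  then show ?thesis
    using C by (simp add: emeasure_eq_measure D_def C_def \<sigma>_def)
qed

text \<open>
  Over \<open>[u - h, u]\<close> the noise is of order \<open>\<surd>h\<close>, whereas the drift is \<open>O(h)\<close> and cannot
  make up for it.
\<close>

lemma no_atom_at_zero:
  assumes X: "adapted F X" and B: "real_wiener_process M F B" and c: "c \<noteq> 0" and u: "0 < u"
    and drift: "AE \<omega> in M. \<exists>K. \<forall>h\<in>{0..u}. \<bar>X u \<omega> - X (u - h) \<omega> - c * (B u \<omega> - B (u - h) \<omega>)\<bar> \<le> K * h"
  shows "AE \<omega> in M. X u \<omega> \<noteq> 0"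
proof -
  \<comment> \<open>The exponents 4 and 3 are balanced: a / sqrt h is of order 1/n, so the
    probability of \<open>A n\<close> tends to 0, while the drift K h falls below a as soon as n
    exceeds K u.\<close>
  define h where "h n = u / real (Suc n) ^ 4" for n
  define a where "a n = 1 / real (Suc n) ^ 3" for n
  have h: "0 < h n" "h n \<le> u" for n
  proof -
    have "1 \<le> real (Suc n) ^ 4" by (intro one_le_power) simp
    then show "0 < h n" "h n \<le> u" using u
        by (simp_all add: h_def divide_le_eq mult_le_cancel_left1 del: of_nat_Suc)
  qed
  define A where "A n = {\<omega>\<in>space M. \<bar>X (u - h n) \<omega> + c * (B u \<omega> - B (u - h n) \<omega>)\<bar> \<le> a n}" for n
  have adB: "adapted F B" using B by (simp add: wiener_process_def)
  have AM[measurable]: "A n \<in> sets M" for n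
  proof -
    have [measurable]: "X (u - h n) \<in> borel_measurable M" "B (u - h n) \<in> borel_measurable M"
        "B u \<in> borel_measurable M"
      using adapted_measurable[OF X] adapted_measurable[OF adB] h[of n] u by auto
    show ?thesis unfolding A_def by measurable
  qed
  have pA: "prob (A n) \<le> 1 / (\<bar>c\<bar> * sqrt u) * (1 / real (Suc n))" for n
  proof -
    have "prob (A n) \<le> a n / (\<bar>c\<bar> * sqrt (u - (u - h n)))"
      unfolding A_def using h[of n]
      by (intro wiener_anticoncentration[OF B _ _ c] adaptedD[OF X]) (auto simp: a_def)
    also have "sqrt (u - (u - h n)) = sqrt u / real (Suc n) ^ 2"
    proof -
      have "real (Suc n) ^ 4 = (real (Suc n) ^ 2)\<^sup>2" by simp
      then have "u - (u - h n) = u / (real (Suc n) ^ 2)\<^sup>2" by (simp only: h_def)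
      then show ?thesis by (simp only: real_sqrt_divide real_sqrt_abs) simp
    qed
    also have "a n / (\<bar>c\<bar> * (sqrt u / real (Suc n) ^ 2)) = 1 / (\<bar>c\<bar> * sqrt u) * (1 / real (Suc n))"
    proof -
      define r where "r = real (Suc n)"
      have "r \<noteq> 0" by (simp add: r_def)
      then show ?thesis unfolding a_def r_def[symmetric]
        by (simp add: field_simps power2_eq_square power3_eq_cube)
    qed
    finally show ?thesis .
  qed
  have "(\<lambda>n. 1 / (\<bar>c\<bar> * sqrt u) * (1 / real (Suc n))) \<longlonglongrightarrow> 1 / (\<bar>c\<bar> * sqrt u) * 0"
    by (intro tendsto_mult tendsto_const LIMSEQ_Suc[OF lim_1_over_n])
  then have "(\<lambda>n. 1 / (\<bar>c\<bar> * sqrt u) * (1 / real (Suc n))) \<longlonglongrightarrow> 0"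
    by (simp only: mult_zero_right)
  then have lim: "(\<lambda>n. prob (A n)) \<longlonglongrightarrow> 0"
  proof (rule Lim_null_comparison[rotated], intro always_eventually allI)
    show "norm (prob (A n)) \<le> 1 / (\<bar>c\<bar> * sqrt u) * (1 / real (Suc n))" for n
      using pA[of n] by (simp only: real_norm_def abs_of_nonneg measure_nonneg)
  qed
  \<comment> \<open>The probabilities tend to 0 like 1/n and are not shown to be summable, so the
    conclusion is only that \<open>A n\<close> fails for arbitrarily large n. That is enough, since
    \<open>K\<close> depends on the sample point but n may be taken beyond K u.\<close>
  have "AE \<omega> in M. \<exists>n\<ge>m. \<omega> \<notin> A n" for m
  proof -
    have "prob (\<Inter>n\<in>{m..}. A n) \<le> 0"
    proof (rule LIMSEQ_le_const[OF lim])
      show "\<exists>N. \<forall>n\<ge>N. prob (\<Inter>n\<in>{m..}. A n) \<le> prob (A n)"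
        by (intro exI[of _ m] allI impI finite_measure_mono) auto
    qed
    then have "prob (\<Inter>n\<in>{m..}. A n) = 0" by (simp add: order_antisym)
    then have "(\<Inter>n\<in>{m..}. A n) \<in> null_sets M"
      by (auto simp: null_sets_def emeasure_eq_measure)
    from AE_not_in[OF this] show ?thesis by eventually_elim auto
  qed
  then have "AE \<omega> in M. \<forall>m. \<exists>n\<ge>m. \<omega> \<notin> A n" by (simp add: AE_all_countable)
  with drift AE_space show ?thesis
  proof eventually_elim
    case (elim \<omega>)
    then obtain K where K: "\<And>h. h \<in> {0..u} \<Longrightarrow> \<bar>X u \<omega> - X (u - h) \<omega> - c * (B u \<omega> - B (u - h) \<omega>)\<bar>
        \<le> K * h"
      by blast
    obtain m where m: "K * u \<le> real m" using real_arch_simple by blast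
    obtain n where n: "n \<ge> m" "\<omega> \<notin> A n" using elim by blast
    show "X u \<omega> \<noteq> 0"
    proof
      assume 0: "X u \<omega> = 0"
      define y where "y = X (u - h n) \<omega> + c * (B u \<omega> - B (u - h n) \<omega>)"
      have "X u \<omega> - X (u - h n) \<omega> - c * (B u \<omega> - B (u - h n) \<omega>) = - y"
        using 0 by (simp add: y_def)
      then have "\<bar>y\<bar> = \<bar>X u \<omega> - X (u - h n) \<omega> - c * (B u \<omega> - B (u - h n) \<omega>)\<bar>"
        by (simp only: abs_minus_cancel)
      also have "\<dots> \<le> K * h n" using h[of n] by (intro K) auto
      also have "\<dots> = K * u / real (Suc n) ^ 4" by (simp add: h_def)
      also have "\<dots> \<le> real (Suc n) / real (Suc n) ^ 4"
        using m n(1) by (intro divide_right_mono) auto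
      also have "\<dots> = a n"
      proof -
        have "r / r ^ 4 = 1 / r ^ 3" if "r \<noteq> 0" for r :: real
          using that by (simp add: divide_simps power4_eq_xxxx power3_eq_cube)
        then show ?thesis unfolding a_def by simp
      qed
      finally have "\<bar>y\<bar> \<le> a n" .
      then show False using n(2) \<open>\<omega> \<in> space M\<close> by (simp add: A_def y_def)
    qed
  qed
qed

end

section \<open>Mean square distance between frozen sign integrals\<close>

text \<open>Both numbers are integer multiples of the finer mesh, so a strict inequality gains a
  full cell: fine cells do not straddle coarse grid points.\<close>

lemma dyadic_nested:
  assumes "k \<le> l" "real m / 2 ^ l < real i / 2 ^ k"
  shows "real (Suc m) / 2 ^ l \<le> real i / 2 ^ k"
proof -
  define p where "p = (2::nat) ^ (l - k)"
  have p: "(2::real) ^ l = 2 ^ k * real p"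
    using assms(1) by (simp add: p_def power_add[symmetric])
  have p0: "real p > 0" by (simp add: p_def)
  have "real m < real i * real p"
    using assms(2) p0 by (simp add: p divide_simps mult.assoc)
  then have "m < i * p" by (metis of_nat_less_iff of_nat_mult)
  then have "Suc m \<le> i * p" by simp
  then have "real (Suc m) \<le> real i * real p" by (metis of_nat_le_iff of_nat_mult)
  then show ?thesis using p0 by (simp add: p divide_simps mult.assoc del: of_nat_Suc)
qed

text \<open>The integrand whose integral against \<open>B\<close> is
  \<open>sign_integral X B k\<close>.\<close>

definition frozen_sign :: "(real \<Rightarrow> 'w \<Rightarrow> real) \<Rightarrow> nat \<Rightarrow> real \<Rightarrow> 'w \<Rightarrow> real" where
  "frozen_sign X k u \<omega> = sign (X (real (nat \<lfloor>u * 2 ^ k\<rfloor>) / 2 ^ k) \<omega>)"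

lemma abs_frozen_sign: "\<bar>frozen_sign X k u \<omega>\<bar> = 1"
  by (simp add: frozen_sign_def)

lemma sq_diff_le_4: "\<bar>a\<bar> = 1 \<Longrightarrow> \<bar>b\<bar> = 1 \<Longrightarrow> (a - b)\<^sup>2 \<le> (4::real)"
  by (cases "a = b") (auto simp: abs_if split: if_splits)

context filtered_prob_space
begin

definition frozen_dist :: "(real \<Rightarrow> 'w \<Rightarrow> real) \<Rightarrow> nat \<Rightarrow> nat \<Rightarrow> real \<Rightarrow> real" where
  "frozen_dist X k l u = (LINT \<omega>|M. (frozen_sign X k u \<omega> - frozen_sign X l u \<omega>)\<^sup>2)"

lemma frozen_sign_measurable:
  assumes "adapted F X"
  shows "frozen_sign X k u \<in> borel_measurable M"
  unfolding frozen_sign_def[abs_def]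
  by (rule measurable_compose[OF adapted_measurable[OF assms] sign_measurable]) simp

text \<open>As a function of time it factors through the two cell indices, which take countably many
  values.\<close>

lemma frozen_dist_measurable: "frozen_dist X k l \<in> borel_measurable borel"
proof -
  have fl: "(\<lambda>u::real. nat \<lfloor>u * 2 ^ k\<rfloor>) \<in> measurable borel (count_space UNIV)" for k :: nat
    by measurable
  define H where "H i j = (LINT \<omega>|M. (sign (X (real i / 2 ^ k) \<omega>) - sign (X (real j / 2 ^ l) \<omega>))\<^sup>2)"
      for i j :: nat
  have "(\<lambda>u::real. H i (nat \<lfloor>u * 2 ^ l\<rfloor>)) \<in> borel_measurable borel" for i
    by (rule measurable_compose_countable[OF _ fl]) simp
  then have "(\<lambda>u::real. H (nat \<lfloor>u * 2 ^ k\<rfloor>) (nat \<lfloor>u * 2 ^ l\<rfloor>)) \<in> borel_measurable borel"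
    by (rule measurable_compose_countable[OF _ fl])
  then show ?thesis by (simp add: frozen_dist_def[abs_def] frozen_sign_def H_def)
qed

lemma frozen_dist_bounds:
  assumes "adapted F X"
  shows "integrable M (\<lambda>\<omega>. (frozen_sign X k u \<omega> - frozen_sign X l u \<omega>)\<^sup>2)"
    "0 \<le> frozen_dist X k l u" "frozen_dist X k l u \<le> 4"
proof -
  note [measurable] = frozen_sign_measurable[OF assms]
  show i: "integrable M (\<lambda>\<omega>. (frozen_sign X k u \<omega> - frozen_sign X l u \<omega>)\<^sup>2)"
    by (rule integrable_const_bound[of _ 4]) (auto intro!: AE_I2 sq_diff_le_4 simp: abs_frozen_sign)
  show "0 \<le> frozen_dist X k l u" unfolding frozen_dist_def by simp
  have "frozen_dist X k l u \<le> (LINT \<omega>|M. 4)"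
    unfolding frozen_dist_def
    by (intro integral_mono i) (auto intro!: sq_diff_le_4 simp: abs_frozen_sign)
  then show "frozen_dist X k l u \<le> 4" by (simp add: prob_space)
qed

text \<open>The Ito isometry on the finer grid: each increment of the difference is a difference of
  two signs known at the left end, times an independent Brownian increment of variance 1 /
  2^l.\<close>

lemma sign_integral_sq_dist:
  assumes X: "adapted F X" and B: "real_wiener_process M F B" and kl: "k \<le> l"
  shows "(LINT \<omega>|M. (sign_integral X B k (real n / 2 ^ l) \<omega> - sign_integral X B l (real n / 2 ^ l)
      \<omega>)\<^sup>2)
    = (\<Sum>i<n. frozen_dist X k l (real i / 2 ^ l) / 2 ^ l)"
proof -
  define R where "R t \<omega> = sign_integral X B k t \<omega> - sign_integral X B l t \<omega>" for t \<omega>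
  define \<tau> where "\<tau> i = real i / 2 ^ l" for i
  have R: "sq_martingale R"
    unfolding R_def[abs_def]
    by (intro sq_martingale_diff wiener_sq_martingale sign_integral_wiener X B)
  have \<tau>: "mono \<tau>" "0 \<le> \<tau> 0" by (auto simp: \<tau>_def intro!: monoI divide_right_mono)
  have inc: "R (\<tau> (Suc i)) \<omega> - R (\<tau> i) \<omega> =
      (frozen_sign X k (\<tau> i) \<omega> - frozen_sign X l (\<tau> i) \<omega>) * (B (\<tau> (Suc i)) \<omega> - B (\<tau> i) \<omega>)" for i \<omega>
  proof -
    define m where "m = nat \<lfloor>\<tau> i * 2 ^ k\<rfloor>"
    have "0 \<le> \<tau> i" by (simp add: \<tau>_def)
    note m = dyadic_cell[OF this, of k, folded m_def]
    have le: "\<tau> i \<le> \<tau> (Suc i)" using monoD[OF \<tau>(1)] by simp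
    have "\<tau> (Suc i) \<le> real (Suc m) / 2 ^ k"
      using dyadic_nested[OF kl m(2)[unfolded \<tau>_def]] by (simp add: \<tau>_def)
    note k = sign_integral_increment[OF m(1) le this, of X B \<omega>]
    have "nat \<lfloor>\<tau> i * 2 ^ l\<rfloor> = i" by (simp add: \<tau>_def)
    moreover have "sign_integral X B l (\<tau> (Suc i)) \<omega> - sign_integral X B l (\<tau> i) \<omega> =
        sign (X (\<tau> i) \<omega>) * (B (\<tau> (Suc i)) \<omega> - B (\<tau> i) \<omega>)"
      unfolding \<tau>_def by (rule sign_integral_increment) (auto intro!: divide_right_mono)
    ultimately show ?thesis
      using k unfolding R_def frozen_sign_def m_def[symmetric] by (simp add: \<tau>_def algebra_simps)
  qed
  have sq: "(LINT \<omega>|M. (R (\<tau> (Suc i)) \<omega> - R (\<tau> i) \<omega>)\<^sup>2) = frozen_dist X k l (\<tau> i) / 2 ^ l" for i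
  proof -
    have ti: "0 \<le> \<tau> i" "\<tau> i < \<tau> (Suc i)" "\<tau> (Suc i) - \<tau> i = 1 / 2 ^ l"
      by (simp_all add: \<tau>_def divide_strict_right_mono diff_divide_distrib[symmetric])
    have Fm: "frozen_sign X p (\<tau> i) \<in> borel_measurable (F (\<tau> i))" for p
    proof -
      have "real (nat \<lfloor>\<tau> i * 2 ^ p\<rfloor>) / 2 ^ p \<le> \<tau> i" by (rule dyadic_cell[OF ti(1)])
      then show ?thesis
        unfolding frozen_sign_def[abs_def]
        by (intro measurable_compose[OF adaptedD[OF X] sign_measurable]) auto
    qed
    have "(\<lambda>\<omega>. (frozen_sign X k (\<tau> i) \<omega> - frozen_sign X l (\<tau> i) \<omega>)\<^sup>2) \<in> borel_measurable (F (\<tau> i))"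
      using Fm by (intro borel_measurable_power borel_measurable_diff)
    moreover have "(\<lambda>x::real. x\<^sup>2) \<in> borel_measurable borel" by measurable
    ultimately have ind: "indep_var borel
        (\<lambda>\<omega>. (frozen_sign X k (\<tau> i) \<omega> - frozen_sign X l (\<tau> i) \<omega>)\<^sup>2)
        borel (\<lambda>\<omega>. (B (\<tau> (Suc i)) \<omega> - B (\<tau> i) \<omega>)\<^sup>2)"
      by (rule wiener_increment_indep[OF B ti(1,2)])
    have m2: "integrable M (\<lambda>\<omega>. (B (\<tau> (Suc i)) \<omega> - B (\<tau> i) \<omega>)\<^sup>2)"
      "(LINT \<omega>|M. (B (\<tau> (Suc i)) \<omega> - B (\<tau> i) \<omega>)\<^sup>2) = 1 / 2 ^ l"
      using wiener_increment_moments(2)[OF B ti(1) less_imp_le[OF ti(2)]]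
      unfolding ti(3) has_bochner_integral_iff by blast+
    show ?thesis
      unfolding inc power_mult_distrib
          indep_var_lebesgue_integral[OF ind frozen_dist_bounds(1)[OF X] m2(1)] m2(2)
      by (simp add: frozen_dist_def)
  qed
  have R0: "R (\<tau> 0) \<omega> = 0" for \<omega> by (simp add: R_def \<tau>_def sign_integral_0)
  show ?thesis
    using sq_martingale_seq_pythagoras[OF sq_martingale_grid[OF R \<tau>], of n]
    unfolding sq R0 by (simp add: R_def \<tau>_def)
qed

text \<open>Taking the supremum over the finer level makes the bound below independent of \<open>l\<close>.\<close>

definition frozen_sup :: "(real \<Rightarrow> 'w \<Rightarrow> real) \<Rightarrow> nat \<Rightarrow> real \<Rightarrow> ennreal" where
  "frozen_sup X k u = (SUP l\<in>{k..}. ennreal (frozen_dist X k l u))"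

lemma frozen_sup_measurable: "frozen_sup X k \<in> borel_measurable borel"
proof -
  note [measurable] = frozen_dist_measurable
  show ?thesis unfolding frozen_sup_def[abs_def] by (intro borel_measurable_SUP) auto
qed

text \<open>Both frozen signs are constant in time on a cell of the finer grid, so the sum given by
  the isometry is the time integral of \<open>frozen_dist\<close>, and the supremum over l dominates
  it.\<close>

lemma sign_integral_sq_dist_le:
  assumes X: "adapted F X" and B: "real_wiener_process M F B" and kl: "k \<le> l"
  shows "ennreal (LINT \<omega>|M. (sign_integral X B k (real N) \<omega> - sign_integral X B l (real N) \<omega>)\<^sup>2)
    \<le> (\<integral>\<^sup>+u. frozen_sup X k u * indicator {0..real N} u \<partial>lborel)"
proof -
  define n where "n = N * 2 ^ l"
  have n: "real n / 2 ^ l = real N" by (simp add: n_def)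
  define J where "J i = {real i / 2 ^ l..<real (Suc i) / 2 ^ l}" for i
  have "ennreal (LINT \<omega>|M. (sign_integral X B k (real N) \<omega> - sign_integral X B l (real N) \<omega>)\<^sup>2)
      = ennreal (\<Sum>i<n. frozen_dist X k l (real i / 2 ^ l) / 2 ^ l)"
    using sign_integral_sq_dist[OF X B kl, of n] by (simp only: n)
  also have "\<dots> = (\<Sum>i<n. ennreal (frozen_dist X k l (real i / 2 ^ l) / 2 ^ l))"
    using frozen_dist_bounds[OF X] by (intro sum_ennreal[symmetric]) auto
  also have "\<dots> = (\<Sum>i<n. \<integral>\<^sup>+u. ennreal (frozen_dist X k l (real i / 2 ^ l))
      * indicator (J i) u \<partial>lborel)"
  proof (rule sum.cong[OF refl])
    fix i
    have "emeasure lborel (J i) = ennreal (1 / 2 ^ l)"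
      unfolding J_def by (subst emeasure_lborel_Ico)
          (auto intro!: divide_right_mono simp: diff_divide_distrib[symmetric])
    then show "ennreal (frozen_dist X k l (real i / 2 ^ l) / 2 ^ l) =
        (\<integral>\<^sup>+u. ennreal (frozen_dist X k l (real i / 2 ^ l)) * indicator (J i) u \<partial>lborel)"
      using frozen_dist_bounds(2)[OF X]
      by (subst nn_integral_cmult_indicator) (auto simp: J_def ennreal_mult[symmetric])
  qed
  also have "\<dots> = (\<integral>\<^sup>+u. (\<Sum>i<n. ennreal (frozen_dist X k l (real i / 2 ^ l)) * indicator (J i) u)
      \<partial>lborel)"
    by (intro nn_integral_sum[symmetric]) (auto simp: J_def)
  also have "\<dots> \<le> (\<integral>\<^sup>+u. frozen_sup X k u * indicator {0..real N} u \<partial>lborel)"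
  proof (rule nn_integral_mono)
    fix u :: real
    define m where "m = nat \<lfloor>u * 2 ^ l\<rfloor>"
    have "(\<Sum>i<n. ennreal (frozen_dist X k l (real i / 2 ^ l)) * indicator (J i) u) \<le>
        (\<Sum>i<n. if i = m then frozen_sup X k u * indicator {0..real N} u else 0)"
    proof (rule sum_mono)
      fix i assume i: "i \<in> {..<n}"
      show "ennreal (frozen_dist X k l (real i / 2 ^ l)) * indicator (J i) u
          \<le> (if i = m then frozen_sup X k u * indicator {0..real N} u else 0)"
      proof (cases "u \<in> J i")
        case True
        then have u: "real i / 2 ^ l \<le> u" "u < real (Suc i) / 2 ^ l" by (auto simp: J_def)
        have im: "m = i" unfolding m_def by (rule dyadic_cell_unique[OF u])
        \<comment> \<open>The point u and the left end of its fine cell lie in the same coarse cell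
          j, so \<open>frozen_dist\<close> takes the same value at both.\<close>
        define j where "j = nat \<lfloor>(real i / 2 ^ l) * 2 ^ k\<rfloor>"
        have "0 \<le> real i / 2 ^ l" by simp
        note j = dyadic_cell[OF this, of k, folded j_def]
        have "real (Suc i) / 2 ^ l \<le> real (Suc j) / 2 ^ k" by (rule dyadic_nested[OF kl j(2)])
        then have "nat \<lfloor>u * 2 ^ k\<rfloor> = j" using j(1) u by (intro dyadic_cell_unique) linarith+
        then have "frozen_dist X k l (real i / 2 ^ l) = frozen_dist X k l u"
          unfolding frozen_dist_def frozen_sign_def
          using im by (simp add: m_def j_def)
        also have "ennreal \<dots> \<le> frozen_sup X k u"
          unfolding frozen_sup_def using kl by (intro SUP_upper) auto
        finally have le: "ennreal (frozen_dist X k l (real i / 2 ^ l)) \<le> frozen_sup X k u" .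
        have "Suc i \<le> n" using i by simp
        then have "real (Suc i) / 2 ^ l \<le> real n / 2 ^ l" by (intro divide_right_mono) auto
        moreover have "0 \<le> real i / 2 ^ l" by simp
        ultimately have "u \<in> {0..real N}" using u unfolding n atLeastAtMost_iff by linarith
        then show ?thesis using le im True by simp
      qed simp
    qed
    also have "\<dots> \<le> frozen_sup X k u * indicator {0..real N} u" by simp
    finally show "(\<Sum>i<n. ennreal (frozen_dist X k l (real i / 2 ^ l)) * indicator (J i) u)
        \<le> frozen_sup X k u * indicator {0..real N} u" .
  qed
  finally show ?thesis .
qed

lemma frozen_sup_tendsto_0:
  assumes X: "adapted F X" and cont: "AE \<omega> in M. continuous_on {0..} (\<lambda>t. X t \<omega>)"
    and nz: "\<And>u. 0 < u \<Longrightarrow> AE \<omega> in M. X u \<omega> \<noteq> 0" and u: "0 \<le> u"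
  shows "(\<lambda>k. frozen_sup X k u) \<longlonglongrightarrow> 0"
proof -
  define q where "q k = (LINT \<omega>|M. (frozen_sign X k u \<omega> - sign (X u \<omega>))\<^sup>2)" for k
  note [measurable] = frozen_sign_measurable[OF X] adapted_measurable[OF X u]
  have iq: "integrable M (\<lambda>\<omega>. (frozen_sign X k u \<omega> - sign (X u \<omega>))\<^sup>2)" for k
    by (rule integrable_const_bound[of _ 4]) (auto intro!: AE_I2 sq_diff_le_4 simp: abs_frozen_sign)
  have conv: "AE \<omega> in M. (\<lambda>k. frozen_sign X k u \<omega>) \<longlonglongrightarrow> sign (X u \<omega>)"
  proof (cases "u = 0")
    case True
    then show ?thesis by (simp add: frozen_sign_def)
  next
    case False
    with u nz have "AE \<omega> in M. X u \<omega> \<noteq> 0" by simp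
    with cont show ?thesis
    proof eventually_elim
      case (elim \<omega>)
      define d where "d k = real (nat \<lfloor>u * 2 ^ k\<rfloor>) / 2 ^ k" for k :: nat
      have "d = (\<lambda>k. of_int \<lfloor>u * 2 ^ k\<rfloor> / 2 ^ k)" using u by (auto simp: d_def)
      then have d: "d \<longlonglongrightarrow> u" using dyadic_floor_tendsto[of u] by (simp only:)
      have "(\<lambda>k. X (d k) \<omega>) \<longlonglongrightarrow> X u \<omega>"
        using u by (intro continuous_on_tendsto_compose[OF elim(1) d]) (auto simp: d_def)
      from sign_tendsto[OF this elim(2)] show ?case by (simp only: frozen_sign_def d_def)
    qed
  qed
  have "q \<longlonglongrightarrow> (LINT \<omega>|M. 0)"
    unfolding q_def
  proof (rule integral_dominated_convergence[where w="\<lambda>_. 4"])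
    show "AE \<omega> in M. (\<lambda>k. (frozen_sign X k u \<omega> - sign (X u \<omega>))\<^sup>2) \<longlonglongrightarrow> 0"
      using conv
    proof eventually_elim
      case (elim \<omega>)
      have "(\<lambda>k. (frozen_sign X k u \<omega> - sign (X u \<omega>))\<^sup>2) \<longlonglongrightarrow> (sign (X u \<omega>) - sign (X u \<omega>))\<^sup>2"
        by (intro tendsto_intros elim)
      then show ?case by simp
    qed
    show "AE \<omega> in M. norm ((frozen_sign X k u \<omega> - sign (X u \<omega>))\<^sup>2) \<le> 4" for k
      by (auto intro!: AE_I2 sq_diff_le_4 simp: abs_frozen_sign)
  qed auto
  then have q: "q \<longlonglongrightarrow> 0" by simp
  have dq: "frozen_dist X k l u \<le> 2 * q k + 2 * q l" for k l
  proof -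
    have "frozen_dist X k l u \<le> (LINT \<omega>|M. 2 * (frozen_sign X k u \<omega> - sign (X u \<omega>))\<^sup>2 + 2
        * (frozen_sign X l u \<omega> - sign (X u \<omega>))\<^sup>2)"
      unfolding frozen_dist_def
    proof (rule integral_mono[OF frozen_dist_bounds(1)[OF X]])
      fix \<omega>
      have "(a - b)\<^sup>2 \<le> 2 * (a - c)\<^sup>2 + 2 * (b - c)\<^sup>2" for a b c :: real
        using zero_le_power2[of "(a - c) + (b - c)"] by (simp add: power2_eq_square algebra_simps)
      then show "(frozen_sign X k u \<omega> - frozen_sign X l u \<omega>)\<^sup>2
          \<le> 2 * (frozen_sign X k u \<omega> - sign (X u \<omega>))\<^sup>2 + 2 *
              (frozen_sign X l u \<omega> - sign (X u \<omega>))\<^sup>2" .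
    qed (use iq in simp)
    also have "\<dots> = 2 * q k + 2 * q l" unfolding q_def using iq by simp
    finally show ?thesis .
  qed
  show ?thesis
  proof (rule order_tendstoI)
    fix a :: ennreal assume "0 < a"
    \<comment> \<open>The bound a may be infinite; any b strictly below it is finite and can be
      handled as a real number.\<close>
    then obtain b where b: "0 < b" "b < a" using dense by blast
    define \<epsilon> where "\<epsilon> = enn2real b"
    have "b < top" using b by (meson order_less_le_trans top_greatest)
    then have eb: "ennreal \<epsilon> = b" by (simp add: \<epsilon>_def)
    then have "0 < \<epsilon>" using b(1) by (metis ennreal_less_zero_iff ennreal_neg less_irrefl not_less)
    then have "\<forall>\<^sub>F k in sequentially. q k < \<epsilon> / 4" using q by (intro order_tendstoD) auto
    then obtain k0 where k0: "\<And>k. k \<ge> k0 \<Longrightarrow> q k < \<epsilon> / 4" by (auto simp: eventually_sequentially)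
    have "frozen_sup X k u < a" if "k \<ge> k0" for k
    proof -
      have "frozen_sup X k u \<le> ennreal \<epsilon>"
        unfolding frozen_sup_def
      proof (rule SUP_least)
        fix l assume "l \<in> {k..}"
        then have "q k < \<epsilon> / 4" "q l < \<epsilon> / 4" using k0 that by auto
        then have "frozen_dist X k l u \<le> \<epsilon>" using dq[of k l] by linarith
        then show "ennreal (frozen_dist X k l u) \<le> ennreal \<epsilon>" by (rule ennreal_leI)
      qed
      then show ?thesis using eb b(2) by simp
    qed
    then show "\<forall>\<^sub>F k in sequentially. frozen_sup X k u < a" by (auto simp: eventually_sequentially)
  qed simp
qed

section \<open>Passage to the limit in the dyadic level\<close>

text \<open>Dominated convergence in the time variable, with majorant 4 because two signs differ by
  at most 2.\<close>

lemma sign_integral_Cauchy: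
  assumes X: "adapted F X" and cont: "AE \<omega> in M. continuous_on {0..} (\<lambda>t. X t \<omega>)"
    and nz: "\<And>u. 0 < u \<Longrightarrow> AE \<omega> in M. X u \<omega> \<noteq> 0"
    and B: "real_wiener_process M F B" and \<epsilon>: "0 < \<epsilon>"
  shows "\<exists>k0. \<forall>k\<ge>k0. \<forall>l\<ge>k.
    (LINT \<omega>|M. (sign_integral X B k (real N) \<omega> - sign_integral X B l (real N) \<omega>)\<^sup>2) \<le> \<epsilon>"
proof -
  note [measurable] = frozen_sup_measurable
  have le4: "frozen_sup X k u \<le> 4" for k u
    unfolding frozen_sup_def
  proof (rule SUP_least)
    fix l
    show "ennreal (frozen_dist X k l u) \<le> 4"
      using ennreal_leI[OF frozen_dist_bounds(3)[OF X, of k l u]] by simp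
  qed
  have "(\<lambda>k. \<integral>\<^sup>+u. frozen_sup X k u * indicator {0..real N} u \<partial>lborel) \<longlonglongrightarrow> (\<integral>\<^sup>+(u::real). 0 \<partial>lborel)"
  proof (rule nn_integral_dominated_convergence[where w="\<lambda>u. 4 * indicator {0..real N} u"])
    show "AE u in lborel. frozen_sup X k u * indicator {0..real N} u \<le> 4 * indicator {0..real N} u"
        for k
      by (intro AE_I2 mult_right_mono le4) simp
    show "(\<integral>\<^sup>+u. 4 * indicator {0..real N} u \<partial>lborel) < \<infinity>"
      by (subst nn_integral_cmult_indicator) (auto simp: ennreal_mult_less_top)
    show "AE u in lborel. (\<lambda>k. frozen_sup X k u * indicator {0..real N} u) \<longlonglongrightarrow> 0"
    proof (rule AE_I2)
      fix u :: real
      show "(\<lambda>k. frozen_sup X k u * indicator {0..real N} u) \<longlonglongrightarrow> 0"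
        using frozen_sup_tendsto_0[OF X cont nz, of u] by (cases "u \<in> {0..real N}") auto
    qed
  qed auto
  then have "\<forall>\<^sub>F k in sequentially. (\<integral>\<^sup>+u. frozen_sup X k u * indicator {0..real N} u \<partial>lborel)
      < ennreal \<epsilon>"
    using \<epsilon> by (intro order_tendstoD(2)) auto
  then obtain k0 where k0: "\<And>k. k \<ge> k0 \<Longrightarrow> (\<integral>\<^sup>+u. frozen_sup X k u * indicator {0..real N} u \<partial>lborel)
      < ennreal \<epsilon>"
    by (auto simp: eventually_sequentially)
  show ?thesis
  proof (intro exI[of _ k0] allI impI)
    fix k l assume "k0 \<le> k" "k \<le> l"
    then have "ennreal (LINT \<omega>|M. (sign_integral X B k (real N) \<omega> - sign_integral X B l (real N)
        \<omega>)\<^sup>2) < ennreal \<epsilon>"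
      using order_le_less_trans[OF sign_integral_sq_dist_le[OF X B] k0] by blast
    then show "(LINT \<omega>|M. (sign_integral X B k (real N) \<omega> - sign_integral X B l (real N) \<omega>)\<^sup>2) \<le> \<epsilon>"
      using \<epsilon> by (simp add: ennreal_less_iff)
  qed
qed

text \<open>Fatou's lemma along the tail starting at \<open>m0\<close>.\<close>

lemma sq_norm_limit_le:
  fixes f :: "nat \<Rightarrow> 'w \<Rightarrow> real"
  assumes f: "\<And>m. f m \<in> borel_measurable M" "\<And>m. integrable M (\<lambda>\<omega>. (f m \<omega>)\<^sup>2)"
    and g: "g \<in> borel_measurable M" and lim: "AE \<omega> in M. (\<lambda>m. f m \<omega>) \<longlonglongrightarrow> g \<omega>"
    and C: "\<And>m. m \<ge> m0 \<Longrightarrow> (LINT \<omega>|M. (f m \<omega>)\<^sup>2) \<le> C" "0 \<le> C"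
  shows "(LINT \<omega>|M. (g \<omega>)\<^sup>2) \<le> C"
proof -
  note [measurable] = f(1) g
  have "(\<integral>\<^sup>+\<omega>. ennreal ((g \<omega>)\<^sup>2) \<partial>M) = (\<integral>\<^sup>+\<omega>. liminf (\<lambda>m. ennreal ((f (m + m0) \<omega>)\<^sup>2)) \<partial>M)"
  proof (rule nn_integral_cong_AE)
    show "AE \<omega> in M. ennreal ((g \<omega>)\<^sup>2) = liminf (\<lambda>m. ennreal ((f (m + m0) \<omega>)\<^sup>2))"
      using lim
    proof eventually_elim
      case (elim \<omega>)
      have "(\<lambda>m. ennreal ((f (m + m0) \<omega>)\<^sup>2)) \<longlonglongrightarrow> ennreal ((g \<omega>)\<^sup>2)"
        by (intro tendsto_ennrealI tendsto_intros LIMSEQ_ignore_initial_segment elim)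
      from lim_imp_Liminf[OF _ this] show ?case by simp
    qed
  qed
  also have "\<dots> \<le> liminf (\<lambda>m. \<integral>\<^sup>+\<omega>. ennreal ((f (m + m0) \<omega>)\<^sup>2) \<partial>M)"
    by (rule nn_integral_liminf) measurable
  also have "\<dots> \<le> liminf (\<lambda>m. ennreal C)"
  proof (rule Liminf_mono, rule always_eventually, rule allI)
    fix m
    have "(\<integral>\<^sup>+\<omega>. ennreal ((f (m + m0) \<omega>)\<^sup>2) \<partial>M) = ennreal (LINT \<omega>|M. (f (m + m0) \<omega>)\<^sup>2)"
      by (rule nn_integral_eq_integral[OF f(2)]) simp
    also have "\<dots> \<le> ennreal C" by (intro ennreal_leI C) simp
    finally show "(\<integral>\<^sup>+\<omega>. ennreal ((f (m + m0) \<omega>)\<^sup>2) \<partial>M) \<le> ennreal C" .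
  qed
  also have "\<dots> = ennreal C" by (simp add: Liminf_const)
  finally have "(\<integral>\<^sup>+\<omega>. ennreal ((g \<omega>)\<^sup>2) \<partial>M) \<le> ennreal C" .
  then show ?thesis
    using C(2) by (intro integral_real_bounded) auto
qed

text \<open>The rate 1/8 is fixed by its uses: divided by the squared threshold (1/4)^j it leaves
  the summable (1/2)^j, and later it must also beat j^2 against the squared threshold (9/16)^j. The
  condition \<open>3 * j \<le> \<kappa> j\<close> gives the mesh the same rate, as the quadratic
  variation requires.\<close>

lemma good_levels:
  assumes X: "adapted F X" and cont: "AE \<omega> in M. continuous_on {0..} (\<lambda>t. X t \<omega>)"
    and nz: "\<And>u. 0 < u \<Longrightarrow> AE \<omega> in M. X u \<omega> \<noteq> 0"
    and B: "real_wiener_process M F B"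
  shows "\<exists>\<kappa>. mono \<kappa> \<and> (\<forall>j. 3 * j \<le> \<kappa> j) \<and> (\<forall>j. \<forall>l\<ge>\<kappa> j.
    (LINT \<omega>|M. (sign_integral X B (\<kappa> j) (real j) \<omega> - sign_integral X B l (real j) \<omega>)\<^sup>2) \<le> (1 / 8) ^
        j)"
proof -
  define P where "P j k \<longleftrightarrow> 3 * j \<le> k \<and> (\<forall>l\<ge>k.
    (LINT \<omega>|M. (sign_integral X B k (real j) \<omega> - sign_integral X B l (real j) \<omega>)\<^sup>2) \<le> (1 / 8) ^ j)"
        for j k :: nat
  have ex: "\<exists>k. P j k \<and> k' \<le> k" for j k'
  proof -
    obtain k0 where k0: "\<forall>k\<ge>k0. \<forall>l\<ge>k.
        (LINT \<omega>|M. (sign_integral X B k (real j) \<omega> - sign_integral X B l (real j) \<omega>)\<^sup>2) \<le> (1 / 8) ^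
            j"
      using sign_integral_Cauchy[OF X cont nz B, of "(1 / 8) ^ j" j] by auto
    define k where "k = max k0 (max (3 * j) k')"
    have "k0 \<le> k" "3 * j \<le> k" "k' \<le> k" by (auto simp: k_def)
    then show ?thesis using k0 unfolding P_def by blast
  qed
  have "\<exists>\<kappa>. \<forall>j. P j (\<kappa> j) \<and> \<kappa> j \<le> \<kappa> (Suc j)"
    by (rule dependent_nat_choice) (use ex in blast)+
  then obtain \<kappa> where \<kappa>: "\<And>j. P j (\<kappa> j)" "\<And>j. \<kappa> j \<le> \<kappa> (Suc j)" by blast
  have "mono \<kappa>" using \<kappa>(2) by (simp add: mono_iff_le_Suc)
  then show ?thesis using \<kappa>(1) unfolding P_def by blast
qed

text \<open>
  Convergence of the frozen sign integrals along the chosen levels is uniform on compacts by the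
  maximal inequality; the limit is the stochastic integral of \<open>sign X\<close> against \<open>B\<close>.
\<close>

lemma sign_wiener:
  assumes X: "adapted F X" and cont: "AE \<omega> in M. continuous_on {0..} (\<lambda>t. X t \<omega>)"
    and nz: "\<And>u. 0 < u \<Longrightarrow> AE \<omega> in M. X u \<omega> \<noteq> 0"
    and B: "real_wiener_process M F B"
  shows "\<exists>\<kappa> w. (\<forall>j. 3 * j \<le> \<kappa> j) \<and> real_wiener_process M F w \<and>
    (\<forall>j. (LINT \<omega>|M. (w (real j) \<omega> - sign_integral X B (\<kappa> j) (real j) \<omega>)\<^sup>2) \<le> (1 / 8) ^ j)"
proof -
  obtain \<kappa> where \<kappa>: "mono \<kappa>" "\<And>j. 3 * j \<le> \<kappa> j" and dist: "\<And>j l. \<kappa> j \<le> l \<Longrightarrow>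
    (LINT \<omega>|M. (sign_integral X B (\<kappa> j) (real j) \<omega> - sign_integral X B l (real j) \<omega>)\<^sup>2) \<le> (1 / 8) ^
        j"
    using good_levels[OF assms] by blast
  define U where "U j = sign_integral X B (\<kappa> j)" for j
  have Uw: "real_wiener_process M F (U j)" for j
    unfolding U_def by (rule sign_integral_wiener[OF X B])
  have Uad: "adapted F (U j)" for j using Uw[of j] by (simp add: wiener_process_def)
  have Uc: "AE \<omega> in M. continuous_on {0..} (\<lambda>t. U j t \<omega>)" for j
    using Uw[of j] by (simp add: wiener_process_def)
  have Um: "sq_martingale (U j)" for j by (rule wiener_sq_martingale[OF Uw])
  define R where "R j t \<omega> = U j t \<omega> - U (Suc j) t \<omega>" for j t \<omega>
  have Rm: "sq_martingale (R j)" for j unfolding R_def[abs_def] by (intro sq_martingale_diff Um)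
  have Rc: "AE \<omega> in M. continuous_on {0..} (\<lambda>t. R j t \<omega>)" for j
    using Uc[of j] Uc[of "Suc j"] unfolding R_def by eventually_elim (rule continuous_on_diff)
  have "AE \<omega> in M. \<forall>\<^sub>F j in sequentially. \<forall>t\<in>{0..real j}. \<bar>R j t \<omega>\<bar> \<le> (1 / 2) ^ j"
  proof (rule sq_martingale_eventually_small[OF Rm Rc])
    show "(LINT \<omega>|M. (R j (real j) \<omega>)\<^sup>2) / ((1 / 2) ^ j)\<^sup>2 \<le> (1 / 2) ^ j" for j
    proof -
      have "(LINT \<omega>|M. (R j (real j) \<omega>)\<^sup>2) \<le> (1 / 8) ^ j"
        unfolding R_def U_def using monoD[OF \<kappa>(1), of j "Suc j"] by (intro dist) simp
      moreover have "(1 / 8 :: real) ^ j = (1 / 2) ^ j * ((1 / 2) ^ j)\<^sup>2"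
        unfolding power2_eq_square power_mult_distrib[symmetric] by simp
      ultimately show ?thesis by (simp add: divide_le_eq)
    qed
    show "summable (\<lambda>j. (1 / 2 :: real) ^ j)" by (rule summable_geometric) simp
  qed simp
  moreover have "AE \<omega> in M. \<forall>j. continuous_on {0..} (\<lambda>t. U j t \<omega>)"
    using Uc by (simp add: AE_all_countable)
  ultimately have main: "AE \<omega> in M. (\<forall>t\<ge>0. (\<lambda>j. U j t \<omega>) \<longlonglongrightarrow> lim (\<lambda>j. U j t \<omega>)) \<and>
      continuous_on {0..} (\<lambda>t. lim (\<lambda>j. U j t \<omega>))"
  proof eventually_elim
    case (elim \<omega>)
    have ulim: "uniform_limit {0..v} (\<lambda>j t. U j t \<omega>) (\<lambda>t. lim (\<lambda>j. U j t \<omega>)) sequentially" for v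
    proof -
      \<comment> \<open>The limit is written as \<open>U 0\<close> plus a telescoping series, to
        which the Weierstrass test with majorant (1/2)^n applies.\<close>
      define S where "S t = (\<Sum>i. U (Suc i) t \<omega> - U i t \<omega>)" for t
      have "uniform_limit {0..v} (\<lambda>n t. \<Sum>i<n. U (Suc i) t \<omega> - U i t \<omega>) S sequentially"
        unfolding S_def
      proof (rule Weierstrass_m_test_ev)
        have "\<forall>\<^sub>F j in sequentially. v \<le> real j"
          by (rule eventually_sequentiallyI[of "nat \<lceil>v\<rceil>"]) linarith
        with elim(1) show "\<forall>\<^sub>F n in sequentially. \<forall>t\<in>{0..v}. norm (U (Suc n) t \<omega> - U n t \<omega>)
            \<le> (1 / 2) ^ n"
        proof eventually_elim
          case (elim n)
          show ?case
          proof
            fix t assume "t \<in> {0..v}"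
            then have "\<bar>R n t \<omega>\<bar> \<le> (1 / 2) ^ n" using elim by auto
            then show "norm (U (Suc n) t \<omega> - U n t \<omega>) \<le> (1 / 2) ^ n"
              unfolding R_def real_norm_def by (simp only: abs_minus_commute)
          qed
        qed
        show "summable (\<lambda>j. (1 / 2 :: real) ^ j)" by (rule summable_geometric) simp
      qed
      moreover have "(\<Sum>i<n. U (Suc i) t \<omega> - U i t \<omega>) = U n t \<omega> - U 0 t \<omega>" for n t
        by (rule sum_lessThan_telescope)
      moreover have "uniform_limit {0..v} (\<lambda>n t. U 0 t \<omega>) (\<lambda>t. U 0 t \<omega>) sequentially"
        by (rule uniform_limit_const)
      ultimately have "uniform_limit {0..v} (\<lambda>n t. (U n t \<omega> - U 0 t \<omega>) + U 0 t \<omega>)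
          (\<lambda>t. S t + U 0 t \<omega>) sequentially"
        by (intro uniform_limit_add) (simp_all only:)
      then have ul: "uniform_limit {0..v} (\<lambda>n t. U n t \<omega>) (\<lambda>t. S t + U 0 t \<omega>) sequentially"
        by (simp only: diff_add_cancel)
      have eq: "lim (\<lambda>j. U j t \<omega>) = S t + U 0 t \<omega>" if "t \<in> {0..v}" for t
        using tendsto_uniform_limitI[OF ul that] by (rule limI)
      show ?thesis by (rule iffD2[OF uniform_limit_cong'[OF refl eq] ul])
    qed
    show ?case
    proof (intro conjI allI impI)
      show "(\<lambda>j. U j t \<omega>) \<longlonglongrightarrow> lim (\<lambda>j. U j t \<omega>)" if "0 \<le> t" for t
        using tendsto_uniform_limitI[OF ulim[of t], of t] that by simp
      show "continuous_on {0..} (\<lambda>t. lim (\<lambda>j. U j t \<omega>))"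
      proof (rule continuous_on_Ici)
        fix v :: real
        show "continuous_on {0..v} (\<lambda>t. lim (\<lambda>j. U j t \<omega>))"
        proof (rule uniform_limit_theorem[OF _ ulim])
          have "continuous_on {0..v} (\<lambda>t. U j t \<omega>)" for j
            by (rule continuous_on_subset[OF spec[OF elim(2), of j]]) auto
          then show "\<forall>\<^sub>F j in sequentially. continuous_on {0..v} (\<lambda>t. U j t \<omega>)" by simp
        qed simp
      qed
    qed
  qed
  \<comment> \<open>\<open>lim\<close> is defined at every sample point, and the limit of adapted
    processes taken in this way is measurable for \<open>F t\<close> itself; no exceptional null set
    has to be removed.\<close>
  define w where "w t \<omega> = lim (\<lambda>j. U j t \<omega>)" for t \<omega>
  have lim_w: "AE \<omega> in M. (\<lambda>j. U j t \<omega>) \<longlonglongrightarrow> w t \<omega>" if "0 \<le> t" for t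
    using main unfolding w_def by eventually_elim (use that in blast)
  have wad: "adapted F w"
    unfolding adapted_def
  proof (intro allI impI)
    fix t :: real assume "0 \<le> t"
    then show "w t \<in> borel_measurable (F t)"
      unfolding w_def[abs_def] by (intro borel_measurable_lim_metric adaptedD[OF Uad]) auto
  qed
  have ww: "real_wiener_process M F w"
  proof (rule iexp_increment_imp_wiener[OF wad])
    show "AE \<omega> in M. w 0 \<omega> = 0"
      by (rule AE_I2) (simp add: w_def U_def sign_integral_0 limI)
    show "AE \<omega> in M. continuous_on {0..} (\<lambda>t. w t \<omega>)"
      using main unfolding w_def by eventually_elim blast
    fix s t :: real assume st: "0 \<le> s" "s < t"
    then have le: "s \<le> t" and t: "0 \<le> t" by auto
    show "iexp_increment w s t"
      by (rule iexp_increment_limit[OF wiener_iexp_increment[OF Uw st(1) le] st(1) le Uad wad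
            lim_w[OF st(1)] lim_w[OF t]])
  qed
  have "(LINT \<omega>|M. (w (real j) \<omega> - U j (real j) \<omega>)\<^sup>2) \<le> (1 / 8) ^ j" for j
  \<comment> \<open>The bound between levels j and m is uniform in m, so Fatou with m tending to
    infinity replaces \<open>U m\<close> by \<open>w\<close>.\<close>
  proof (rule sq_norm_limit_le[where f="\<lambda>m \<omega>. U m (real j) \<omega> - U j (real j) \<omega>" and ?m0.0=j])
    note m = sq_martingaleD[OF sq_martingale_diff[OF Um Um]]
    show "(\<lambda>\<omega>. U m (real j) \<omega> - U j (real j) \<omega>) \<in> borel_measurable M" for m
      using m(2)[of "real j" m j] by simp
    show "integrable M (\<lambda>\<omega>. (U m (real j) \<omega> - U j (real j) \<omega>)\<^sup>2)" for m
      using m(3)[of "real j" m j] by simp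
    show "(\<lambda>\<omega>. w (real j) \<omega> - U j (real j) \<omega>) \<in> borel_measurable M"
      using adapted_measurable[OF wad] adapted_measurable[OF Uad]
          by (intro borel_measurable_diff) auto
    show "AE \<omega> in M. (\<lambda>m. U m (real j) \<omega> - U j (real j) \<omega>) \<longlonglongrightarrow> w (real j) \<omega> - U j (real j) \<omega>"
      using lim_w[OF of_nat_0_le_iff[of j]] by eventually_elim (intro tendsto_diff tendsto_const)
    fix m assume "m \<ge> j"
    then have "(LINT \<omega>|M. (U j (real j) \<omega> - U m (real j) \<omega>)\<^sup>2) \<le> (1 / 8) ^ j"
      unfolding U_def using monoD[OF \<kappa>(1)] by (intro dist) auto
    also have "(LINT \<omega>|M. (U j (real j) \<omega> - U m (real j) \<omega>)\<^sup>2)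
        = (LINT \<omega>|M. (U m (real j) \<omega> - U j (real j) \<omega>)\<^sup>2)"
      by (intro Bochner_Integration.integral_cong refl power2_commute)
    finally show "(LINT \<omega>|M. (U m (real j) \<omega> - U j (real j) \<omega>)\<^sup>2) \<le> (1 / 8) ^ j" .
  qed simp
  then show ?thesis using \<kappa>(2) ww unfolding U_def by blast
qed

end

section \<open>Ito's formula for the square\<close>

lemma dyadic_telescope:
  fixes f :: "real \<Rightarrow> real"
  assumes "0 \<le> t" "t \<le> real N"
  shows "(\<Sum>i<N * 2 ^ k. f (min (real (Suc i) / 2 ^ k) t) - f (min (real i / 2 ^ k) t)) = f t - f 0"
proof -
  have "(\<Sum>i<N * 2 ^ k. f (min (real (Suc i) / 2 ^ k) t) - f (min (real i / 2 ^ k) t)) =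
      f (min (real (N * 2 ^ k) / 2 ^ k) t) - f (min (real 0 / 2 ^ k) t)"
    by (rule sum_lessThan_telescope[where f="\<lambda>i. f (min (real i / 2 ^ k) t)"])
  then show ?thesis using assms by (simp add: min_def)
qed

lemma dyadic_min_step:
  fixes k i :: nat
  assumes "0 \<le> t"
  defines "u \<equiv> min (real i / 2 ^ k) t" and "v \<equiv> min (real (Suc i) / 2 ^ k) t"
  shows "0 \<le> u" "u \<le> v" "v \<le> t" "v - u \<le> 1 / 2 ^ k"
proof -
  have s: "real (Suc i) / 2 ^ k = real i / 2 ^ k + 1 / 2 ^ k" by (simp add: add_divide_distrib)
  have p: "0 \<le> 1 / (2::real) ^ k" "0 \<le> real i / 2 ^ k" by simp_all
  show "0 \<le> u" "u \<le> v" "v \<le> t" "v - u \<le> 1 / 2 ^ k"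
    using assms(1) p unfolding u_def v_def s by linarith+
qed

text \<open>The cells that end by time t are full and controlled by \<open>qv\<close>. The cell
  containing t adds at most the square of \<rho>, later summands vanish since both ends are clamped
  to t, and the last error term is the distance from t to the grid point before it.\<close>

lemma dyadic_sq_sum:
  fixes \<beta> :: "real \<Rightarrow> real" and N :: nat
  assumes t: "0 \<le> t" "t \<le> real N"
    and qv: "\<And>m. m \<le> N * 2 ^ k \<Longrightarrow>
      \<bar>(\<Sum>i<m. (\<beta> (real (Suc i) / 2 ^ k) - \<beta> (real i / 2 ^ k))\<^sup>2 - 1 / 2 ^ k)\<bar> \<le> \<epsilon>"
    and osc: "\<And>r s. 0 \<le> r \<Longrightarrow> r \<le> s \<Longrightarrow> s \<le> t \<Longrightarrow> s - r \<le> 1 / 2 ^ k \<Longrightarrow> \<bar>\<beta> s - \<beta> r\<bar> \<le> \<rho>"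
  shows "\<bar>(\<Sum>i<N * 2 ^ k. (\<beta> (min (real (Suc i) / 2 ^ k) t) - \<beta> (min (real i / 2 ^ k) t))\<^sup>2) - t\<bar>
    \<le> \<epsilon> + \<rho>\<^sup>2 + 1 / 2 ^ k"
proof -
  define n where "n = N * 2 ^ k"
  define m where "m = nat \<lfloor>t * 2 ^ k\<rfloor>"
  note m = dyadic_cell[OF t(1), of k, folded m_def]
  have n: "real n / 2 ^ k = real N" by (simp add: n_def)
  have mn: "m \<le> n"
  proof (rule ccontr)
    assume "\<not> m \<le> n"
    then have "Suc n \<le> m" by simp
    then have "real (Suc n) / 2 ^ k \<le> real m / 2 ^ k" by (intro divide_right_mono) simp_all
    moreover have "real n / 2 ^ k < real (Suc n) / 2 ^ k" by (simp add: divide_strict_right_mono)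
    ultimately show False using n m(1) t(2) by linarith
  qed
  define a where "a i = (\<beta> (min (real (Suc i) / 2 ^ k) t) - \<beta> (min (real i / 2 ^ k) t))\<^sup>2" for i
  have late: "a i = 0" if "m < i" for i
  proof -
    have "real (Suc m) / 2 ^ k \<le> real i / 2 ^ k" using that by (intro divide_right_mono) simp_all
    moreover have "real i / 2 ^ k \<le> real (Suc i) / 2 ^ k" by (intro divide_right_mono) simp_all
    ultimately have "min (real (Suc i) / 2 ^ k) t = t" "min (real i / 2 ^ k) t = t" using m(2)
        by linarith+
    then show ?thesis by (simp add: a_def)
  qed
  have early: "a i = (\<beta> (real (Suc i) / 2 ^ k) - \<beta> (real i / 2 ^ k))\<^sup>2" if "i < m" for i
  proof -
    have "real (Suc i) / 2 ^ k \<le> real m / 2 ^ k" using that by (intro divide_right_mono) simp_all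
    moreover have "real i / 2 ^ k \<le> real (Suc i) / 2 ^ k" by (intro divide_right_mono) simp_all
    ultimately have "min (real (Suc i) / 2 ^ k) t = real (Suc i) / 2 ^ k"
        "min (real i / 2 ^ k) t = real i / 2 ^ k"
      using m(1) by linarith+
    then show ?thesis by (simp add: a_def)
  qed
  have am: "0 \<le> a m" "a m \<le> \<rho>\<^sup>2"
  proof -
    note s = dyadic_min_step[OF t(1), of m k]
    have "\<bar>\<beta> (min (real (Suc m) / 2 ^ k) t) - \<beta> (min (real m / 2 ^ k) t)\<bar> \<le> \<rho>"
      by (rule osc[OF s])
    from power_mono[OF this, of 2] show "a m \<le> \<rho>\<^sup>2" by (simp add: a_def)
  qed (simp add: a_def)
  define q where "q = (\<Sum>i<m. (\<beta> (real (Suc i) / 2 ^ k) - \<beta> (real i / 2 ^ k))\<^sup>2 - 1 / 2 ^ k)"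
  have q: "\<bar>q\<bar> \<le> \<epsilon>" unfolding q_def using qv[of m] mn by (simp add: n_def)
  have sum_m: "(\<Sum>i<m. a i) = q + real m / 2 ^ k"
    unfolding q_def by (simp add: early sum_subtractf)
  have tm: "\<bar>t - real m / 2 ^ k\<bar> \<le> 1 / 2 ^ k"
    using m by (simp add: add_divide_distrib)
  have "(\<Sum>i<n. a i) = (\<Sum>i<m. a i) + (if m < n then a m else 0)"
  proof (cases "m < n")
    case True
    have "(\<Sum>i<n. a i) = (\<Sum>i<Suc m. a i)"
      using True late by (intro sum.mono_neutral_right) auto
    then show ?thesis using True by simp
  next
    case False
    then have "n = m" using mn by simp
    then show ?thesis by simp
  qed
  then have "\<bar>(\<Sum>i<n. a i) - t\<bar> \<le> \<epsilon> + \<rho>\<^sup>2 + 1 / 2 ^ k"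
    using q tm am unfolding sum_m by (auto simp del: of_nat_Suc split: if_splits)
  then show ?thesis by (simp only: a_def n_def)
qed

lemma integral_Icc_increment:
  fixes g :: "real \<Rightarrow> real"
  assumes "continuous_on {0..} g" "0 \<le> u" "u \<le> v"
  shows "integral {0..v} g - integral {0..u} g = integral {u..v} g"
    "g integrable_on {u..v}" "continuous_on {u..v} g"
proof -
  have c: "continuous_on {0..v} g" "continuous_on {u..v} g"
    using assms by (auto intro: continuous_on_subset)
  then show "continuous_on {u..v} g" "g integrable_on {u..v}"
    by (auto intro: integrable_continuous_interval)
  have "integral {0..u} g + integral {u..v} g = integral {0..v} g"
    using assms c(1) by (intro Henstock_Kurzweil_Integration.integral_combine
        integrable_continuous_interval)
  then show "integral {0..v} g - integral {0..u} g = integral {u..v} g" by simp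
qed

text \<open>
  The pathwise part of Ito's formula for the square: \<open>2 a \<Delta>x = \<Delta>(x\<^sup>2) - (\<Delta>x)\<^sup>2\<close> with \<open>a\<close> the
  left end value.
\<close>

lemma ito_square_estimate:
  fixes x g \<beta> :: "real \<Rightarrow> real" and N :: nat
  assumes x: "continuous_on {0..} x" and g: "continuous_on {0..} g"
    and eq: "\<And>t. 0 \<le> t \<Longrightarrow> x t = x 0 + integral {0..t} g + c * \<beta> t"
    and t: "0 \<le> t" "t \<le> real N"
    and G: "\<And>s. 0 \<le> s \<Longrightarrow> s \<le> t \<Longrightarrow> \<bar>g s\<bar> \<le> G"
    and osc_x: "\<And>r s. 0 \<le> r \<Longrightarrow> r \<le> s \<Longrightarrow> s \<le> t \<Longrightarrow> s - r \<le> 1 / 2 ^ k \<Longrightarrow> \<bar>x s - x r\<bar> \<le> \<rho>"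
    and osc: "\<And>r s. 0 \<le> r \<Longrightarrow> r \<le> s \<Longrightarrow> s \<le> t \<Longrightarrow> s - r \<le> 1 / 2 ^ k \<Longrightarrow> \<bar>\<beta> s - \<beta> r\<bar> \<le> \<rho>"
    and qv: "\<And>m. m \<le> N * 2 ^ k \<Longrightarrow>
      \<bar>(\<Sum>i<m. (\<beta> (real (Suc i) / 2 ^ k) - \<beta> (real i / 2 ^ k))\<^sup>2 - 1 / 2 ^ k)\<bar> \<le> \<epsilon>"
  shows "\<bar>(\<Sum>i<N * 2 ^ k. 2 * x (real i / 2 ^ k)
      * (c * (\<beta> (min (real (Suc i) / 2 ^ k) t) - \<beta> (min (real i / 2 ^ k) t))))
      - ((x t)\<^sup>2 - (x 0)\<^sup>2 - (c\<^sup>2 * t + 2 * integral {0..t} (\<lambda>s. x s * g s)))\<bar>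
    \<le> c\<^sup>2 * (\<epsilon> + \<rho>\<^sup>2 + 1 / 2 ^ k) + (3 + \<bar>c\<bar>) * \<rho> * G * t"
proof -
  define n where "n = N * 2 ^ k"
  define u v where "u i = min (real i / 2 ^ k) t" and "v i = min (real (Suc i) / 2 ^ k) t" for i
  have uv: "0 \<le> u i" "u i \<le> v i" "v i \<le> t" "v i - u i \<le> 1 / 2 ^ k" for i
    using dyadic_min_step[OF t(1), of i k] by (simp_all only: u_def v_def)
  have tel: "(\<Sum>i<n. f (v i) - f (u i)) = f t - f 0" for f :: "real \<Rightarrow> real"
    unfolding n_def u_def v_def by (rule dyadic_telescope[OF t])
  have \<rho>: "0 \<le> \<rho>" using osc[of 0 0] t by simp
  have G0: "0 \<le> G" using G[of 0] t by linarith
  have xg: "continuous_on {0..} (\<lambda>s. x s * g s)" by (intro continuous_intros x g)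
  have dx: "x (v i) - x (u i) = integral {u i..v i} g + c * (\<beta> (v i) - \<beta> (u i))" for i
    using eq[of "v i"] eq[of "u i"] uv[of i] integral_Icc_increment(1)[OF g uv(1,2)[of i]]
    by (simp add: right_diff_distrib)
  have bound_int: "\<bar>integral {u i..v i} h\<bar> \<le> H * (v i - u i)"
    if "continuous_on {u i..v i} h" "\<And>s. s \<in> {u i..v i} \<Longrightarrow> \<bar>h s\<bar> \<le> H" for h i H
    using integral_bound[of "u i" "v i" h H] that uv by simp
  have dg: "\<bar>integral {u i..v i} g\<bar> \<le> G * (v i - u i)" for i
  proof (rule bound_int[OF integral_Icc_increment(3)[OF g uv(1,2)]])
    fix s assume "s \<in> {u i..v i}"
    then show "\<bar>g s\<bar> \<le> G" using uv(1,3)[of i] by (intro G) auto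
  qed
  \<comment> \<open>The share of the drift in a squared increment. As \<Delta>x - c \<Delta>\<beta>
    is the integral of g over the cell, it factors into that integral, of order G times the length,
    and a sum of two small oscillations.\<close>
  define e1 where "e1 i = (x (v i) - x (u i))\<^sup>2 - c\<^sup>2 * (\<beta> (v i) - \<beta> (u i))\<^sup>2" for i
  \<comment> \<open>The error of freezing x at the left end inside the integral of x g.\<close>
  define e2 where "e2 i = integral {u i..v i} (\<lambda>s. x s * g s) - x (u i) * integral {u i..v i} g"
      for i
  have e1: "\<bar>e1 i\<bar> \<le> (1 + \<bar>c\<bar>) * \<rho> * G * (v i - u i)" for i
  proof -
    have "e1 i = integral {u i..v i} g * ((x (v i) - x (u i)) + c * (\<beta> (v i) - \<beta> (u i)))"
      unfolding e1_def dx by (simp add: power2_eq_square algebra_simps)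
    then have "\<bar>e1 i\<bar> = \<bar>integral {u i..v i} g\<bar> * \<bar>(x (v i) - x (u i)) + c * (\<beta> (v i) - \<beta> (u i))\<bar>"
      by (simp only: abs_mult)
    also have "\<dots> \<le> (G * (v i - u i)) * (\<rho> + \<bar>c\<bar> * \<rho>)"
    proof (intro mult_mono dg)
      have "\<bar>(x (v i) - x (u i)) + c * (\<beta> (v i) - \<beta> (u i))\<bar> \<le> \<bar>x (v i) - x (u i)\<bar> + \<bar>c\<bar> * \<bar>\<beta> (v i)
          - \<beta> (u i)\<bar>"
        unfolding abs_mult[symmetric] by (rule abs_triangle_ineq)
      also have "\<dots> \<le> \<rho> + \<bar>c\<bar> * \<rho>"
        using uv by (intro add_mono mult_left_mono osc_x osc) auto
      finally show "\<bar>(x (v i) - x (u i)) + c * (\<beta> (v i) - \<beta> (u i))\<bar> \<le> \<rho> + \<bar>c\<bar> * \<rho>" .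
      show "0 \<le> G * (v i - u i)" using G0 uv(2)[of i] by simp
    qed simp
    finally show ?thesis by (simp add: algebra_simps)
  qed
  have e2: "\<bar>e2 i\<bar> \<le> \<rho> * G * (v i - u i)" for i
  proof -
    have ig: "g integrable_on {u i..v i}" "(\<lambda>s. x s * g s) integrable_on {u i..v i}"
      using integral_Icc_increment(2)[OF g uv(1,2)] integral_Icc_increment(2)[OF xg uv(1,2)]
          by blast+
    have "(\<lambda>s. x (u i) * g s) integrable_on {u i..v i}"
      by (intro integrable_continuous_interval continuous_intros
          integral_Icc_increment(3)[OF g uv(1,2)])
    with ig have "e2 i = integral {u i..v i} (\<lambda>s. x s * g s - x (u i) * g s)"
      unfolding e2_def by (subst Henstock_Kurzweil_Integration.integral_diff) auto
    also have "\<bar>\<dots>\<bar> \<le> (\<rho> * G) * (v i - u i)"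
    proof (rule bound_int)
      have "{u i..v i} \<subseteq> {0..}" using uv(1)[of i] by auto
      then show "continuous_on {u i..v i} (\<lambda>s. x s * g s - x (u i) * g s)"
        by (intro continuous_intros continuous_on_subset[OF x] continuous_on_subset[OF g])
      fix s assume s: "s \<in> {u i..v i}"
      have "\<bar>x s * g s - x (u i) * g s\<bar> = \<bar>x s - x (u i)\<bar> * \<bar>g s\<bar>"
        by (simp add: abs_mult[symmetric] left_diff_distrib)
      also have "\<dots> \<le> \<rho> * G"
        using s uv[of i] \<rho> by (intro mult_mono osc_x G) auto
      finally show "\<bar>x s * g s - x (u i) * g s\<bar> \<le> \<rho> * G" .
    qed
    finally show ?thesis .
  qed
  have sum_len: "(\<Sum>i<n. K * (v i - u i)) = K * t" for K :: real
    using tel[of "\<lambda>s. s"] by (simp add: sum_distrib_left[symmetric])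
  have E1: "\<bar>\<Sum>i<n. e1 i\<bar> \<le> (1 + \<bar>c\<bar>) * \<rho> * G * t"
  proof -
    have "\<bar>\<Sum>i<n. e1 i\<bar> \<le> (\<Sum>i<n. \<bar>e1 i\<bar>)" by (rule sum_abs)
    also have "\<dots> \<le> (\<Sum>i<n. (1 + \<bar>c\<bar>) * \<rho> * G * (v i - u i))" by (intro sum_mono e1)
    finally show ?thesis unfolding sum_len .
  qed
  have E2: "\<bar>\<Sum>i<n. e2 i\<bar> \<le> \<rho> * G * t"
  proof -
    have "\<bar>\<Sum>i<n. e2 i\<bar> \<le> (\<Sum>i<n. \<bar>e2 i\<bar>)" by (rule sum_abs)
    also have "\<dots> \<le> (\<Sum>i<n. \<rho> * G * (v i - u i))" by (intro sum_mono e2)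
    finally show ?thesis unfolding sum_len .
  qed
  define q where "q = (\<Sum>i<n. (\<beta> (v i) - \<beta> (u i))\<^sup>2)"
  have Q: "\<bar>q - t\<bar> \<le> \<epsilon> + \<rho>\<^sup>2 + 1 / 2 ^ k"
    unfolding q_def n_def u_def v_def by (rule dyadic_sq_sum[OF t qv osc])
  have step: "2 * x (real i / 2 ^ k) * (c * (\<beta> (v i) - \<beta> (u i)))
      = ((x (v i))\<^sup>2 - (x (u i))\<^sup>2) - e1 i - c\<^sup>2 * (\<beta> (v i) - \<beta> (u i))\<^sup>2
        - 2 * (integral {0..v i} (\<lambda>s. x s * g s) - integral {0..u i} (\<lambda>s. x s * g s)) + 2 * e2
            i" for i
  proof -
    \<comment> \<open>The sum evaluates x at the grid point, not at the clamped point
      \<open>u i\<close>; they differ only beyond t, where the increment of \<beta> is zero.\<close>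
    have left: "2 * x (real i / 2 ^ k) * (c * (\<beta> (v i) - \<beta> (u i)))
        = 2 * x (u i) * (c * (\<beta> (v i) - \<beta> (u i)))"
    proof (cases "real i / 2 ^ k \<le> t")
      case False
      have "real i / 2 ^ k \<le> real (Suc i) / 2 ^ k" by (intro divide_right_mono) simp_all
      with False have "u i = t" "v i = t" unfolding u_def v_def by linarith+
      then show ?thesis by simp
    qed (simp add: u_def)
    have inc: "c * (\<beta> (v i) - \<beta> (u i)) = (x (v i) - x (u i)) - integral {u i..v i} g" using dx[of i]
        by simp
    have "2 * x (u i) * (c * (\<beta> (v i) - \<beta> (u i)))
      = ((x (v i))\<^sup>2 - (x (u i))\<^sup>2) - (x (v i) - x (u i))\<^sup>2 - 2 * integral {u i..v i}
          (\<lambda>s. x s * g s) + 2 * e2 i"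
      unfolding e2_def inc by (simp add: power2_eq_square algebra_simps)
    then show ?thesis
      unfolding left e1_def integral_Icc_increment(1)[OF xg uv(1,2)] by linarith
  qed
  have "(\<Sum>i<n. 2 * x (real i / 2 ^ k) * (c * (\<beta> (v i) - \<beta> (u i))))
      = ((x t)\<^sup>2 - (x 0)\<^sup>2) - (\<Sum>i<n. e1 i) - c\<^sup>2 * q
        - 2 * (integral {0..t} (\<lambda>s. x s * g s) - integral {0..0} (\<lambda>s. x s * g s)) + 2 *
            (\<Sum>i<n. e2 i)"
    unfolding step sum.distrib sum_subtractf q_def sum_distrib_left[symmetric]
      tel[of "\<lambda>s. (x s)\<^sup>2", unfolded sum_subtractf] tel[of
          "\<lambda>s. integral {0..s} (\<lambda>s. x s * g s)", unfolded sum_subtractf] ..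
  then have "(\<Sum>i<n. 2 * x (real i / 2 ^ k) * (c * (\<beta> (v i) - \<beta> (u i))))
      - ((x t)\<^sup>2 - (x 0)\<^sup>2 - (c\<^sup>2 * t + 2 * integral {0..t} (\<lambda>s. x s * g s)))
      = - (\<Sum>i<n. e1 i) - c\<^sup>2 * (q - t) + 2 * (\<Sum>i<n. e2 i)"
    by (simp add: right_diff_distrib)
  also have "\<bar>\<dots>\<bar> \<le> \<bar>\<Sum>i<n. e1 i\<bar> + \<bar>c\<^sup>2 * (q - t)\<bar> + 2 * \<bar>\<Sum>i<n. e2 i\<bar>" by linarith
  \<comment> \<open>The drift error contributes 1 + |c| and the doubled freezing error contributes
    2, which explains the constant 3 + |c|.\<close>
  also have "\<dots> \<le> (1 + \<bar>c\<bar>) * \<rho> * G * t + c\<^sup>2 * (\<epsilon> + \<rho>\<^sup>2 + 1 / 2 ^ k) + 2 * (\<rho> * G * t)"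
  proof -
    have "\<bar>c\<^sup>2 * (q - t)\<bar> \<le> c\<^sup>2 * (\<epsilon> + \<rho>\<^sup>2 + 1 / 2 ^ k)"
      unfolding abs_mult abs_power2 by (intro mult_left_mono Q) simp
    then show ?thesis using E1 E2 by linarith
  qed
  finally show ?thesis unfolding n_def u_def v_def by (simp add: algebra_simps)
qed

lemma modulus_of_continuity:
  fixes f :: "real \<Rightarrow> real"
  assumes "continuous_on {0..} f" "0 < \<rho>" "0 \<le> T"
  shows "\<exists>d>0. \<forall>r s. 0 \<le> r \<and> r \<le> s \<and> s \<le> T \<and> s - r < d \<longrightarrow> \<bar>f s - f r\<bar> \<le> \<rho>"
proof -
  have "uniformly_continuous_on {0..T} f"
    using assms(1) by (intro compact_uniformly_continuous continuous_on_subset[OF assms(1)]) auto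
  then obtain d where d: "d > 0" "\<And>r s. r \<in> {0..T} \<Longrightarrow> s \<in> {0..T} \<Longrightarrow> dist s r < d \<Longrightarrow> dist (f s) (f r)
      < \<rho>"
    using assms(2) unfolding uniformly_continuous_on_def by metis
  have "\<bar>f s - f r\<bar> \<le> \<rho>" if "0 \<le> r" "r \<le> s" "s \<le> T" "s - r < d" for r s
    using d(2)[of r s] that by (simp add: dist_real_def)
  then show ?thesis using d(1) by blast
qed

lemma continuous_Icc_bounded:
  fixes f :: "real \<Rightarrow> real"
  assumes "continuous_on {0..} f" "0 \<le> T"
  shows "\<exists>K\<ge>0. \<forall>s. 0 \<le> s \<and> s \<le> T \<longrightarrow> \<bar>f s\<bar> \<le> K"
proof -
  have "bounded (f ` {0..T})"
    by (intro compact_imp_bounded compact_continuous_image continuous_on_subset[OF assms(1)]) auto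
  then obtain K where K: "\<And>y. y \<in> f ` {0..T} \<Longrightarrow> \<bar>y\<bar> \<le> K" unfolding bounded_real by blast
  have "0 \<le> \<bar>f 0\<bar>" by simp
  also have "\<bar>f 0\<bar> \<le> K" using assms(2) by (intro K) auto
  finally have "0 \<le> K" .
  moreover have "\<bar>f s\<bar> \<le> K" if "0 \<le> s" "s \<le> T" for s using that by (intro K) auto
  ultimately show ?thesis by blast
qed

lemma levels_mesh_tendsto_0:
  assumes "\<And>j. j \<le> \<kappa> j"
  shows "(\<lambda>j. 1 / 2 ^ \<kappa> j :: real) \<longlonglongrightarrow> 0"
proof (rule Lim_null_comparison[of _ "\<lambda>j. (1 / 2) ^ j"])
  show "\<forall>\<^sub>F j in sequentially. norm (1 / 2 ^ \<kappa> j :: real) \<le> (1 / 2) ^ j"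
  proof (intro always_eventually allI)
    fix j
    have "(2::real) ^ j \<le> 2 ^ \<kappa> j" by (rule power_increasing[OF assms]) simp
    then show "norm (1 / 2 ^ \<kappa> j :: real) \<le> (1 / 2) ^ j" by (simp add: power_one_over frac_le)
  qed
  show "(\<lambda>j. (1 / 2) ^ j :: real) \<longlonglongrightarrow> 0" by (rule LIMSEQ_realpow_zero) simp_all
qed

lemma eventually_le_real: "\<forall>\<^sub>F j in sequentially. T \<le> real j"
  by (rule eventually_sequentiallyI[of "nat \<lceil>T\<rceil>"]) linarith

text \<open>The estimate of \<open>ito_square_estimate\<close> is used with \<rho> fixed and j
  tending to infinity: uniform continuity supplies the oscillation bounds once the mesh is small,
  and the remaining terms tend to 0.\<close>

lemma ito_square_pathwise:
  fixes x g \<beta> :: "real \<Rightarrow> real" and \<kappa> :: "nat \<Rightarrow> nat"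
  assumes x: "continuous_on {0..} x" and g: "continuous_on {0..} g" and \<beta>: "continuous_on {0..} \<beta>"
    and eq: "\<And>t. 0 \<le> t \<Longrightarrow> x t = x 0 + integral {0..t} g + c * \<beta> t"
    and \<kappa>: "\<And>j. j \<le> \<kappa> j"
    and qv: "\<forall>\<^sub>F j in sequentially. \<forall>m\<le>j * 2 ^ \<kappa> j.
      \<bar>(\<Sum>i<m. (\<beta> (real (Suc i) / 2 ^ \<kappa> j) - \<beta> (real i / 2 ^ \<kappa> j))\<^sup>2 - 1 / 2 ^ \<kappa> j)\<bar> \<le> \<epsilon> j"
    and \<epsilon>: "\<epsilon> \<longlonglongrightarrow> 0" and T: "0 \<le> T"
  shows "uniform_limit {0..T} (\<lambda>j t. \<Sum>i<j * 2 ^ \<kappa> j. 2 * x (real i / 2 ^ \<kappa> j) *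
      (c * (\<beta> (min (real (Suc i) / 2 ^ \<kappa> j) t) - \<beta> (min (real i / 2 ^ \<kappa> j) t))))
    (\<lambda>t. (x t)\<^sup>2 - (x 0)\<^sup>2 - (c\<^sup>2 * t + 2 * integral {0..t} (\<lambda>s. x s * g s))) sequentially"
proof (rule uniform_limitI)
  fix e :: real assume e: "0 < e"
  obtain G where G: "0 \<le> G" "\<And>s. 0 \<le> s \<Longrightarrow> s \<le> T \<Longrightarrow> \<bar>g s\<bar> \<le> G"
    using continuous_Icc_bounded[OF g T] by blast
  define L where "L = c\<^sup>2 + (3 + \<bar>c\<bar>) * G * T"
  have L: "0 \<le> L" unfolding L_def using G T by simp
  \<comment> \<open>\<rho> \<le> 1 bounds its square by itself, so all terms containing \<rho> are
    at most \<rho> L and hence at most e / 2; L + 1 avoids division by zero.\<close>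
  define \<rho> where "\<rho> = min 1 (e / (2 * (L + 1)))"
  have \<rho>: "0 < \<rho>" "\<rho> \<le> 1" "\<rho> * (L + 1) \<le> e / 2"
  proof -
    show "0 < \<rho>" "\<rho> \<le> 1" using e L by (auto simp: \<rho>_def)
    have "\<rho> \<le> e / (2 * (L + 1))" by (simp add: \<rho>_def)
    then show "\<rho> * (L + 1) \<le> e / 2" using L by (simp add: pos_le_divide_eq field_simps)
  qed
  obtain d1 where d1: "0 < d1" "\<And>r s. 0 \<le> r \<and> r \<le> s \<and> s \<le> T \<and> s - r < d1 \<Longrightarrow> \<bar>x s - x r\<bar> \<le> \<rho>"
    using modulus_of_continuity[OF x \<rho>(1) T] by blast
  obtain d2 where d2: "0 < d2" "\<And>r s. 0 \<le> r \<and> r \<le> s \<and> s \<le> T \<and> s - r < d2 \<Longrightarrow> \<bar>\<beta> s - \<beta> r\<bar> \<le> \<rho>"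
    using modulus_of_continuity[OF \<beta> \<rho>(1) T] by blast
  note mesh = levels_mesh_tendsto_0[OF \<kappa>]
  have "(\<lambda>j. c\<^sup>2 * (\<epsilon> j + 1 / 2 ^ \<kappa> j)) \<longlonglongrightarrow> c\<^sup>2 * (0 + 0)"
    by (intro tendsto_mult tendsto_add tendsto_const \<epsilon> mesh)
  then have "\<forall>\<^sub>F j in sequentially. c\<^sup>2 * (\<epsilon> j + 1 / 2 ^ \<kappa> j) < e / 2"
    using e by (intro order_tendstoD(2)) auto
  moreover have "\<forall>\<^sub>F j in sequentially. 1 / 2 ^ \<kappa> j < min d1 d2"
    using mesh d1(1) d2(1) by (intro order_tendstoD(2)) auto
  ultimately show "\<forall>\<^sub>F j in sequentially. \<forall>t\<in>{0..T}.
      dist (\<Sum>i<j * 2 ^ \<kappa> j. 2 * x (real i / 2 ^ \<kappa> j) *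
        (c * (\<beta> (min (real (Suc i) / 2 ^ \<kappa> j) t) - \<beta> (min (real i / 2 ^ \<kappa> j) t))))
      ((x t)\<^sup>2 - (x 0)\<^sup>2 - (c\<^sup>2 * t + 2 * integral {0..t} (\<lambda>s. x s * g s))) < e"
    using qv eventually_le_real[of T]
  proof eventually_elim
    case (elim j)
    show ?case
    proof
      fix t assume "t \<in> {0..T}"
      then have t: "0 \<le> t" "t \<le> T" "t \<le> real j" using elim(4) by auto
      have est: "\<bar>(\<Sum>i<j * 2 ^ \<kappa> j. 2 * x (real i / 2 ^ \<kappa> j)
          * (c * (\<beta> (min (real (Suc i) / 2 ^ \<kappa> j) t) - \<beta> (min (real i / 2 ^ \<kappa> j) t))))
          - ((x t)\<^sup>2 - (x 0)\<^sup>2 - (c\<^sup>2 * t + 2 * integral {0..t} (\<lambda>s. x s * g s)))\<bar>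
        \<le> c\<^sup>2 * (\<epsilon> j + \<rho>\<^sup>2 + 1 / 2 ^ \<kappa> j) + (3 + \<bar>c\<bar>) * \<rho> * G * t"
      proof (rule ito_square_estimate[OF x g eq t(1,3)])
        show "\<bar>g s\<bar> \<le> G" if "0 \<le> s" "s \<le> t" for s using that t(2) by (intro G) auto
        show "\<bar>x s - x r\<bar> \<le> \<rho>" if "0 \<le> r" "r \<le> s" "s \<le> t" "s - r \<le> 1 / 2 ^ \<kappa> j" for r s
          using that t(2) elim(2) by (intro d1(2)) auto
        show "\<bar>\<beta> s - \<beta> r\<bar> \<le> \<rho>" if "0 \<le> r" "r \<le> s" "s \<le> t" "s - r \<le> 1 / 2 ^ \<kappa> j" for r s
          using that t(2) elim(2) by (intro d2(2)) auto
        show "\<bar>(\<Sum>i<m. (\<beta> (real (Suc i) / 2 ^ \<kappa> j) - \<beta> (real i / 2 ^ \<kappa> j))\<^sup>2 - 1 / 2 ^ \<kappa> j)\<bar> \<le> \<epsilon> j"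
          if "m \<le> j * 2 ^ \<kappa> j" for m
          using elim(3) that by (elim allE[of _ m] impE)
      qed
      have split: "c\<^sup>2 * (\<epsilon> j + \<rho>\<^sup>2 + 1 / 2 ^ \<kappa> j) + (3 + \<bar>c\<bar>) * \<rho> * G * t
          = c\<^sup>2 * (\<epsilon> j + 1 / 2 ^ \<kappa> j) + (c\<^sup>2 * \<rho>\<^sup>2 + (3 + \<bar>c\<bar>) * \<rho> * G * t)"
        by (simp add: algebra_simps)
      have small: "c\<^sup>2 * \<rho>\<^sup>2 + (3 + \<bar>c\<bar>) * \<rho> * G * t \<le> e / 2"
      proof -
        have "\<rho>\<^sup>2 \<le> \<rho>" using \<rho> by (simp add: power2_eq_square mult_left_le)
        then have "c\<^sup>2 * \<rho>\<^sup>2 \<le> c\<^sup>2 * \<rho>" by (intro mult_left_mono) auto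
        moreover have "(3 + \<bar>c\<bar>) * \<rho> * G * t \<le> (3 + \<bar>c\<bar>) * \<rho> * G * T"
          using \<rho> G t by (intro mult_left_mono) auto
        moreover have "c\<^sup>2 * \<rho> + (3 + \<bar>c\<bar>) * \<rho> * G * T = \<rho> * L" by (simp add: L_def algebra_simps)
        moreover have "\<rho> * L \<le> \<rho> * (L + 1)" using \<rho> by (intro mult_left_mono) auto
        ultimately show ?thesis using \<rho>(3) by linarith
      qed
      show "dist (\<Sum>i<j * 2 ^ \<kappa> j. 2 * x (real i / 2 ^ \<kappa> j) *
          (c * (\<beta> (min (real (Suc i) / 2 ^ \<kappa> j) t) - \<beta> (min (real i / 2 ^ \<kappa> j) t))))
        ((x t)\<^sup>2 - (x 0)\<^sup>2 - (c\<^sup>2 * t + 2 * integral {0..t} (\<lambda>s. x s * g s))) < e"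
        using elim(1) est split small unfolding dist_real_def by linarith
    qed
  qed
qed

section \<open>Approximation by simple processes on dyadic grids\<close>

lemma simple_value_dyadic:
  assumes "real i / 2 ^ k < s" "s \<le> real (Suc i) / 2 ^ k" "i < n"
  shows "simple_value n (\<lambda>i. real i / 2 ^ k) \<xi> s \<omega> = \<xi> i \<omega>"
proof -
  have "\<xi> i' \<omega> * indicator {real i' / 2 ^ k<..real (Suc i') / 2 ^ k} s
      = (if i' = i then \<xi> i \<omega> else 0)" for i'
  proof (cases "i' = i")
    case True
    then show ?thesis using assms by simp
  next
    case False
    then consider "Suc i' \<le> i" | "Suc i \<le> i'" by linarith
    then have "s \<notin> {real i' / 2 ^ k<..real (Suc i') / 2 ^ k}"
    proof cases
      case 1
      then have "real (Suc i') / 2 ^ k \<le> real i / 2 ^ k" by (intro divide_right_mono) simp_all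
      then show ?thesis using assms by auto
    next
      case 2
      then have "real (Suc i) / 2 ^ k \<le> real i' / 2 ^ k" by (intro divide_right_mono) simp_all
      then show ?thesis using assms by auto
    qed
    then show ?thesis using False by simp
  qed
  then show ?thesis using assms(3) by (simp add: simple_value_def)
qed

text \<open>Simple processes live on cells open on the left and closed on the right, so the index is
  the ceiling minus one, in contrast with the floor used for \<open>sign_integral\<close>.\<close>

lemma dyadic_left_cell:
  assumes "0 < s" "s \<le> real N"
  shows "\<exists>i<N * 2 ^ k. real i / 2 ^ k < s \<and> s \<le> real (Suc i) / 2 ^ k"
proof -
  define i where "i = nat (\<lceil>s * 2 ^ k\<rceil> - 1)"
  have pos: "0 < s * 2 ^ k" using assms(1) by simp
  then have "0 < \<lceil>s * 2 ^ k\<rceil>" by (simp only: zero_less_ceiling)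
  then have i: "real i = of_int \<lceil>s * 2 ^ k\<rceil> - 1" by (simp add: i_def)
  have "real i < s * 2 ^ k" "s * 2 ^ k \<le> real i + 1" unfolding i by linarith+
  moreover have "s * 2 ^ k \<le> real N * 2 ^ k" using assms(2) by simp
  ultimately have "real i < real N * 2 ^ k" by linarith
  then have "real i < real (N * 2 ^ k)" by simp
  then have "i < N * 2 ^ k" by (simp only: of_nat_less_iff)
  moreover have "real i / 2 ^ k < s" "s \<le> real (Suc i) / 2 ^ k"
    using \<open>real i < s * 2 ^ k\<close> \<open>s * 2 ^ k \<le> real i + 1\<close>
        by (simp_all add: divide_less_eq le_divide_eq)
  ultimately show ?thesis by blast
qed

text \<open>The heights have to agree with \<sigma> only at grid points up to T and only for large
  j; this leaves room for a truncation that becomes inactive at an index depending on the path. The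
  rest is uniform continuity.\<close>

lemma simple_value_L2_tendsto:
  fixes \<sigma> :: "real \<Rightarrow> real" and \<kappa> :: "nat \<Rightarrow> nat" and \<xi> :: "nat \<Rightarrow> nat \<Rightarrow> 'w \<Rightarrow> real"
  assumes \<sigma>: "continuous_on {0..} \<sigma>" and \<kappa>: "\<And>j. j \<le> \<kappa> j" and T: "0 \<le> T"
    and \<xi>: "\<forall>\<^sub>F j in sequentially. \<forall>i. real i / 2 ^ \<kappa> j \<le> T \<longrightarrow> \<xi> j i \<omega> = \<sigma> (real i / 2 ^ \<kappa> j)"
  shows "(\<lambda>j. \<integral>\<^sup>+s\<in>{0..T}. ennreal ((simple_value (j * 2 ^ \<kappa> j) (\<lambda>i. real i / 2 ^ \<kappa> j) (\<xi> j) s \<omega>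
      - \<sigma> s)\<^sup>2) \<partial>lborel)
    \<longlonglongrightarrow> 0"
proof (rule order_tendstoI)
  fix a :: ennreal assume "0 < a"
  then obtain b where b: "0 < b" "b < a" using dense by blast
  define \<epsilon> where "\<epsilon> = enn2real b"
  have "b < top" using b by (meson order_less_le_trans top_greatest)
  then have eb: "ennreal \<epsilon> = b" by (simp add: \<epsilon>_def)
  then have \<epsilon>: "0 < \<epsilon>" using b(1) by (metis ennreal_less_zero_iff ennreal_neg less_irrefl not_less)
  define \<rho> where "\<rho> = sqrt (\<epsilon> / (T + 1))"
  have \<rho>: "0 < \<rho>" "\<rho>\<^sup>2 * T \<le> \<epsilon>" using \<epsilon> T by (simp_all add: \<rho>_def divide_le_eq)
  obtain d where d: "0 < d" "\<And>r s. 0 \<le> r \<and> r \<le> s \<and> s \<le> T \<and> s - r < d \<Longrightarrow> \<bar>\<sigma> s - \<sigma> r\<bar> \<le> \<rho>"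
    using modulus_of_continuity[OF \<sigma> \<rho>(1) T] by blast
  have "\<forall>\<^sub>F j in sequentially. 1 / 2 ^ \<kappa> j < d"
    using levels_mesh_tendsto_0[OF \<kappa>] d(1) by (intro order_tendstoD(2)) auto
  with \<xi> eventually_le_real[of T]
  show "\<forall>\<^sub>F j in sequentially. (\<integral>\<^sup>+s\<in>{0..T}. ennreal
      ((simple_value (j * 2 ^ \<kappa> j) (\<lambda>i. real i / 2 ^ \<kappa> j) (\<xi> j) s \<omega> - \<sigma> s)\<^sup>2) \<partial>lborel) < a"
  proof eventually_elim
    case (elim j)
    have le: "(simple_value (j * 2 ^ \<kappa> j) (\<lambda>i. real i / 2 ^ \<kappa> j) (\<xi> j) s \<omega> - \<sigma> s)\<^sup>2 \<le> \<rho>\<^sup>2"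
      if s: "0 < s" "s \<le> T" for s
    proof -
      have "s \<le> real j" using s elim(2) by linarith
      then obtain i where i: "i < j * 2 ^ \<kappa> j" "real i / 2 ^ \<kappa> j < s" "s \<le> real (Suc i) / 2 ^ \<kappa> j"
        using dyadic_left_cell[OF s(1)] by blast
      have "simple_value (j * 2 ^ \<kappa> j) (\<lambda>i. real i / 2 ^ \<kappa> j) (\<xi> j) s \<omega> = \<xi> j i \<omega>"
        by (rule simple_value_dyadic[OF i(2,3,1)])
      also have "\<dots> = \<sigma> (real i / 2 ^ \<kappa> j)"
      proof -
        have "real i / 2 ^ \<kappa> j \<le> T" using i(2) s(2) by linarith
        then show ?thesis using elim(1) by blast
      qed
      finally have eq: "simple_value (j * 2 ^ \<kappa> j) (\<lambda>i. real i / 2 ^ \<kappa> j) (\<xi> j) s \<omega>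
          = \<sigma> (real i / 2 ^ \<kappa> j)" .
      have "s - real i / 2 ^ \<kappa> j \<le> 1 / 2 ^ \<kappa> j" using i(3) by (simp add: add_divide_distrib)
      then have "\<bar>\<sigma> s - \<sigma> (real i / 2 ^ \<kappa> j)\<bar> \<le> \<rho>"
        using i(2) s(2) elim(3) by (intro d(2)) auto
      from power_mono[OF this, of 2] show ?thesis unfolding eq by (simp add: power2_commute)
    qed
    have "(\<integral>\<^sup>+s\<in>{0..T}. ennreal ((simple_value (j * 2 ^ \<kappa> j) (\<lambda>i. real i / 2 ^ \<kappa> j) (\<xi> j) s \<omega>
        - \<sigma> s)\<^sup>2) \<partial>lborel)
        \<le> (\<integral>\<^sup>+s. ennreal (\<rho>\<^sup>2) * indicator {0..T} s \<partial>lborel)"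
    proof (rule nn_integral_mono_AE)
      \<comment> \<open>Time 0 belongs to no cell that is open on the left, so the pointwise bound
        excludes it.\<close>
      have "AE s in lborel. s \<noteq> (0::real)" by (rule AE_lborel_singleton)
      then show "AE s in lborel. ennreal
          ((simple_value (j * 2 ^ \<kappa> j) (\<lambda>i. real i / 2 ^ \<kappa> j) (\<xi> j) s \<omega> - \<sigma> s)\<^sup>2) * indicator {0..T}
              s
          \<le> ennreal (\<rho>\<^sup>2) * indicator {0..T} s"
      proof eventually_elim
        case (elim s)
        show ?case
        proof (cases "s \<in> {0..T}")
          case True
          then have "0 < s" "s \<le> T" using elim by auto
          from ennreal_leI[OF le[OF this]] show ?thesis using True by simp
        qed simp
      qed
    qed
    also have "\<dots> = ennreal (\<rho>\<^sup>2 * T)"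
      using T by (subst nn_integral_cmult_indicator) (auto simp: ennreal_mult)
    also have "\<dots> \<le> b" unfolding eb[symmetric] by (rule ennreal_leI[OF \<rho>(2)])
    finally show ?case using b(2) by simp
  qed
qed simp

context filtered_prob_space
begin

lemma progressive_adapted:
  assumes "progressive F X"
  shows "adapted F X"
  unfolding adapted_def
proof (intro allI impI)
  fix t :: real assume t: "0 \<le> t"
  have "Pair t \<in> measurable (F t) (restrict_space borel {0..t} \<Otimes>\<^sub>M F t)"
    using t by (intro measurable_Pair1') (simp add: space_restrict_space)
  moreover have "(\<lambda>(s, \<omega>). X s \<omega>) \<in> borel_measurable (restrict_space borel {0..t} \<Otimes>\<^sub>M F t)"
    using assms t unfolding progressive_def by blast
  ultimately have "(\<lambda>\<omega>. (\<lambda>(s, \<omega>). X s \<omega>) (Pair t \<omega>)) \<in> borel_measurable (F t)"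
    by (rule measurable_compose)
  then show "X t \<in> borel_measurable (F t)" by simp
qed

lemma progressive_compose:
  assumes "progressive F X" "h \<in> borel_measurable borel"
  shows "progressive F (\<lambda>t \<omega>. h (X t \<omega>))"
  unfolding progressive_def
proof (intro allI impI)
  fix t :: real assume "0 \<le> t"
  then have "(\<lambda>(s, \<omega>). X s \<omega>) \<in> borel_measurable (restrict_space borel {0..t} \<Otimes>\<^sub>M F t)"
    using assms(1) unfolding progressive_def by blast
  from measurable_compose[OF this assms(2)]
  show "(\<lambda>(s, \<omega>). h (X s \<omega>)) \<in> borel_measurable (restrict_space borel {0..t} \<Otimes>\<^sub>M F t)"
    by (simp add: case_prod_beta')
qed

section \<open>Quadratic variation of a Wiener process\<close>

definition sq_variation_error :: "(real \<Rightarrow> 'w \<Rightarrow> real) \<Rightarrow> nat \<Rightarrow> nat \<Rightarrow> 'w \<Rightarrow> real" where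
  "sq_variation_error B k m \<omega> = (\<Sum>i<m. (B (real (Suc i) / 2 ^ k) \<omega> - B (real i / 2 ^ k) \<omega>)\<^sup>2
      - 1 / 2 ^ k)"

text \<open>With d = 1 / 2^k, each summand is independent of the past, has mean 0 and second moment
  3 d^2 - 2 d d + d^2 = 2 d^2.\<close>

lemma sq_variation_error_martingale:
  assumes B: "real_wiener_process M F B"
  shows "sq_martingale_seq (\<lambda>i. real i / 2 ^ k) (sq_variation_error B k)"
    and "(LINT \<omega>|M. (sq_variation_error B k n \<omega>)\<^sup>2) = real n * (2 * (1 / 2 ^ k)\<^sup>2)"
proof -
  define \<tau> where "\<tau> i = real i / 2 ^ k" for i
  define D where "D i \<omega> = (B (\<tau> (Suc i)) \<omega> - B (\<tau> i) \<omega>)\<^sup>2 - 1 / 2 ^ k" for i \<omega>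
  have Suc: "sq_variation_error B k (Suc m) \<omega> = sq_variation_error B k m \<omega> + D m \<omega>" for m \<omega>
    by (simp add: sq_variation_error_def D_def \<tau>_def)
  have adB: "adapted F B" using B by (simp add: wiener_process_def)
  have \<tau>: "mono \<tau>" "\<And>i. 0 \<le> \<tau> i" "\<And>i. \<tau> i < \<tau> (Suc i)" "\<And>i. \<tau> (Suc i) - \<tau> i = 1 / 2 ^ k"
    by (auto simp: \<tau>_def intro!: monoI divide_right_mono divide_strict_right_mono simp flip:
        diff_divide_distrib)
  have mom: "integrable M (\<lambda>\<omega>. (B (\<tau> (Suc i)) \<omega> - B (\<tau> i) \<omega>)\<^sup>2)"
      "(LINT \<omega>|M. (B (\<tau> (Suc i)) \<omega> - B (\<tau> i) \<omega>)\<^sup>2) = 1 / 2 ^ k"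
      "integrable M (\<lambda>\<omega>. (B (\<tau> (Suc i)) \<omega> - B (\<tau> i) \<omega>) ^ 4)"
      "(LINT \<omega>|M. (B (\<tau> (Suc i)) \<omega> - B (\<tau> i) \<omega>) ^ 4) = 3 * (1 / 2 ^ k)\<^sup>2" for i
    using wiener_increment_moments(2,3)[OF B \<tau>(2) less_imp_le[OF \<tau>(3)], of i]
    unfolding \<tau>(4) has_bochner_integral_iff by blast+
  have Dexp: "(D i \<omega>)\<^sup>2 = (B (\<tau> (Suc i)) \<omega> - B (\<tau> i) \<omega>) ^ 4
      - (2 * (1 / 2 ^ k)) * (B (\<tau> (Suc i)) \<omega> - B (\<tau> i) \<omega>)\<^sup>2 + (1 / 2 ^ k)\<^sup>2" for i \<omega>
  proof -
    have "(z\<^sup>2 - d)\<^sup>2 = z ^ 4 - (2 * d) * z\<^sup>2 + d\<^sup>2" for z d :: real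
      by (simp add: power2_eq_square power4_eq_xxxx algebra_simps)
    then show ?thesis unfolding D_def .
  qed
  have D2: "integrable M (\<lambda>\<omega>. (D i \<omega>)\<^sup>2)" "(LINT \<omega>|M. (D i \<omega>)\<^sup>2) = 2 * (1 / 2 ^ k)\<^sup>2" for i
  proof -
    show "integrable M (\<lambda>\<omega>. (D i \<omega>)\<^sup>2)"
      unfolding Dexp by (intro Bochner_Integration.integrable_add
          Bochner_Integration.integrable_diff
          integrable_mult_right mom integrable_const)
    have "(LINT \<omega>|M. (D i \<omega>)\<^sup>2) = 3 * (1 / 2 ^ k)\<^sup>2 - (2 * (1 / 2 ^ k)) * (1 / 2 ^ k)
        + (1 / 2 ^ k)\<^sup>2"
      unfolding Dexp using mom[of i] by (simp add: prob_space)
    then show "(LINT \<omega>|M. (D i \<omega>)\<^sup>2) = 2 * (1 / 2 ^ k)\<^sup>2" by (simp add: power2_eq_square)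
  qed
  have Bm: "B (\<tau> i) \<in> borel_measurable (F (\<tau> m))" if "i \<le> m" for i m
    by (rule adaptedD[OF adB \<tau>(2) monoD[OF \<tau>(1) that]])
  have Xm: "sq_variation_error B k m \<in> borel_measurable (F (\<tau> m))" for m
    unfolding sq_variation_error_def[abs_def] \<tau>_def[symmetric]
    by (intro borel_measurable_sum borel_measurable_diff borel_measurable_power Bm) auto
  have Dm: "D m \<in> borel_measurable M" for m
    unfolding D_def[abs_def]
    using measurable_F_M[OF Bm[of m m]] measurable_F_M[OF Bm[of "Suc m" "Suc m"]] by measurable
  have X2: "integrable M (\<lambda>\<omega>. (sq_variation_error B k m \<omega>)\<^sup>2)" for m
  proof (induction m)
    case (Suc m)
    have "integrable M (\<lambda>\<omega>. (sq_variation_error B k m \<omega> - (0 - D m \<omega>))\<^sup>2)"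
      using Suc Dm D2(1) measurable_F_M[OF Xm] by (intro sq_integrable_diff) auto
    then show ?case by (simp add: \<open>\<And>m \<omega>. sq_variation_error B k (Suc m) \<omega> = _\<close>)
  qed (simp add: sq_variation_error_def)
  have "(LINT \<omega>|M. indicator A \<omega> * D m \<omega>) = 0" if A: "A \<in> sets (F (\<tau> m))" for A m
  proof -
    have "A \<in> sets M" by (rule subsetD[OF sets_F_subset A])
    have "(\<lambda>x::real. x\<^sup>2 - 1 / 2 ^ k) \<in> borel_measurable borel" by measurable
    then have "indep_var borel (indicator A :: 'w \<Rightarrow> real) borel (D m)"
      unfolding D_def[abs_def]
      by (rule wiener_increment_indep[OF B \<tau>(2,3) borel_measurable_indicator[OF A]])
    then have "(LINT \<omega>|M. indicator A \<omega> * D m \<omega>) = (LINT \<omega>|M. indicator A \<omega>) * (LINT \<omega>|M. D m \<omega>)"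
    proof (rule indep_var_lebesgue_integral)
      show "integrable M (indicator A :: 'w \<Rightarrow> real)"
        using \<open>A \<in> sets M\<close> by (intro integrable_real_indicator) (auto simp: emeasure_eq_measure)
      show "integrable M (D m)" by (rule sq_integrable_integrable[OF Dm D2(1)])
    qed
    also have "(LINT \<omega>|M. D m \<omega>) = 0"
      unfolding D_def using mom[of m] by (simp add: prob_space)
    finally show ?thesis by simp
  qed
  then have seq: "sq_martingale_seq \<tau> (sq_variation_error B k)"
    unfolding sq_martingale_seq_def Suc using \<tau>(1) Xm X2 by simp
  then show "sq_martingale_seq (\<lambda>i. real i / 2 ^ k) (sq_variation_error B k)"
      by (simp only: \<tau>_def[abs_def])
  show "(LINT \<omega>|M. (sq_variation_error B k n \<omega>)\<^sup>2) = real n * (2 * (1 / 2 ^ k)\<^sup>2)"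
    unfolding sq_martingale_seq_pythagoras[OF seq, of n] Suc
    by (simp add: D2(2) sq_variation_error_def)
qed

text \<open>Kolmogorov's inequality and Borel-Cantelli. Over j 2^k cells of level k =
  \<open>\<kappa> j\<close> the second moment is 2 j / 2^k, at most 2 (2/8)^j; division by the
  squared threshold (9/16)^j leaves 2 (4/9)^j.\<close>

lemma wiener_quadratic_variation:
  assumes B: "real_wiener_process M F B" and \<kappa>: "\<And>j. 3 * j \<le> \<kappa> j"
  shows "AE \<omega> in M. \<forall>\<^sub>F j in sequentially. \<forall>m\<le>j * 2 ^ \<kappa> j. \<bar>sq_variation_error B (\<kappa> j) m \<omega>\<bar>
      \<le> (3 / 4) ^ j"
proof -
  define E where "E j = {\<omega>\<in>space M. \<exists>m\<le>j * 2 ^ \<kappa> j. (3 / 4) ^ j < \<bar>sq_variation_error B (\<kappa> j) m \<omega>\<bar>}"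
      for j
  have EM: "E j \<in> sets M" for j
  proof -
    have "E j = (\<Union>m\<in>{..j * 2 ^ \<kappa> j}. {\<omega>\<in>space M. (3 / 4) ^ j < \<bar>sq_variation_error B (\<kappa> j) m \<omega>\<bar>})"
      by (auto simp: E_def)
    also have "\<dots> \<in> sets M"
      using sq_martingale_seqD(3)[OF sq_variation_error_martingale(1)[OF B]]
      by (intro sets.finite_UN) (auto intro!: borel_measurable_less borel_measurable_abs)
    finally show ?thesis .
  qed
  have pE: "prob (E j) \<le> 2 * (4 / 9) ^ j" for j
  proof -
    have "prob (E j) \<le> (LINT \<omega>|M. (sq_variation_error B (\<kappa> j) (j * 2 ^ \<kappa> j) \<omega>)\<^sup>2) / ((3 / 4) ^ j)\<^sup>2"
      unfolding E_def by (intro sq_martingale_seq_maximal[OF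
          sq_variation_error_martingale(1)[OF B]]) simp
    also have "(LINT \<omega>|M. (sq_variation_error B (\<kappa> j) (j * 2 ^ \<kappa> j) \<omega>)\<^sup>2)
        = 2 * real j * (1 / 2 ^ \<kappa> j)"
      unfolding sq_variation_error_martingale(2)[OF B] by (simp add: power2_eq_square)
    also have "2 * real j * (1 / 2 ^ \<kappa> j) / ((3 / 4) ^ j)\<^sup>2
        \<le> 2 * 2 ^ j * (1 / 8) ^ j / ((3 / 4) ^ j)\<^sup>2"
    proof (intro divide_right_mono mult_mono)
      show "real j \<le> 2 ^ j" by (rule of_nat_less_two_power[THEN less_imp_le])
      have "(2::real) ^ (3 * j) \<le> 2 ^ \<kappa> j" by (rule power_increasing[OF \<kappa>]) simp
      then have "(8::real) ^ j \<le> 2 ^ \<kappa> j" by (simp add: power_mult)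
      then show "1 / (2::real) ^ \<kappa> j \<le> (1 / 8) ^ j" by (simp add: power_one_over frac_le)
    qed simp_all
    also have "\<dots> = 2 * (4 / 9) ^ j"
    proof -
      have "(4 / 9 :: real) ^ j * ((3 / 4) ^ j)\<^sup>2 = 2 ^ j * (1 / 8) ^ j"
        unfolding power2_eq_square power_mult_distrib[symmetric] by simp
      then have "2 * 2 ^ j * (1 / 8) ^ j = 2 * (4 / 9 :: real) ^ j * ((3 / 4) ^ j)\<^sup>2" by simp
      then show ?thesis by (simp only: nonzero_mult_div_cancel_right) simp
    qed
    finally show ?thesis .
  qed
  have "AE \<omega> in M. \<forall>\<^sub>F j in sequentially. \<omega> \<in> space M - E j"
  proof (rule borel_cantelli_AE1[OF EM])
    show "emeasure M (E j) < \<infinity>" for j by (simp add: emeasure_eq_measure)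
    show "summable (\<lambda>j. prob (E j))"
    proof (rule summable_comparison_test')
      show "summable (\<lambda>j. 2 * (4 / 9 :: real) ^ j)" by (intro summable_mult summable_geometric) simp
      show "norm (prob (E j)) \<le> 2 * (4 / 9) ^ j" if "0 \<le> j" for j using pE[of j] by simp
    qed
  qed
  then show ?thesis
  proof eventually_elim
    case (elim \<omega>)
    then show ?case
    proof eventually_elim
      case (elim j)
      then have "\<not> (\<exists>m\<le>j * 2 ^ \<kappa> j. (3 / 4) ^ j < \<bar>sq_variation_error B (\<kappa> j) m \<omega>\<bar>)"
        unfolding E_def by blast
      then show ?case using not_le by blast
    qed
  qed
qed

end

section \<open>The stochastic integral against the constructed Wiener process\<close>

lemma set_integral_continuous:
  fixes f :: "real \<Rightarrow> real"
  assumes "continuous_on {0..} f"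
  shows "set_integrable lborel {0..t} f" "(LINT s:{0..t}|lborel. f s) = integral {0..t} f"
proof -
  show "set_integrable lborel {0..t} f"
    by (rule borel_integrable_atLeastAtMost'[OF continuous_on_subset[OF assms]]) auto
  then show "(LINT s:{0..t}|lborel. f s) = integral {0..t} f"
    by (rule set_borel_integral_eq_integral)
qed

text \<open>Linearity in the integrator, used to split \<open>w\<close> into a frozen sign integral
  and the remaining gap.\<close>

lemma simple_integral_process_add:
  "simple_integral_process w n \<tau> \<xi> t \<omega> =
    simple_integral_process u n \<tau> \<xi> t \<omega> + simple_integral_process (\<lambda>t \<omega>. w t \<omega> - u t \<omega>) n \<tau> \<xi> t \<omega>"
  unfolding simple_integral_process_def sum.distrib[symmetric]
  by (intro sum.cong) (simp_all add: algebra_simps)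

lemma simple_integral_process_continuous:
  fixes w :: "real \<Rightarrow> 'w \<Rightarrow> real"
  assumes "continuous_on {0..} (\<lambda>t. w t \<omega>)" "\<And>i. 0 \<le> \<tau> i"
  shows "continuous_on {0..} (\<lambda>t. simple_integral_process w n \<tau> \<xi> t \<omega>)"
  unfolding simple_integral_process_def
proof (intro continuous_intros)
  fix i
  have m: "continuous_on {0..} (\<lambda>t. min (\<tau> i) t)" for i by (intro continuous_intros)
  have "continuous_on {0..} (\<lambda>t. w (min (\<tau> i) t) \<omega>)" for i
    by (rule continuous_on_compose2[OF assms(1) m]) (use assms(2) in auto)
  then show "continuous_on {0..} (\<lambda>t. w (min (\<tau> (Suc i)) t) \<omega>)"
      "continuous_on {0..} (\<lambda>t. w (min (\<tau> i) t) \<omega>)"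
    by blast+
qed

text \<open>Here |X| dw = X dB becomes an exact identity of finite sums: in each cell the integrator
  moves by the sign of X at the left end times \<Delta>B, and |x| times the sign of x is x. The
  truncation at K is inactive on the path considered.\<close>

lemma simple_integral_sign_integral:
  assumes t: "0 \<le> t" and K: "\<And>s. 0 \<le> s \<Longrightarrow> s \<le> t \<Longrightarrow> \<bar>X s \<omega>\<bar> \<le> K"
  shows "simple_integral_process (sign_integral X B k) n (\<lambda>i. real i / 2 ^ k)
      (\<lambda>i \<omega>. 2 * c * min \<bar>X (real i / 2 ^ k) \<omega>\<bar> K) t \<omega>
    = (\<Sum>i<n. 2 * X (real i / 2 ^ k) \<omega> *
        (c * (B (min (real (Suc i) / 2 ^ k) t) \<omega> - B (min (real i / 2 ^ k) t) \<omega>)))"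
  unfolding simple_integral_process_def
proof (rule sum.cong[OF refl])
  fix i
  define u v where "u = min (real i / 2 ^ k) t" and "v = min (real (Suc i) / 2 ^ k) t"
  show "2 * c * min \<bar>X (real i / 2 ^ k) \<omega>\<bar> K *
      (sign_integral X B k (min (real (Suc i) / 2 ^ k) t) \<omega> - sign_integral X B k
          (min (real i / 2 ^ k) t) \<omega>)
    = 2 * X (real i / 2 ^ k) \<omega> * (c *
        (B (min (real (Suc i) / 2 ^ k) t) \<omega> - B (min (real i / 2 ^ k) t) \<omega>))"
    unfolding u_def[symmetric] v_def[symmetric]
  proof (cases "real i / 2 ^ k \<le> t")
    case True
    have uv: "real i / 2 ^ k \<le> u" "u \<le> v" "v \<le> real (Suc i) / 2 ^ k"
      using True dyadic_min_step(2)[OF t, of i k] by (simp_all add: u_def v_def)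
    have "min \<bar>X (real i / 2 ^ k) \<omega>\<bar> K = \<bar>X (real i / 2 ^ k) \<omega>\<bar>"
      using K[of "real i / 2 ^ k"] True by simp
    then have "2 * c * min \<bar>X (real i / 2 ^ k) \<omega>\<bar> K
        * (sign_integral X B k v \<omega> - sign_integral X B k u \<omega>)
        = 2 * (\<bar>X (real i / 2 ^ k) \<omega>\<bar> * sign (X (real i / 2 ^ k) \<omega>)) * (c * (B v \<omega> - B u \<omega>))"
      unfolding sign_integral_increment[OF uv] by (simp only: mult_ac)
    then show "2 * c * min \<bar>X (real i / 2 ^ k) \<omega>\<bar> K
        * (sign_integral X B k v \<omega> - sign_integral X B k u \<omega>)
        = 2 * X (real i / 2 ^ k) \<omega> * (c * (B v \<omega> - B u \<omega>))"
      unfolding abs_mult_sign .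
  next
    case False
    have "real i / 2 ^ k \<le> real (Suc i) / 2 ^ k" by (intro divide_right_mono) simp_all
    with False have "u = t" "v = t" unfolding u_def v_def by linarith+
    then show "2 * c * min \<bar>X (real i / 2 ^ k) \<omega>\<bar> K
        * (sign_integral X B k v \<omega> - sign_integral X B k u \<omega>)
        = 2 * X (real i / 2 ^ k) \<omega> * (c * (B v \<omega> - B u \<omega>))" by simp
  qed
qed

context filtered_prob_space
begin

lemma ito_square:
  assumes X: "progressive F X" and B: "real_wiener_process M F B"
    and Xc: "AE \<omega> in M. continuous_on {0..} (\<lambda>t. X t \<omega>)"
        and gc: "AE \<omega> in M. continuous_on {0..} (\<lambda>t. g t \<omega>)"
    and eq: "AE \<omega> in M. \<forall>t\<ge>0. X t \<omega> = X 0 \<omega> + integral {0..t} (\<lambda>s. g s \<omega>) + c * B t \<omega>"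
  shows "\<exists>w I. real_wiener_process M F w \<and> ito_integral M F w (\<lambda>t \<omega>. 2 * c * \<bar>X t \<omega>\<bar>) I \<and>
    (AE \<omega> in M. \<forall>t\<ge>0. I t \<omega> =
      (X t \<omega>)\<^sup>2 - (X 0 \<omega>)\<^sup>2 - (c\<^sup>2 * t + 2 * integral {0..t} (\<lambda>s. X s \<omega> * g s \<omega>)))"
proof -
  define L where "L t \<omega> = (X t \<omega>)\<^sup>2 - (X 0 \<omega>)\<^sup>2
      - (c\<^sup>2 * t + 2 * integral {0..t} (\<lambda>s. X s \<omega> * g s \<omega>))" for t \<omega>
  have Xad: "adapted F X" by (rule progressive_adapted[OF X])
  have Bc: "AE \<omega> in M. continuous_on {0..} (\<lambda>t. B t \<omega>)" using B by (simp add: wiener_process_def)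
  have \<sigma>p: "progressive F (\<lambda>t \<omega>. 2 * c * \<bar>X t \<omega>\<bar>)" by (rule progressive_compose[OF X]) measurable
  have \<sigma>i: "AE \<omega> in M. \<forall>T\<ge>0. set_integrable lborel {0..T} (\<lambda>s. (2 * c * \<bar>X s \<omega>\<bar>)\<^sup>2)"
    using Xc
  proof eventually_elim
    case (elim \<omega>)
    have "continuous_on {0..} (\<lambda>s. (2 * c * \<bar>X s \<omega>\<bar>)\<^sup>2)" by (intro continuous_intros elim)
    then show ?case using set_integral_continuous(1) by blast
  qed
  have path: "AE \<omega> in M. \<forall>T\<ge>0. uniform_limit {0..T} (\<lambda>j t. \<Sum>i<j * 2 ^ \<kappa> j. 2
      * X (real i / 2 ^ \<kappa> j) \<omega> *
      (c * (B (min (real (Suc i) / 2 ^ \<kappa> j) t) \<omega> - B (min (real i / 2 ^ \<kappa> j) t) \<omega>))) (\<lambda>t. L t \<omega>)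
          sequentially"
    if \<kappa>: "\<And>j. 3 * j \<le> \<kappa> j" for \<kappa>
    using Xc gc Bc eq wiener_quadratic_variation[OF B \<kappa>]
  proof eventually_elim
    case (elim \<omega>)
    have "j \<le> \<kappa> j" for j using \<kappa>[of j] by linarith
    moreover have "(\<lambda>j. (3 / 4 :: real) ^ j) \<longlonglongrightarrow> 0" by (rule LIMSEQ_realpow_zero) simp_all
    ultimately show ?case
      unfolding L_def using ito_square_pathwise[OF elim(1-3) _ _
          elim(5)[unfolded sq_variation_error_def], of c] elim(4)
      by blast
  qed
  show ?thesis
  proof (cases "c = 0")
    case True
    \<comment> \<open>For c = 0 every approximating sum is zero, so the pathwise limit itself shows
      that \<open>L\<close> vanishes; the levels 3 j are merely an admissible choice.\<close>
    have I0: "AE \<omega> in M. \<forall>t\<ge>0. L t \<omega> = 0"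
      using path[of "\<lambda>j. 3 * j", OF order_refl]
    proof eventually_elim
      case (elim \<omega>)
      show ?case
      proof (intro allI impI)
        fix t :: real assume "0 \<le> t"
        then have "(\<lambda>j. 0 :: real) \<longlonglongrightarrow> L t \<omega>"
          using tendsto_uniform_limitI[OF elim[rule_format], of t t] by (simp add: True)
        then show "L t \<omega> = 0" by (simp add: LIMSEQ_const_iff)
      qed
    qed
    have "ito_integral M F B (\<lambda>t \<omega>. 2 * c * \<bar>X t \<omega>\<bar>) (\<lambda>t \<omega>. 0)"
      unfolding ito_integral_def
    proof (intro conjI \<sigma>p \<sigma>i)
      show "adapted F (\<lambda>t \<omega>. 0 :: real)" by (simp add: adapted_def)
      show "\<exists>n \<tau> \<xi>. (\<forall>k. simple_process M F (n k) (\<tau> k) (\<xi> k)) \<and>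
        (AE \<omega> in M. \<forall>T\<ge>0.
           ((\<lambda>k. \<integral>\<^sup>+s\<in>{0..T}. ennreal ((simple_value (n k) (\<tau> k) (\<xi> k) s \<omega> - 2 * c * \<bar>X s \<omega>\<bar>)\<^sup>2)
               \<partial>lborel)
              \<longlonglongrightarrow> 0) \<and>
           uniform_limit {0..T} (\<lambda>k t. simple_integral_process B (n k) (\<tau> k) (\<xi> k) t \<omega>)
             (\<lambda>t. 0) sequentially)"
        by (intro exI[of _ "\<lambda>_. 0"] exI[of _ "\<lambda>_ _. 0"] exI[of _ "\<lambda>_ _ _. 0"] conjI)
          (simp_all add: simple_process_def simple_value_def simple_integral_process_def True
              uniform_limit_const)
    qed
    moreover have "AE \<omega> in M. \<forall>t\<ge>0. 0 = L t \<omega>" using I0 by eventually_elim simp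
    ultimately show ?thesis unfolding L_def using B by blast
  next
    case False
    have nz: "AE \<omega> in M. X u \<omega> \<noteq> 0" if u: "0 < u" for u
    proof (rule no_atom_at_zero[OF Xad B False u])
      show "AE \<omega> in M. \<exists>K. \<forall>h\<in>{0..u}. \<bar>X u \<omega> - X (u - h) \<omega> - c * (B u \<omega> - B (u - h) \<omega>)\<bar> \<le> K * h"
        using gc eq
      proof eventually_elim
        case (elim \<omega>)
        obtain K where K: "\<And>s. 0 \<le> s \<and> s \<le> u \<Longrightarrow> \<bar>g s \<omega>\<bar> \<le> K"
          using continuous_Icc_bounded[OF elim(1), of u] u by auto
        show ?case
        proof (intro exI[of _ K] ballI)
          fix h assume h: "h \<in> {0..u}"
          then have h': "0 \<le> u - h" "u - h \<le> u" "0 \<le> u" by auto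
          note i = integral_Icc_increment[OF elim(1) h'(1,2)]
          have "X u \<omega> - X (u - h) \<omega> - c * (B u \<omega> - B (u - h) \<omega>) = integral {u - h..u} (\<lambda>s. g s \<omega>)"
            unfolding i(1)[symmetric]
                using elim(2)[rule_format, OF h'(1)] elim(2)[rule_format, OF h'(3)]
            by (simp add: right_diff_distrib)
          moreover have "norm (integral {u - h..u} (\<lambda>s. g s \<omega>)) \<le> K * (u - (u - h))"
            using h by (intro integral_bound i(3)) (auto intro!: K)
          ultimately show "\<bar>X u \<omega> - X (u - h) \<omega> - c * (B u \<omega> - B (u - h) \<omega>)\<bar> \<le> K * h" by simp
        qed
      qed
    qed
    obtain \<kappa> w where \<kappa>: "\<And>j. 3 * j \<le> \<kappa> j" and w: "real_wiener_process M F w"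
      and dist: "\<And>j. (LINT \<omega>|M. (w (real j) \<omega> - sign_integral X B (\<kappa> j) (real j) \<omega>)\<^sup>2)
          \<le> (1 / 8) ^ j"
      using sign_wiener[OF Xad Xc nz B] by blast
    have \<kappa>': "j \<le> \<kappa> j" for j using \<kappa>[of j] by linarith
    define n where "n j = j * 2 ^ \<kappa> j" for j
    define \<tau> where "\<tau> j i = real i / 2 ^ \<kappa> j" for j i
    \<comment> \<open>Heights of simple processes must be bounded while X is not. The cut at j is
      eventually inactive for each path on each compact interval.\<close>
    define \<xi> where "\<xi> j i \<omega> = 2 * c * min \<bar>X (\<tau> j i) \<omega>\<bar> (real j)" for j i \<omega>
    define S where "S j = simple_integral_process w (n j) (\<tau> j) (\<xi> j)" for j
    define N where "N j = simple_integral_process (\<lambda>t \<omega>. w t \<omega> - sign_integral X B (\<kappa> j) t \<omega>) (n j)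
        (\<tau> j) (\<xi> j)" for j
    have \<tau>: "mono (\<tau> j)" "0 \<le> \<tau> j i" "\<tau> j (n j) = real j" for j i
      by (auto simp: \<tau>_def n_def intro!: monoI divide_right_mono)
    have \<xi>m: "\<xi> j i \<in> borel_measurable (F (\<tau> j i))" for j i
    proof -
      have [measurable]: "X (\<tau> j i) \<in> borel_measurable (F (\<tau> j i))"
          by (rule adaptedD[OF Xad \<tau>(2) order_refl])
      show ?thesis unfolding \<xi>_def[abs_def] by measurable
    qed
    have \<xi>b: "\<bar>\<xi> j i \<omega>\<bar> \<le> 2 * \<bar>c\<bar> * real j" for j i \<omega>
      unfolding \<xi>_def abs_mult by (intro mult_mono) auto
    have simple: "simple_process M F (n j) (\<tau> j) (\<xi> j)" for j
      unfolding simple_process_def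
    proof (intro conjI allI impI)
      show "\<tau> j i \<le> \<tau> j (Suc i)" for i using monoD[OF \<tau>(1)] by simp
      show "bounded (\<xi> j i ` space M)" for i
        using \<xi>b unfolding bounded_iff by (intro exI[of _ "2 * \<bar>c\<bar> * real j"]) auto
    qed (rule \<tau>(2) \<xi>m)+
    have wm: "sq_martingale w" by (rule wiener_sq_martingale[OF w])
    have Um: "sq_martingale (sign_integral X B (\<kappa> j))" for j
      by (rule wiener_sq_martingale[OF sign_integral_wiener[OF Xad B]])
    note Rm = sq_martingale_diff[OF wm Um]
    have wc: "AE \<omega> in M. continuous_on {0..} (\<lambda>t. w t \<omega>)" using w by (simp add: wiener_process_def)
    have Rc: "AE \<omega> in M. continuous_on {0..} (\<lambda>t. w t \<omega> - sign_integral X B (\<kappa> j) t \<omega>)" for j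
      using wc Bc by eventually_elim (intro continuous_on_diff sign_integral_continuous)
    have Sad: "adapted F (S j)" for j
      unfolding S_def by (rule sq_martingaleD(1)[OF sq_martingale_simple_integral(1)[OF wm \<tau>(1,2) \<xi>m
          \<xi>b]])
    have Nm: "sq_martingale (N j)" and N2:
        "(LINT \<omega>|M. (N j (real j) \<omega>)\<^sup>2) \<le> (2 * \<bar>c\<bar> * real j)\<^sup>2 * (1 / 8) ^ j" for j
    proof -
      note s = sq_martingale_simple_integral[where \<tau>="\<tau> j" and \<xi>="\<xi> j"
          and n="n j", OF Rm \<tau>(1,2) \<xi>m \<xi>b]
      show "sq_martingale (N j)" unfolding N_def by (rule s(1))
      have "(LINT \<omega>|M. (N j (real j) \<omega>)\<^sup>2) \<le> (2 * \<bar>c\<bar> * real j)\<^sup>2 *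
          (LINT \<omega>|M. (w (real j) \<omega> - sign_integral X B (\<kappa> j) (real j) \<omega>)\<^sup>2)"
        using s(2) unfolding N_def \<tau>(3) .
      also have "\<dots> \<le> (2 * \<bar>c\<bar> * real j)\<^sup>2 * (1 / 8) ^ j" by (intro mult_left_mono dist) simp
      finally show "(LINT \<omega>|M. (N j (real j) \<omega>)\<^sup>2) \<le> (2 * \<bar>c\<bar> * real j)\<^sup>2 * (1 / 8) ^ j" .
    qed
    have Nc: "AE \<omega> in M. continuous_on {0..} (\<lambda>t. N j t \<omega>)" for j
      using Rc[of j] unfolding N_def
          by eventually_elim (rule simple_integral_process_continuous[OF _ \<tau>(2)])
    have small: "AE \<omega> in M. \<forall>\<^sub>F j in sequentially. \<forall>t\<in>{0..real j}. \<bar>N j t \<omega>\<bar> \<le> (3 / 4) ^ j"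
    proof (rule sq_martingale_eventually_small[OF Nm Nc])
      \<comment> \<open>j^2 is at most 4^j, and 4/8 = (8/9) (9/16), where 9/16 belongs to the
        squared threshold.\<close>
      show "(LINT \<omega>|M. (N j (real j) \<omega>)\<^sup>2) / ((3 / 4) ^ j)\<^sup>2 \<le> (4 * c\<^sup>2) * (8 / 9) ^ j" for j
      proof -
        have "(2 * \<bar>c\<bar> * real j)\<^sup>2 * (1 / 8) ^ j = 4 * c\<^sup>2 * ((real j)\<^sup>2 * (1 / 8) ^ j)"
          by (simp add: power_mult_distrib)
        also have "\<dots> \<le> 4 * c\<^sup>2 * ((2 ^ j)\<^sup>2 * (1 / 8) ^ j)"
          using of_nat_less_two_power[of j, where 'a=real]
              by (intro mult_left_mono mult_right_mono power_mono) auto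
        also have "(2 ^ j)\<^sup>2 * (1 / 8) ^ j = (8 / 9 :: real) ^ j * ((3 / 4) ^ j)\<^sup>2"
          unfolding power2_eq_square power_mult_distrib[symmetric] by simp
        finally have "(2 * \<bar>c\<bar> * real j)\<^sup>2 * (1 / 8) ^ j
            \<le> 4 * c\<^sup>2 * ((8 / 9) ^ j * ((3 / 4) ^ j)\<^sup>2)" .
        from order_trans[OF N2 this]
        have "(LINT \<omega>|M. (N j (real j) \<omega>)\<^sup>2) \<le> (4 * c\<^sup>2) * (8 / 9) ^ j * ((3 / 4) ^ j)\<^sup>2"
          by (simp only: mult.assoc)
        then show ?thesis by (subst pos_divide_le_eq) simp_all
      qed
      show "summable (\<lambda>j. 4 * c\<^sup>2 * (8 / 9 :: real) ^ j)"
          by (intro summable_mult summable_geometric) simp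
    qed simp
    have uni: "AE \<omega> in M. \<forall>T\<ge>0. uniform_limit {0..T} (\<lambda>j t. S j t \<omega>) (\<lambda>t. L t \<omega>) sequentially"
      using Xc small path[OF \<kappa>]
    proof eventually_elim
      case (elim \<omega>)
      show ?case
      proof (intro allI impI)
        fix T :: real assume T: "0 \<le> T"
        obtain K where K: "\<And>s. 0 \<le> s \<and> s \<le> T \<Longrightarrow> \<bar>X s \<omega>\<bar> \<le> K"
          using continuous_Icc_bounded[OF elim(1) T] by blast
        have "uniform_limit {0..T} (\<lambda>j t. N j t \<omega>) (\<lambda>t. 0) sequentially"
        proof (rule uniform_limitI)
          fix e :: real assume "0 < e"
          have "(\<lambda>j. (3 / 4 :: real) ^ j) \<longlonglongrightarrow> 0" by (rule LIMSEQ_realpow_zero) simp_all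
          then have "\<forall>\<^sub>F j in sequentially. (3 / 4) ^ j < e" using \<open>0 < e\<close>
              by (rule order_tendstoD(2))
          with elim(2) eventually_le_real[of T]
          show "\<forall>\<^sub>F j in sequentially. \<forall>t\<in>{0..T}. dist (N j t \<omega>) 0 < e"
          proof eventually_elim
            case (elim j)
            show ?case
            proof
              fix t assume "t \<in> {0..T}"
              then have "t \<in> {0..real j}" using elim(2) by auto
              then have "\<bar>N j t \<omega>\<bar> \<le> (3 / 4) ^ j" using elim(1) by blast
              then show "dist (N j t \<omega>) 0 < e" using elim(3) by simp
            qed
          qed
        qed
        from uniform_limit_add[OF elim(3)[rule_format, OF T] this]
        have lim: "uniform_limit {0..T} (\<lambda>j t. (\<Sum>i<j * 2 ^ \<kappa> j. 2 * X (real i / 2 ^ \<kappa> j) \<omega> *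
          (c * (B (min (real (Suc i) / 2 ^ \<kappa> j) t) \<omega> - B (min (real i / 2 ^ \<kappa> j) t) \<omega>))) + N j t \<omega>)
              (\<lambda>t. L t \<omega> + 0) sequentially" .
        show "uniform_limit {0..T} (\<lambda>j t. S j t \<omega>) (\<lambda>t. L t \<omega>) sequentially"
        proof (rule iffD1[OF uniform_limit_cong lim])
          show "\<forall>\<^sub>F j in sequentially. \<forall>t\<in>{0..T}. (\<Sum>i<j * 2 ^ \<kappa> j. 2 * X (real i / 2 ^ \<kappa> j) \<omega> *
            (c * (B (min (real (Suc i) / 2 ^ \<kappa> j) t) \<omega> - B (min (real i / 2 ^ \<kappa> j) t) \<omega>))) + N j t \<omega>
                = S j t \<omega>"
            \<comment> \<open>K bounds the path of X on [0, T], so beyond j = K the truncation has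
              no effect and the exact identity of sums is available.\<close>
            using eventually_le_real[of K]
          proof eventually_elim
            case (elim j)
            show ?case
            proof
              fix t assume t: "t \<in> {0..T}"
              have "\<bar>X s \<omega>\<bar> \<le> real j" if "0 \<le> s" "s \<le> t" for s
              proof -
                have "0 \<le> s \<and> s \<le> T" using that t by auto
                then show ?thesis using K[of s] elim by linarith
              qed
              moreover have "0 \<le> t" using t by simp
              ultimately have "simple_integral_process (sign_integral X B (\<kappa> j)) (n j) (\<tau> j) (\<xi> j) t
                  \<omega>
                = (\<Sum>i<j * 2 ^ \<kappa> j. 2 * X (real i / 2 ^ \<kappa> j) \<omega> *
                  (c * (B (min (real (Suc i) / 2 ^ \<kappa> j) t) \<omega> - B (min (real i / 2 ^ \<kappa> j) t) \<omega>)))"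
                unfolding n_def \<tau>_def[abs_def] \<xi>_def[abs_def]
                    by (intro simple_integral_sign_integral)
              then show "(\<Sum>i<j * 2 ^ \<kappa> j. 2 * X (real i / 2 ^ \<kappa> j) \<omega> *
                  (c * (B (min (real (Suc i) / 2 ^ \<kappa> j) t) \<omega> - B (min (real i / 2 ^ \<kappa> j) t) \<omega>))) + N
                      j t \<omega> = S j t \<omega>"
                unfolding S_def N_def
                using simple_integral_process_add[of w "n j" "\<tau> j" "\<xi> j" t \<omega>
                    "sign_integral X B (\<kappa> j)"] by linarith
            qed
          qed
        qed simp
      qed
    qed
    have L2: "AE \<omega> in M. \<forall>T\<ge>0. (\<lambda>j. \<integral>\<^sup>+s\<in>{0..T}. ennreal
        ((simple_value (n j) (\<tau> j) (\<xi> j) s \<omega> - 2 * c * \<bar>X s \<omega>\<bar>)\<^sup>2) \<partial>lborel)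
        \<longlonglongrightarrow> 0"
      using Xc
    proof eventually_elim
      case (elim \<omega>)
      show ?case
      proof (intro allI impI)
        fix T :: real assume T: "0 \<le> T"
        obtain K where K: "\<And>s. 0 \<le> s \<and> s \<le> T \<Longrightarrow> \<bar>X s \<omega>\<bar> \<le> K"
          using continuous_Icc_bounded[OF elim T] by blast
        have c\<sigma>: "continuous_on {0..} (\<lambda>s. 2 * c * \<bar>X s \<omega>\<bar>)" by (intro continuous_intros elim)
        show "(\<lambda>j. \<integral>\<^sup>+s\<in>{0..T}. ennreal ((simple_value (n j) (\<tau> j) (\<xi> j) s \<omega> - 2 * c * \<bar>X s \<omega>\<bar>)\<^sup>2)
            \<partial>lborel) \<longlonglongrightarrow> 0"
          unfolding n_def \<tau>_def[abs_def]
        proof (rule simple_value_L2_tendsto[OF c\<sigma> \<kappa>' T])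
          show "\<forall>\<^sub>F j in sequentially. \<forall>i. real i / 2 ^ \<kappa> j \<le> T \<longrightarrow> \<xi> j i \<omega>
              = 2 * c * \<bar>X (real i / 2 ^ \<kappa> j) \<omega>\<bar>"
            using eventually_le_real[of K]
          proof eventually_elim
            case (elim j)
            show ?case
            proof (intro allI impI)
              fix i :: nat assume "real i / 2 ^ \<kappa> j \<le> T"
              then have "\<bar>X (real i / 2 ^ \<kappa> j) \<omega>\<bar> \<le> K" by (intro K) simp
              then have "\<bar>X (real i / 2 ^ \<kappa> j) \<omega>\<bar> \<le> real j" using elim by linarith
              then show "\<xi> j i \<omega> = 2 * c * \<bar>X (real i / 2 ^ \<kappa> j) \<omega>\<bar>"
                unfolding \<xi>_def \<tau>_def by (simp add: min_absorb1)
            qed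
          qed
        qed
      qed
    qed
    \<comment> \<open>\<open>L\<close> agrees with the limit only almost surely. The everywhere
      defined limit of the adapted \<open>S j\<close> is itself adapted, as
      \<open>ito_integral\<close> demands.\<close>
    define I where "I t \<omega> = lim (\<lambda>j. S j t \<omega>)" for t \<omega>
    have I_L: "AE \<omega> in M. \<forall>t\<ge>0. I t \<omega> = L t \<omega>"
      using uni
    proof eventually_elim
      case (elim \<omega>)
      show ?case
      proof (intro allI impI)
        fix t :: real assume t: "0 \<le> t"
        have "t \<in> {0..t}" using t by simp
        from tendsto_uniform_limitI[OF elim[rule_format, OF t] this]
        show "I t \<omega> = L t \<omega>" unfolding I_def by (rule limI)
      qed
    qed
    have Iad: "adapted F I"
      unfolding adapted_def
    proof (intro allI impI)
      fix t :: real assume "0 \<le> t"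
      then show "I t \<in> borel_measurable (F t)"
        unfolding I_def[abs_def] by (intro borel_measurable_lim_metric adaptedD[OF Sad]) auto
    qed
    have "AE \<omega> in M. \<forall>T\<ge>0.
        ((\<lambda>j. \<integral>\<^sup>+s\<in>{0..T}. ennreal ((simple_value (n j) (\<tau> j) (\<xi> j) s \<omega> - 2 * c * \<bar>X s \<omega>\<bar>)\<^sup>2)
            \<partial>lborel) \<longlonglongrightarrow> 0) \<and>
        uniform_limit {0..T} (\<lambda>j t. simple_integral_process w (n j) (\<tau> j) (\<xi> j) t \<omega>) (\<lambda>t. I t \<omega>)
            sequentially"
      using L2 uni I_L
    proof eventually_elim
      case (elim \<omega>)
      show ?case
      proof (intro allI impI conjI)
        fix T :: real assume T: "0 \<le> T"
        show "(\<lambda>j. \<integral>\<^sup>+s\<in>{0..T}. ennreal ((simple_value (n j) (\<tau> j) (\<xi> j) s \<omega> - 2 * c * \<bar>X s \<omega>\<bar>)\<^sup>2)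
            \<partial>lborel) \<longlonglongrightarrow> 0"
          by (rule elim(1)[rule_format, OF T])
        have "L t \<omega> = I t \<omega>" if "t \<in> {0..T}" for t using elim(3) that by simp
        from iffD1[OF uniform_limit_cong'[OF refl this] elim(2)[rule_format, OF T]]
        show "uniform_limit {0..T} (\<lambda>j t. simple_integral_process w (n j) (\<tau> j) (\<xi> j) t \<omega>)
            (\<lambda>t. I t \<omega>) sequentially"
          unfolding S_def .
      qed
    qed
    then have "ito_integral M F w (\<lambda>t \<omega>. 2 * c * \<bar>X t \<omega>\<bar>) I"
      unfolding ito_integral_def using simple \<sigma>p \<sigma>i Iad by blast
    with w I_L show ?thesis unfolding L_def by blast
  qed
qed

end

section \<open>The variance process\<close>

text \<open>Pairing with v turns the Bochner integral into a real one and moves A and \<eta> to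
  their adjoints. Continuity is read off the right-hand side, an indefinite integral plus a
  projection of W. It is applied to v = f for the process X and to v = \<open>adj A f\<close> for
  the continuity of its drift.\<close>

lemma strong_solution_projection:
  fixes W Y :: "real \<Rightarrow> 'w \<Rightarrow> 'h::{real_inner,banach,second_countable_topology}"
  assumes W: "wiener_process M F Q W" and Y: "strong_solution M F A \<eta> W Y\<^sub>0 Y"
  shows "AE \<omega> in M. continuous_on {0..} (\<lambda>t. Y t \<omega> \<bullet> v) \<and>
    (\<forall>t\<ge>0. Y t \<omega> \<bullet> v = Y 0 \<omega> \<bullet> v + integral {0..t} (\<lambda>s. Y s \<omega> \<bullet> adj A v) + W t \<omega> \<bullet> adj \<eta> v)"
proof -
  have "AE \<omega> in M. \<forall>t\<ge>0. set_integrable lborel {0..t} (\<lambda>s. A (Y s \<omega>)) \<and>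
        Y t \<omega> = Y\<^sub>0 + (LINT s:{0..t}|lborel. A (Y s \<omega>)) + \<eta> (W t \<omega>)"
    using Y by (simp add: strong_solution_def)
  moreover have "AE \<omega> in M. W 0 \<omega> = 0" "AE \<omega> in M. continuous_on {0..} (\<lambda>t. W t \<omega>)"
    using W by (simp_all add: wiener_process_def)
  ultimately show ?thesis
  proof eventually_elim
    case (elim \<omega>)
    define a where "a s = Y s \<omega> \<bullet> adj A v" for s
    have int: "set_integrable lborel {0..t} a"
        "(LINT s:{0..t}|lborel. A (Y s \<omega>)) \<bullet> v = (LINT s:{0..t}|lborel. a s)"
      if "0 \<le> t" for t
    proof -
      have i: "integrable lborel (\<lambda>s. indicator {0..t} s *\<^sub>R A (Y s \<omega>))"
        using elim(1) that unfolding set_integrable_def by blast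
      have eq: "(indicator {0..t} s *\<^sub>R A (Y s \<omega>)) \<bullet> v = indicator {0..t} s *\<^sub>R a s" for s
        by (simp add: a_def inner_adj)
      show "set_integrable lborel {0..t} a"
        using integrable_inner_left[OF i, of v] unfolding set_integrable_def eq by blast
      show "(LINT s:{0..t}|lborel. A (Y s \<omega>)) \<bullet> v = (LINT s:{0..t}|lborel. a s)"
        using integral_inner_left[OF i, of v] unfolding set_lebesgue_integral_def eq by (rule sym)
    qed
    have Yv: "Y t \<omega> \<bullet> v = Y\<^sub>0 \<bullet> v + integral {0..t} a + W t \<omega> \<bullet> adj \<eta> v" if t: "0 \<le> t" for t
    proof -
      have "Y t \<omega> = Y\<^sub>0 + (LINT s:{0..t}|lborel. A (Y s \<omega>)) + \<eta> (W t \<omega>)" using elim(1) t by blast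
      then have "Y t \<omega> \<bullet> v = Y\<^sub>0 \<bullet> v + (LINT s:{0..t}|lborel. A (Y s \<omega>)) \<bullet> v + \<eta> (W t \<omega>) \<bullet> v"
        by (simp only: inner_add_left)
      also have "(LINT s:{0..t}|lborel. A (Y s \<omega>)) \<bullet> v = integral {0..t} a"
        using int[OF t] set_borel_integral_eq_integral(2)[OF int(1)[OF t]] by simp
      finally show ?thesis by (simp only: inner_adj)
    qed
    have "continuous_on {0..} (\<lambda>t. Y\<^sub>0 \<bullet> v + integral {0..t} a + W t \<omega> \<bullet> adj \<eta> v)"
    proof (intro continuous_intros elim(3) continuous_on_Ici)
      fix t :: real assume "0 \<le> t"
      from set_borel_integral_eq_integral(1)[OF int(1)[OF this]]
      show "continuous_on {0..t} (\<lambda>t. integral {0..t} a)" by (rule indefinite_integral_continuous_1)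
    qed
    then have "continuous_on {0..} (\<lambda>t. Y t \<omega> \<bullet> v)"
      by (rule continuous_on_eq) (simp add: Yv)
    moreover have "Y 0 \<omega> \<bullet> v = Y\<^sub>0 \<bullet> v" using Yv[of 0] elim(2) by simp
    ultimately show ?case using Yv unfolding a_def by simp
  qed
qed

text \<open>The product c * B, in place of a quotient, covers the degenerate direction too: c = 0
  forces h = 0, and both sides are then zero for every B.\<close>

lemma (in filtered_prob_space) wiener_projection_scaled:
  fixes W :: "real \<Rightarrow> 'w \<Rightarrow> 'h::{real_inner,banach,second_countable_topology}"
  assumes W: "wiener_process M F Q W" and Q: "positive_definite Q" and x: "\<exists>x::'h. x \<noteq> 0"
    and c: "c\<^sup>2 = Q h \<bullet> h"
  shows "\<exists>B. real_wiener_process M F B \<and> (\<forall>t \<omega>. c * B t \<omega> = W t \<omega> \<bullet> h)"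
proof (cases "c = 0")
  case True
  then have "h = 0" using c Q unfolding positive_definite_def by force
  obtain x :: 'h where "x \<noteq> 0" using x by blast
  then have "0 < Q x \<bullet> x" using Q unfolding positive_definite_def by blast
  then have "real_wiener_process M F (\<lambda>t \<omega>. (W t \<omega> \<bullet> x) / sqrt (Q x \<bullet> x))"
    by (intro real_wiener_projection[OF W]) auto
  then show ?thesis using True \<open>h = 0\<close> by auto
next
  case False
  then have "real_wiener_process M F (\<lambda>t \<omega>. (W t \<omega> \<bullet> h) / c)"
    using c by (intro real_wiener_projection[OF W]) auto
  then show ?thesis using False by (intro exI[of _ "\<lambda>t \<omega>. (W t \<omega> \<bullet> h) / c"]) simp
qed

theorem proposition13:
  fixes M :: "'w measure" and F :: "real \<Rightarrow> 'w measure"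
    and Q A \<eta> :: "'h::{real_inner,banach,second_countable_topology} \<Rightarrow>\<^sub>L 'h"
    and W Y :: "real \<Rightarrow> 'w \<Rightarrow> 'h" and Y\<^sub>0 f :: 'h
    and \<V> :: "real \<Rightarrow> 'w \<Rightarrow> ('h \<Rightarrow>\<^sub>L 'h)" and V :: "real \<Rightarrow> 'w \<Rightarrow> real" and c :: real
  assumes "filtered_prob_space M F"
    and "\<exists>x::'h. x \<noteq> 0"
    and "self_adjoint Q" and "positive_definite Q" and "trace_class Q"
    and "wiener_process M F Q W"
    and "strong_solution M F A \<eta> W Y\<^sub>0 Y"
  defines "\<V> \<equiv> heston_variance Y"
    and "V \<equiv> (\<lambda>t \<omega>. Lfun f (\<V> t \<omega>))"
    and "c \<equiv> norm (op_sqrt Q (adj \<eta> f))"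
  shows "(\<forall>t \<omega>. V t \<omega> = (Y t \<omega> \<bullet> f)\<^sup>2) \<and>
    (\<exists>w. real_wiener_process M F w \<and>
      has_ito_differential M F w V
        (\<lambda>t \<omega>. V t \<omega> + c\<^sup>2 + Lfun (adj A f) (\<V> t \<omega>) - Lfun ((adj A - id_blinfun) f) (\<V> t \<omega>))
        (\<lambda>t \<omega>. 2 * c * sqrt (V t \<omega>)))"
proof -
  interpret filtered_prob_space M F by fact
  define X where "X t \<omega> = Y t \<omega> \<bullet> f" for t \<omega>
  define g where "g t \<omega> = Y t \<omega> \<bullet> adj A f" for t \<omega>
  have L: "Lfun e (\<V> t \<omega>) = (Y t \<omega> \<bullet> e)\<^sup>2" for e t \<omega>
    unfolding \<V>_def heston_variance_def by (rule Lfun_tensor)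
  have V: "V t \<omega> = (X t \<omega>)\<^sup>2" for t \<omega> unfolding V_def L X_def ..
  have sqrt_V: "sqrt (V t \<omega>) = \<bar>X t \<omega>\<bar>" for t \<omega> unfolding V by simp
  have "nonneg_definite Q"
    unfolding nonneg_definite_def
  proof
    fix x show "0 \<le> Q x \<bullet> x"
      using \<open>positive_definite Q\<close> by (cases "x = 0") (auto simp: positive_definite_def less_imp_le)
  qed
  with \<open>self_adjoint Q\<close> have "c\<^sup>2 = Q (adj \<eta> f) \<bullet> adj \<eta> f" unfolding c_def by (rule norm_op_sqrt)
  then obtain B where B: "real_wiener_process M F B" "\<And>t \<omega>. c * B t \<omega> = W t \<omega> \<bullet> adj \<eta> f"
    using wiener_projection_scaled[OF assms(6,4,2)] by blast
  have Xp: "progressive F X"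
  proof -
    have "progressive F Y" using assms(7) by (simp add: strong_solution_def)
    then show ?thesis unfolding X_def[abs_def] by (rule progressive_compose) measurable
  qed
  note proj = strong_solution_projection[OF assms(6,7)]
  have Xc: "AE \<omega> in M. continuous_on {0..} (\<lambda>t. X t \<omega>)"
    using proj[of f] unfolding X_def by eventually_elim blast
  have gc: "AE \<omega> in M. continuous_on {0..} (\<lambda>t. g t \<omega>)"
    using proj[of "adj A f"] unfolding g_def by eventually_elim blast
  have eq: "AE \<omega> in M. \<forall>t\<ge>0. X t \<omega> = X 0 \<omega> + integral {0..t} (\<lambda>s. g s \<omega>) + c * B t \<omega>"
    using proj[of f] unfolding X_def g_def B(2) by eventually_elim blast
  obtain w I where w: "real_wiener_process M F w"
      and I: "ito_integral M F w (\<lambda>t \<omega>. 2 * c * \<bar>X t \<omega>\<bar>) I"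
    and I_eq: "AE \<omega> in M. \<forall>t\<ge>0. I t \<omega> =
      (X t \<omega>)\<^sup>2 - (X 0 \<omega>)\<^sup>2 - (c\<^sup>2 * t + 2 * integral {0..t} (\<lambda>s. X s \<omega> * g s \<omega>))"
    using ito_square[OF Xp B(1) Xc gc eq] by blast
  \<comment> \<open>With x = \<open>Y t \<omega> \<bullet> f\<close> and y =
    \<open>Y t \<omega> \<bullet> adj A f\<close> this is x^2 + y^2 - (y - x)^2 = 2 x y.\<close>
  have drift: "V t \<omega> + c\<^sup>2 + Lfun (adj A f) (\<V> t \<omega>) - Lfun ((adj A - id_blinfun) f) (\<V> t \<omega>)
      = c\<^sup>2 + 2 * (X t \<omega> * g t \<omega>)" for t \<omega>
    unfolding L V X_def g_def
    by (simp add: blinfun.diff_left inner_diff_right power2_eq_square algebra_simps)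
  have "has_ito_differential M F w V
      (\<lambda>t \<omega>. V t \<omega> + c\<^sup>2 + Lfun (adj A f) (\<V> t \<omega>) - Lfun ((adj A - id_blinfun) f) (\<V> t \<omega>))
      (\<lambda>t \<omega>. 2 * c * sqrt (V t \<omega>))"
    unfolding drift sqrt_V
    unfolding has_ito_differential_def V
  proof (intro exI[of _ I] conjI I)
    show "AE \<omega> in M. \<forall>t\<ge>0. set_integrable lborel {0..t} (\<lambda>s. c\<^sup>2 + 2 * (X s \<omega> * g s \<omega>)) \<and>
        (X t \<omega>)\<^sup>2 = (X 0 \<omega>)\<^sup>2 + (LINT s:{0..t}|lborel. c\<^sup>2 + 2 * (X s \<omega> * g s \<omega>)) + I t \<omega>"
      using Xc gc I_eq
    proof eventually_elim
      case (elim \<omega>)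
      have cXg: "continuous_on {0..} (\<lambda>s. X s \<omega> * g s \<omega>)" by (intro continuous_intros elim(1,2))
      have cb: "continuous_on {0..} (\<lambda>s. c\<^sup>2 + 2 * (X s \<omega> * g s \<omega>))"
        by (intro continuous_intros elim(1,2))
      have "integral {0..t} (\<lambda>s. c\<^sup>2 + 2 * (X s \<omega> * g s \<omega>))
          = c\<^sup>2 * t + 2 * integral {0..t} (\<lambda>s. X s \<omega> * g s \<omega>)"
        if t: "0 \<le> t" for t
      proof -
        have "(\<lambda>s. X s \<omega> * g s \<omega>) integrable_on {0..t}"
          by (rule integral_Icc_increment(2)[OF cXg order_refl t])
        then have "((\<lambda>s. c\<^sup>2 + 2 * (X s \<omega> * g s \<omega>)) has_integral
            (t - 0) *\<^sub>R c\<^sup>2 + 2 * integral {0..t} (\<lambda>s. X s \<omega> * g s \<omega>)) {0..t}"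
          using has_integral_const_real[of "c\<^sup>2" 0 t] t
          by (intro has_integral_add has_integral_mult_right integrable_integral)
              (simp_all add: content_real)
        then show ?thesis by (simp add: integral_unique mult.commute)
      qed
      then show ?case
        using set_integral_continuous[OF cb] elim(3) by simp
    qed
  qed
  with V w show ?thesis unfolding X_def by blast
qed

end
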